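(* Fix constants $1\le r<k$. Consider the following problem: given a set $S$ with $|S|=n$, a family $\mathcal{A}$ of $k$-subsets of $S$ whose size $m=|\mathcal{A}|$ is polynomially bounded in $n$, and an integer $s=\gamma n$ with $r<s<n$, find a set $B\subseteq S$ with $|B|=s$ maximizing the number of groups $A\in\mathcal{A}$ with $|A\cap B|\ge r$, and compute this maximum $f(\gamma;S,\mathcal{A},\mu)$. This problem is NP-hard.
   Context: $S$ is a set of nodes and the members of $\mathcal{A}$ are called groups. Here $r$ is the smallest integer strictly greater than $\mu k$ for an authentication threshold $\mu$; an adversary corrupting a set $B$ of $s=\gamma n$ nodes corrupts a group $A$ iff $|A\cap B|>\mu k$, i.e. $|A\cap B|\ge r$, and $$f(\gamma;S,\mathcal{A},\mu):=\max_{B\subseteq S,\ |B|=\gamma n}\big|\{A\in\mathcal{A} : |A\cap B|\ge r\}\big| .$$ NP-hardness is with respect to polynomial-time reductions, with $r,k$ fixed constants not part of the input. *)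

theory Defs
  imports "HOL-Computational_Algebra.Polynomial"
begin

section \<open>Polynomial-time computation\<close>

text \<open>
  The machine model: programs with finite control acting on finitely many stacks of bits. A
  multitape Turing machine with any finite alphabet is simulated by such a program with constant
  overhead per step (each tape is a pair of stacks, each symbol a fixed-length block of bits), and
  conversely, so polynomial time has its usual meaning here.

  \<open>Pop i e f t\<close> removes the top bit of stack \<open>i\<close> and jumps to \<open>f\<close> or \<open>t\<close> according to its value;
  if the stack is empty it jumps to \<open>e\<close>. A program halts by jumping, or running, past its end.
\<close>

type_synonym word = "bool list"

datatype instr = Push nat bool | Pop nat nat nat nat

type_synonym config = "nat \<times> (nat \<Rightarrow> word)"

fun exec :: "instr \<Rightarrow> config \<Rightarrow> config" where
  "exec (Push i b) (pc, \<sigma>) = (Suc pc, \<sigma>(i := b # \<sigma> i))"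
| "exec (Pop i e f t) (pc, \<sigma>) =
    (case \<sigma> i of [] \<Rightarrow> (e, \<sigma>) | b # w \<Rightarrow> (if b then t else f, \<sigma>(i := w)))"

definition step :: "instr list \<Rightarrow> config \<Rightarrow> config" where
  "step P c = (if fst c < length P then exec (P ! fst c) c else c)"

text \<open>Inputs are on the stacks \<open>0, 1, \<dots>\<close>, all other stacks are initially empty.\<close>

definition start :: "word list \<Rightarrow> config" where
  "start ws = (0, \<lambda>i. if i < length ws then ws ! i else [])"

text \<open>On inputs \<open>ws\<close>, \<open>P\<close> halts after at most \<open>t\<close> steps with output \<open>out\<close> on stack \<open>0\<close>.\<close>

definition computes_within :: "instr list \<Rightarrow> word list \<Rightarrow> nat \<Rightarrow> word \<Rightarrow> bool" where
  "computes_within P ws t out \<longleftrightarrow>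
    (let c = (step P ^^ t) (start ws) in length P \<le> fst c \<and> snd c 0 = out)"

definition polytime_function :: "(word \<Rightarrow> word) \<Rightarrow> bool" where
  "polytime_function g \<longleftrightarrow>
    (\<exists>P (p :: nat poly). \<forall>x. computes_within P [x] (poly p (length x)) (g x))"

definition polytime_relation :: "(word \<Rightarrow> word \<Rightarrow> bool) \<Rightarrow> bool" where
  "polytime_relation V \<longleftrightarrow>
    (\<exists>P (p :: nat poly). \<forall>x y.
       computes_within P [x, y] (poly p (length x + length y)) [V x y])"


section \<open>NP and NP-hardness of search problems\<close>

definition NP :: "word set set" where
  "NP = {L. \<exists>V (p :: nat poly). polytime_relation V \<and>
      (\<forall>x. x \<in> L \<longleftrightarrow> (\<exists>y. length y \<le> poly p (length x) \<and> V x y))}"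

text \<open>
  A search problem is the set of pairs of an instance and a correct answer to it. A language
  reduces to it if membership of \<open>x\<close> can be decided in polynomial time from \<open>x\<close> and an arbitrary
  correct answer to an instance \<open>g x\<close> computed from \<open>x\<close> in polynomial time. This is the usual
  polynomial-time reduction between function problems; it is a polynomial-time Turing reduction
  that makes a single query.
\<close>

definition reduces_to :: "word set \<Rightarrow> (word \<times> word) set \<Rightarrow> bool" where
  "reduces_to L R \<longleftrightarrow>
    (\<exists>g h. polytime_function g \<and> polytime_relation h \<and>
      (\<forall>x. g x \<in> Domain R \<and> (\<forall>y. (g x, y) \<in> R \<longrightarrow> (x \<in> L \<longleftrightarrow> h x y))))"

definition NP_hard :: "(word \<times> word) set \<Rightarrow> bool" where
  "NP_hard R \<longleftrightarrow> (\<forall>L\<in>NP. reduces_to L R)"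


section \<open>Encodings\<close>

text \<open>
  All codes are prefix-free, so they can be concatenated. Numbers are written in unary; this is
  only applied to \<open>s < |S|\<close> and to a number of groups, and both \<open>S\<close> and the family of groups are
  listed explicitly, so no encoding becomes more than polynomially longer than in binary.
\<close>

definition enc_nat :: "nat \<Rightarrow> word" where
  "enc_nat n = replicate n True @ [False]"

definition enc_list :: "('a \<Rightarrow> word) \<Rightarrow> 'a list \<Rightarrow> word" where
  "enc_list e xs = concat (map (\<lambda>x. True # e x) xs) @ [False]"

definition enc_word :: "word \<Rightarrow> word" where
  "enc_word = enc_list (\<lambda>b. [b])"

text \<open>Nodes are arbitrary words; sets are listed without repetition, in any order.\<close>

definition encodes_instance :: "word \<Rightarrow> word set \<Rightarrow> word set set \<Rightarrow> nat \<Rightarrow> bool" where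
  "encodes_instance w S \<A> s \<longleftrightarrow>
    (\<exists>xs gs. w = enc_list enc_word xs @ enc_list (enc_list enc_word) gs @ enc_nat s \<and>
       distinct xs \<and> set xs = S \<and>
       (\<forall>g\<in>set gs. distinct g) \<and> distinct (map set gs) \<and> set (map set gs) = \<A>)"

definition encodes_answer :: "word \<Rightarrow> word set \<Rightarrow> nat \<Rightarrow> bool" where
  "encodes_answer w B v \<longleftrightarrow>
    (\<exists>xs. w = enc_list enc_word xs @ enc_nat v \<and> distinct xs \<and> set xs = B)"

lemma enc_nat_prefix_free: "enc_nat m @ u = enc_nat n @ v \<longleftrightarrow> m = n \<and> u = v"
proof (induction m arbitrary: n)
  case 0
  then show ?case by (cases n) (auto simp: enc_nat_def)
next
  case (Suc m)
  then show ?case by (cases n) (auto simp: enc_nat_def)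
qed

lemma enc_list_prefix_free:
  assumes "\<And>x y u v. e x @ u = e y @ v \<longleftrightarrow> x = y \<and> u = v"
  shows "enc_list e xs @ u = enc_list e ys @ v \<longleftrightarrow> xs = ys \<and> u = v"
proof (induction xs arbitrary: ys)
  case Nil
  then show ?case by (cases ys) (auto simp: enc_list_def)
next
  case (Cons x xs)
  then show ?case by (cases ys) (auto simp: enc_list_def assms)
qed

lemma enc_word_prefix_free: "enc_word x @ u = enc_word y @ v \<longleftrightarrow> x = y \<and> u = v"
  unfolding enc_word_def by (rule enc_list_prefix_free) simp

lemma encodes_instance_unique:
  assumes "encodes_instance w S \<A> s" "encodes_instance w S' \<A>' s'"
  shows "S = S' \<and> \<A> = \<A>' \<and> s = s'"
proof -
  have "enc_nat m = enc_nat n \<longleftrightarrow> m = n" for m n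
    using enc_nat_prefix_free[of m "[]" n "[]"] by simp
  with assms show ?thesis
    unfolding encodes_instance_def
    by (auto simp: enc_list_prefix_free enc_word_prefix_free)
qed

lemma encodes_answer_unique:
  assumes "encodes_answer w B v" "encodes_answer w B' v'"
  shows "B = B' \<and> v = v'"
proof -
  have "enc_nat m = enc_nat n \<longleftrightarrow> m = n" for m n
    using enc_nat_prefix_free[of m "[]" n "[]"] by simp
  with assms show ?thesis
    unfolding encodes_answer_def
    by (auto simp: enc_list_prefix_free enc_word_prefix_free)
qed


section \<open>Corrupting groups\<close>

text \<open>
  For \<open>\<mu> \<ge> 0\<close> this is the smallest integer strictly greater than \<open>\<mu> k\<close>. A negative \<open>\<mu>\<close> gives
  \<open>0\<close>, which \<open>1 \<le> r\<close> excludes.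
\<close>

definition threshold :: "real \<Rightarrow> nat \<Rightarrow> nat" where
  "threshold \<mu> k = (LEAST r. \<mu> * real k < real r)"

definition corrupted :: "real \<Rightarrow> nat \<Rightarrow> 'a set set \<Rightarrow> 'a set \<Rightarrow> 'a set set" where
  "corrupted \<mu> k \<A> B = {A \<in> \<A>. threshold \<mu> k \<le> card (A \<inter> B)}"

text \<open>The quantity \<open>f(\<gamma>; S, \<A>, \<mu>)\<close>, where \<open>k\<close> is the common size of the groups.\<close>

definition max_corrupted :: "real \<Rightarrow> 'a set \<Rightarrow> 'a set set \<Rightarrow> real \<Rightarrow> nat \<Rightarrow> nat" where
  "max_corrupted \<gamma> S \<A> \<mu> k =
    Max ((\<lambda>B. card (corrupted \<mu> k \<A> B)) ` {B. B \<subseteq> S \<and> real (card B) = \<gamma> * real (card S)})"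

text \<open>
  \<open>p\<close> is the polynomial bounding the number of groups in terms of the number of nodes.
\<close>

definition valid_instance ::
    "real \<Rightarrow> nat \<Rightarrow> nat poly \<Rightarrow> 'a set \<Rightarrow> 'a set set \<Rightarrow> nat \<Rightarrow> bool" where
  "valid_instance \<mu> k p S \<A> s \<longleftrightarrow>
    finite S \<and> (\<forall>A\<in>\<A>. A \<subseteq> S \<and> card A = k) \<and> card \<A> \<le> poly p (card S) \<and>
    threshold \<mu> k < s \<and> s < card S"

definition optimal_answer ::
    "real \<Rightarrow> nat \<Rightarrow> 'a set \<Rightarrow> 'a set set \<Rightarrow> nat \<Rightarrow> 'a set \<Rightarrow> nat \<Rightarrow> bool" where
  "optimal_answer \<mu> k S \<A> s B v \<longleftrightarrow>
    B \<subseteq> S \<and> card B = s \<and>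
    (\<forall>B'. B' \<subseteq> S \<and> card B' = s \<longrightarrow>
       card (corrupted \<mu> k \<A> B') \<le> card (corrupted \<mu> k \<A> B)) \<and>
    v = max_corrupted (real s / real (card S)) S \<A> \<mu> k"

definition corruption_problem :: "real \<Rightarrow> nat \<Rightarrow> nat poly \<Rightarrow> (word \<times> word) set" where
  "corruption_problem \<mu> k p =
    {(w, y). \<exists>S \<A> s B v. encodes_instance w S \<A> s \<and> encodes_answer y B v \<and>
       valid_instance \<mu> k p S \<A> s \<and> optimal_answer \<mu> k S \<A> s B v}"

end

theory Submission imports Defs
begin

text \<open>
  The proof is a direct Cook-Levin reduction. A run of a verifier is described by one vertex for
  every time \<open>\<tau>\<close> and stack \<open>i\<close>: it records the program counters at times \<open>\<tau>\<close> and \<open>Suc \<tau>\<close>, and for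
  these two times a pointer to the top of stack \<open>i\<close>, namely the successor of the time at which the
  top bit was pushed (\<open>0\<close> if the stack is empty). A pop at time \<open>\<tau>\<close> then only has to be compared with
  the vertex of the push that it undoes, so all conditions on a run are conditions on single
  vertices or on pairs of vertices, and \<open>x \<in> L\<close> iff a certain graph on \<open>N ^ 6\<close> vertices has an
  independent set of size \<open>N ^ 2\<close>.

  With \<open>t = k - r\<close>, an edge is padded to groups of size \<open>k\<close> by one of many disjoint blocks of \<open>t - 1\<close>
  nodes and by \<open>r - 1\<close> nodes common to all groups. A set \<open>B\<close> corrupts a group iff its complement
  contains at most \<open>t\<close> nodes of it. For the right size of \<open>B\<close>, counting shows that the complement of a
  set corrupting all groups contains a whole block and no common node, hence at most one end of
  every edge. So it suffices to ask whether the optimum is the number of groups.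

  The instance consists of lists of tuples of numbers below \<open>N\<close> that satisfy simple conditions; it is
  written by a program of nested loops over unary counters.
\<close>

section \<open>Structured programs\<close>

text \<open>A tableau cell holding the contents of a stack would range over exponentially many
  values. A pointer is a number below \<open>N\<close>, and it determines the whole stack: what lies
  under the top bit is the stack as it was just before that bit was pushed. Hence comparing pairs of
  vertices suffices. A vertex has 6 fields, which gives \<open>N ^ 6\<close> vertices;
  \<open>N ^ 2\<close> is the number of pairs of a time and a stack, and an independent set of that
  size must choose one vertex for each pair.

  The obstacle in the padding is that the adversary may spend its nodes on the padding instead of on
  vertices. Corrupting one node in a single block would help every group at once, so there are as
  many blocks as vertices, each combined with every edge. The budget is smaller than the number of
  blocks, so if blocks are nonempty, some block stays untouched, and the groups over this block
  alone force an end of each edge to be corrupted. Since \<open>r\<close> and \<open>k\<close> are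
  constants, blocks have constant size and the instance stays polynomial.\<close>

type_synonym stacks = "nat \<Rightarrow> word"

datatype com = Skip | Psh nat bool | Seq com com | Case nat com com com | While nat com com

text \<open>The times are the exact step counts of the compiled code: a test is one
  \<open>Pop\<close>, and leaving a branch costs a \<open>jump\<close> of two steps. In
  \<open>Case\<close> the branch for \<open>True\<close> is laid out last and falls through, hence
  \<open>t + 1\<close> instead of \<open>t + 3\<close>.\<close>

inductive big :: "com \<Rightarrow> stacks \<Rightarrow> nat \<Rightarrow> stacks \<Rightarrow> bool" where
  Skip: "big Skip \<sigma> 0 \<sigma>"
| Psh: "big (Psh i b) \<sigma> 1 (\<sigma>(i := b # \<sigma> i))"
| Seq: "big c \<sigma> t \<sigma>' \<Longrightarrow> big d \<sigma>' t' \<sigma>'' \<Longrightarrow> big (Seq c d) \<sigma> (t + t') \<sigma>''"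
| CaseE: "\<sigma> i = [] \<Longrightarrow> big ce \<sigma> t \<sigma>' \<Longrightarrow> big (Case i ce cf ct) \<sigma> (t + 3) \<sigma>'"
| CaseF: "\<sigma> i = False # w \<Longrightarrow> big cf (\<sigma>(i := w)) t \<sigma>' \<Longrightarrow> big (Case i ce cf ct) \<sigma> (t + 3) \<sigma>'"
| CaseT: "\<sigma> i = True # w \<Longrightarrow> big ct (\<sigma>(i := w)) t \<sigma>' \<Longrightarrow> big (Case i ce cf ct) \<sigma> (t + 1) \<sigma>'"
| WhileE: "\<sigma> i = [] \<Longrightarrow> big (While i cf ct) \<sigma> 1 \<sigma>"
| WhileF: "\<sigma> i = False # w \<Longrightarrow> big cf (\<sigma>(i := w)) t \<sigma>' \<Longrightarrow> big (While i cf ct) \<sigma>' t' \<sigma>'' \<Longrightarrow>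
    big (While i cf ct) \<sigma> (t + 3 + t') \<sigma>''"
| WhileT: "\<sigma> i = True # w \<Longrightarrow> big ct (\<sigma>(i := w)) t \<sigma>' \<Longrightarrow> big (While i cf ct) \<sigma>' t' \<sigma>'' \<Longrightarrow>
    big (While i cf ct) \<sigma> (t + 3 + t') \<sigma>''"

text \<open>The machine has no unconditional jump. Popping a bit that was just pushed restores stack
  0 and, with equal targets, always leads to \<open>l\<close>.\<close>

definition jump :: "nat \<Rightarrow> instr list" where
  "jump l = [Push 0 True, Pop 0 l l l]"

fun code_len :: "com \<Rightarrow> nat" where
  "code_len Skip = 0"
| "code_len (Psh i b) = 1"
| "code_len (Seq c d) = code_len c + code_len d"
| "code_len (Case i ce cf ct) = code_len ce + code_len cf + code_len ct + 5"
| "code_len (While i cf ct) = code_len cf + code_len ct + 5"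

text \<open>Jump targets are absolute, so the compiler needs the address \<open>n\<close> at which
  its code will be placed.\<close>

fun compile :: "nat \<Rightarrow> com \<Rightarrow> instr list" where
  "compile n Skip = []"
| "compile n (Psh i b) = [Push i b]"
| "compile n (Seq c d) = compile n c @ compile (n + code_len c) d"
| "compile n (Case i ce cf ct) =
    (let f = n + 3 + code_len ce; t = f + 2 + code_len cf; l = t + code_len ct
     in Pop i (n + 1) f t # compile (n + 1) ce @ jump l @ compile f cf @ jump l @ compile t ct)"
| "compile n (While i cf ct) =
    (let t = n + 3 + code_len cf; l = t + 2 + code_len ct
     in Pop i l (n + 1) t # compile (n + 1) cf @ jump n @ compile t ct @ jump n)"

lemma length_compile [simp]: "length (compile n c) = code_len c"
  by (induction c arbitrary: n) (auto simp: jump_def Let_def)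

definition code_at :: "instr list \<Rightarrow> nat \<Rightarrow> instr list \<Rightarrow> bool" where
  "code_at P n xs \<longleftrightarrow> (\<forall>j<length xs. n + j < length P \<and> P ! (n + j) = xs ! j)"

lemma code_at_Nil [simp]: "code_at P n []"
  by (simp add: code_at_def)

lemma code_at_Cons [simp]:
  "code_at P n (x # xs) \<longleftrightarrow> n < length P \<and> P ! n = x \<and> code_at P (Suc n) xs"
  by (auto simp: code_at_def less_Suc_eq_0_disj)

lemma code_at_append [simp]:
  "code_at P n (xs @ ys) \<longleftrightarrow> code_at P n xs \<and> code_at P (n + length xs) ys"
  by (induction xs arbitrary: n) auto

lemma steps_add: "(step P ^^ s) c = c' \<Longrightarrow> (step P ^^ t) c' = c'' \<Longrightarrow> (step P ^^ (s + t)) c = c''"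
  using funpow_add[of t s "step P"] by (simp add: add.commute)

lemma steps_jump:
  assumes "code_at P n (jump l)"
  shows "(step P ^^ 2) (n, \<sigma>) = (l, \<sigma>)"
  using assms by (auto simp: jump_def step_def numeral_2_eq_2)

lemma steps_pop:
  assumes "code_at P n [Pop i e f t]"
  shows "(step P ^^ 1) (n, \<sigma>) =
    (case \<sigma> i of [] \<Rightarrow> (e, \<sigma>) | b # w \<Rightarrow> (if b then t else f, \<sigma>(i := w)))"
  using assms by (auto simp: step_def split: list.splits)

text \<open>Induction on the evaluation and not on the command: after one iteration a
  \<open>While\<close> is executed again by the same code at the same address, and only the
  derivation has become smaller.\<close>

lemma compile_correct:
  assumes "big c \<sigma> t \<sigma>'" and "code_at P n (compile n c)"
  shows "(step P ^^ t) (n, \<sigma>) = (n + code_len c, \<sigma>')"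
  using assms
proof (induction arbitrary: n rule: big.induct)
  case (Skip \<sigma>)
  then show ?case by simp
next
  case (Psh i b \<sigma>)
  then show ?case by (auto simp: step_def fun_upd_def)
next
  case (Seq c \<sigma> t \<sigma>' d t' \<sigma>'')
  then show ?case
    using steps_add[OF Seq.IH(1)[of n] Seq.IH(2)] by (simp add: add.assoc)
next
  case (CaseE \<sigma> i ce t \<sigma>' cf ct)
  let ?f = "n + 3 + code_len ce"
  let ?t = "?f + 2 + code_len cf"
  let ?l = "?t + code_len ct"
  have 1: "(step P ^^ 1) (n, \<sigma>) = (n + 1, \<sigma>)"
    using CaseE steps_pop[of P n i "n + 1" ?f ?t \<sigma>] by (simp add: Let_def)
  have 2: "(step P ^^ t) (n + 1, \<sigma>) = (n + 1 + code_len ce, \<sigma>')"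
    using CaseE by (simp add: Let_def)
  have 3: "(step P ^^ 2) (n + 1 + code_len ce, \<sigma>') = (?l, \<sigma>')"
    by (rule steps_jump) (use CaseE in \<open>simp add: Let_def add_ac eval_nat_numeral\<close>)
  show ?case
    using steps_add[OF steps_add[OF 1 2] 3] by (simp del: funpow.simps add: add_ac eval_nat_numeral)
next
  case (CaseF \<sigma> i w cf t \<sigma>' ce ct)
  let ?f = "n + 3 + code_len ce"
  let ?t = "?f + 2 + code_len cf"
  let ?l = "?t + code_len ct"
  have 1: "(step P ^^ 1) (n, \<sigma>) = (?f, \<sigma>(i := w))"
    using CaseF steps_pop[of P n i "n + 1" ?f ?t \<sigma>] by (simp add: Let_def)
  have 2: "(step P ^^ t) (?f, \<sigma>(i := w)) = (?f + code_len cf, \<sigma>')"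
    by (rule CaseF.IH) (use CaseF.prems in \<open>simp add: Let_def jump_def add_ac eval_nat_numeral\<close>)
  have 3: "(step P ^^ 2) (?f + code_len cf, \<sigma>') = (?l, \<sigma>')"
    by (rule steps_jump) (use CaseF in \<open>simp add: Let_def jump_def add_ac eval_nat_numeral\<close>)
  show ?case
    using steps_add[OF steps_add[OF 1 2] 3] by (simp del: funpow.simps add: add_ac eval_nat_numeral)
next
  case (CaseT \<sigma> i w ct t \<sigma>' ce cf)
  let ?f = "n + 3 + code_len ce"
  let ?t = "?f + 2 + code_len cf"
  let ?l = "?t + code_len ct"
  have 1: "(step P ^^ 1) (n, \<sigma>) = (?t, \<sigma>(i := w))"
    using CaseT steps_pop[of P n i "n + 1" ?f ?t \<sigma>] by (simp add: Let_def)
  have 2: "(step P ^^ t) (?t, \<sigma>(i := w)) = (?l, \<sigma>')"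
    by (rule CaseT.IH) (use CaseT.prems in \<open>simp add: Let_def jump_def add_ac eval_nat_numeral\<close>)
  show ?case
    using steps_add[OF 1 2] by (simp add: add_ac)
next
  case (WhileE \<sigma> i cf ct)
  then show ?case
    using steps_pop[of P n i "n + code_len (While i cf ct)" "n + 1" "n + 3 + code_len cf" \<sigma>]
    by (simp add: Let_def add_ac eval_nat_numeral)
next
  case (WhileF \<sigma> i w cf t \<sigma>' ct t' \<sigma>'')
  have 1: "(step P ^^ 1) (n, \<sigma>) = (n + 1, \<sigma>(i := w))"
    using WhileF steps_pop[of P n i "n + code_len (While i cf ct)" "n + 1" "n + 3 + code_len cf" \<sigma>]
    by (simp add: Let_def add_ac eval_nat_numeral)
  have 2: "(step P ^^ t) (n + 1, \<sigma>(i := w)) = (n + 1 + code_len cf, \<sigma>')"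
    by (rule WhileF.IH) (use WhileF.prems in \<open>simp add: Let_def\<close>)
  have 3: "(step P ^^ 2) (n + 1 + code_len cf, \<sigma>') = (n, \<sigma>')"
    by (rule steps_jump) (use WhileF.prems in \<open>simp add: Let_def\<close>)
  have 4: "(step P ^^ t') (n, \<sigma>') = (n + code_len (While i cf ct), \<sigma>'')"
    by (rule WhileF.IH) (use WhileF.prems in \<open>simp add: Let_def\<close>)
  show ?case
    using steps_add[OF steps_add[OF steps_add[OF 1 2] 3] 4] by (simp del: funpow.simps add: add_ac eval_nat_numeral)
next
  case (WhileT \<sigma> i w ct t \<sigma>' cf t' \<sigma>'')
  let ?t = "n + 3 + code_len cf"
  have 1: "(step P ^^ 1) (n, \<sigma>) = (?t, \<sigma>(i := w))"
    using WhileT steps_pop[of P n i "n + code_len (While i cf ct)" "n + 1" ?t \<sigma>]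
    by (simp add: Let_def add_ac eval_nat_numeral)
  have 2: "(step P ^^ t) (?t, \<sigma>(i := w)) = (?t + code_len ct, \<sigma>')"
    by (rule WhileT.IH) (use WhileT.prems in \<open>simp add: Let_def jump_def add_ac eval_nat_numeral\<close>)
  have 3: "(step P ^^ 2) (?t + code_len ct, \<sigma>') = (n, \<sigma>')"
    by (rule steps_jump) (use WhileT.prems in \<open>simp add: Let_def jump_def add_ac eval_nat_numeral\<close>)
  have 4: "(step P ^^ t') (n, \<sigma>') = (n + code_len (While i cf ct), \<sigma>'')"
    by (rule WhileT.IH) (use WhileT.prems in \<open>simp add: Let_def\<close>)
  show ?case
    using steps_add[OF steps_add[OF steps_add[OF 1 2] 3] 4] by (simp del: funpow.simps add: add_ac eval_nat_numeral)
qed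

text \<open>A halted configuration is a fixed point of \<open>step\<close>, so an exact running time
  can be replaced by any upper bound.\<close>

lemma steps_halted:
  assumes "(step P ^^ s) c = c'" "length P \<le> fst c'" "s \<le> t"
  shows "(step P ^^ t) c = c'"
proof -
  have "(step P ^^ m) c' = c'" for m
    using assms(2) by (induction m) (auto simp: step_def)
  then show ?thesis
    using steps_add[OF assms(1), of "t - s" c'] assms(3) by simp
qed

section \<open>Time-bounded execution of structured programs\<close>

definition runs :: "com \<Rightarrow> stacks \<Rightarrow> stacks \<Rightarrow> nat \<Rightarrow> bool" where
  "runs c \<sigma> \<sigma>' B \<longleftrightarrow> (\<exists>t\<le>B. big c \<sigma> t \<sigma>')"

lemma runs_computes_within:
  assumes "runs c (snd (start ws)) \<sigma>' B" "\<sigma>' 0 = out"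
  shows "computes_within (compile 0 c) ws B out"
proof -
  obtain t where t: "t \<le> B" "big c (snd (start ws)) t \<sigma>'"
    using assms(1) by (auto simp: runs_def)
  have "code_at (compile 0 c) 0 (compile 0 c)"
    by (simp add: code_at_def)
  from compile_correct[OF t(2) this] have "(step (compile 0 c) ^^ t) (start ws) = (code_len c, \<sigma>')"
    by (simp add: start_def)
  from steps_halted[OF this _ t(1)] show ?thesis
    using assms(2) by (simp add: computes_within_def)
qed

lemma runs_mono: "runs c \<sigma> \<sigma>' B \<Longrightarrow> B \<le> B' \<Longrightarrow> runs c \<sigma> \<sigma>' B'"
  unfolding runs_def by (meson order_trans)

lemma runs_Skip: "runs Skip \<sigma> \<sigma> 0"
  using big.Skip by (auto simp: runs_def)

lemma runs_Psh: "runs (Psh i b) \<sigma> (\<sigma>(i := b # \<sigma> i)) 1"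
  using big.Psh by (auto simp: runs_def)

lemma runs_Seq: "runs c \<sigma> \<sigma>' B \<Longrightarrow> runs d \<sigma>' \<sigma>'' B' \<Longrightarrow> runs (Seq c d) \<sigma> \<sigma>'' (B + B')"
  unfolding runs_def by (meson add_mono big.Seq)

text \<open>Only the branch selected by the top of the stack has to be treated; 3 is the largest of
  the three overheads.\<close>

lemma runs_Case:
  assumes "\<sigma> i = [] \<Longrightarrow> runs ce \<sigma> \<sigma>' B"
    and "\<And>w. \<sigma> i = False # w \<Longrightarrow> runs cf (\<sigma>(i := w)) \<sigma>' B"
    and "\<And>w. \<sigma> i = True # w \<Longrightarrow> runs ct (\<sigma>(i := w)) \<sigma>' B"
  shows "runs (Case i ce cf ct) \<sigma> \<sigma>' (B + 3)"
proof (cases "\<sigma> i")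
  case Nil
  with assms(1) show ?thesis
    unfolding runs_def by (meson add_le_mono1 big.CaseE)
next
  case (Cons b w)
  show ?thesis
  proof (cases b)
    case True
    with Cons obtain t where "t \<le> B" "big ct (\<sigma>(i := w)) t \<sigma>'"
      using assms(3)[of w] by (auto simp: runs_def)
    then show ?thesis
      unfolding runs_def using Cons True by (intro exI[of _ "t + 1"]) (auto simp del: add_Suc_right One_nat_def intro: big.CaseT)
  next
    case False
    with Cons obtain t where "t \<le> B" "big cf (\<sigma>(i := w)) t \<sigma>'"
      using assms(2)[of w] by (auto simp: runs_def)
    then show ?thesis
      unfolding runs_def using Cons False by (intro exI[of _ "t + 3"]) (auto intro: big.CaseF)
  qed
qed

lemma runs_While_Nil: "\<sigma> i = [] \<Longrightarrow> runs (While i cf ct) \<sigma> \<sigma> 1"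
  using big.WhileE by (auto simp: runs_def)

lemma runs_While_Cons:
  assumes "\<sigma> i = b # w" "runs (if b then ct else cf) (\<sigma>(i := w)) \<sigma>' B"
    "runs (While i cf ct) \<sigma>' \<sigma>'' B'"
  shows "runs (While i cf ct) \<sigma> \<sigma>'' (B + 3 + B')"
proof -
  from assms obtain t t' where t: "t \<le> B" "big (if b then ct else cf) (\<sigma>(i := w)) t \<sigma>'"
    "t' \<le> B'" "big (While i cf ct) \<sigma>' t' \<sigma>''"
    by (auto simp: runs_def)
  have "big (While i cf ct) \<sigma> (t + 3 + t') \<sigma>''"
    using t assms(1) by (cases b) (auto intro: big.WhileF big.WhileT)
  then show ?thesis
    using t by (auto simp: runs_def intro!: exI[of _ "t + 3 + t'"])
qed

lemma runs_move:
  assumes "i \<noteq> j"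
  shows "runs (While i (Psh j False) (Psh j True)) \<sigma> (\<sigma>(i := [], j := rev (\<sigma> i) @ \<sigma> j))
    (4 * length (\<sigma> i) + 1)"
proof (induction "\<sigma> i" arbitrary: \<sigma>)
  case Nil
  then show ?case
    using runs_While_Nil[of \<sigma> i] by (simp add: fun_upd_idem)
next
  case (Cons b w)
  have "runs (if b then Psh j True else Psh j False) (\<sigma>(i := w)) (\<sigma>(i := w, j := b # \<sigma> j)) 1"
    using runs_Psh[of j b "\<sigma>(i := w)"] assms by (cases b) (auto simp: fun_upd_twist)
  from runs_While_Cons[OF Cons(2)[symmetric] this Cons(1)] show ?case
    unfolding Cons(2)[symmetric] using assms by (auto simp: fun_upd_twist)
qed

section \<open>Emitting words in polynomial time\<close>

type_synonym env = "nat \<Rightarrow> nat"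

text \<open>
  Stack conventions: \<open>0\<close> holds the output, \<open>2\<close> is scratch space, \<open>3\<close> and \<open>4\<close> hold the operands of a
  comparison, \<open>5\<close> holds truth values, \<open>6\<close> holds the reversed input word, and \<open>7 + v\<close> holds the
  variable \<open>v\<close> in unary. The set \<open>A\<close> in \<open>gen A f\<close> consists of the loop variables.
\<close>

definition rep0 :: "env \<Rightarrow> word \<Rightarrow> stacks \<Rightarrow> bool" where
  "rep0 e x \<sigma> \<longleftrightarrow> \<sigma> 2 = [] \<and> \<sigma> 6 = x \<and> (\<forall>v. \<sigma> (7 + v) = replicate (e v) True)"

text \<open>An expression may have to be evaluated while operands already lie on stacks 3 and 4, as
  in a sum or on the right of a comparison. So \<open>val\<close> assumes only \<open>rep0\<close>,
  while tests start with both operand stacks empty.\<close>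

definition rep :: "env \<Rightarrow> word \<Rightarrow> stacks \<Rightarrow> bool" where
  "rep e x \<sigma> \<longleftrightarrow> rep0 e x \<sigma> \<and> \<sigma> 3 = [] \<and> \<sigma> 4 = []"

definition bounded :: "env \<Rightarrow> word \<Rightarrow> nat \<Rightarrow> bool" where
  "bounded e x K \<longleftrightarrow> (\<forall>v. e v \<le> K) \<and> length x \<le> K"

text \<open>The value is bounded as well as the time, because later loops over the unary result take
  time proportional to it. Prepending to stack \<open>d\<close> turns a sum into the concatenation
  of its summands.\<close>

definition val :: "(env \<Rightarrow> word \<Rightarrow> nat) \<Rightarrow> bool" where
  "val f \<longleftrightarrow> (\<forall>d\<in>{3,4}. \<exists>c (q :: nat poly). \<forall>e x \<sigma> K. rep0 e x \<sigma> \<longrightarrow> bounded e x K \<longrightarrow>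
     f e x \<le> poly q K \<and> runs c \<sigma> (\<sigma>(d := replicate (f e x) True @ \<sigma> d)) (poly q K))"

definition dec :: "(env \<Rightarrow> word \<Rightarrow> bool) \<Rightarrow> bool" where
  "dec P \<longleftrightarrow> (\<exists>c (q :: nat poly). \<forall>e x \<sigma> K. rep e x \<sigma> \<longrightarrow> bounded e x K \<longrightarrow>
     runs c \<sigma> (\<sigma>(5 := P e x # \<sigma> 5)) (poly q K))"

text \<open>The final state differs from the initial one only on stack 0, so loop variables are zero
  again afterwards and consecutive generators can share them. The length bound becomes a bound on
  the environment when an output is stored in a variable.\<close>

definition gen :: "nat set \<Rightarrow> (env \<Rightarrow> word \<Rightarrow> word) \<Rightarrow> bool" where
  "gen A f \<longleftrightarrow> (\<exists>c (q :: nat poly). \<forall>e x \<sigma> K. rep e x \<sigma> \<longrightarrow> (\<forall>v\<in>A. e v = 0) \<longrightarrow> bounded e x K \<longrightarrow>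
     length (f e x) \<le> poly q K \<and> runs c \<sigma> (\<sigma>(0 := f e x @ \<sigma> 0)) (poly q K))"

lemma runs_weaken: "runs c \<sigma> \<sigma>' B \<Longrightarrow> \<sigma>' = \<sigma>'' \<Longrightarrow> B \<le> B' \<Longrightarrow> runs c \<sigma> \<sigma>'' B'"
  using runs_mono by blast

lemma runs_clear: "runs (While i Skip Skip) \<sigma> (\<sigma>(i := [])) (3 * length (\<sigma> i) + 1)"
proof (induction "\<sigma> i" arbitrary: \<sigma>)
  case Nil
  then show ?case
    using runs_While_Nil[of \<sigma> i] by (simp add: fun_upd_idem)
next
  case (Cons b w)
  have "runs (if b then Skip else Skip) (\<sigma>(i := w)) (\<sigma>(i := w)) 0"
    by (simp add: runs_Skip)
  from runs_While_Cons[OF Cons(2)[symmetric] this Cons(1)] show ?case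
    unfolding Cons(2)[symmetric] by simp
qed

lemma runs_copy2:
  assumes "i \<noteq> j" "i \<noteq> d" "j \<noteq> d"
  shows "\<sigma> i = replicate n True \<Longrightarrow> runs (While i Skip (Seq (Psh j True) (Psh d True))) \<sigma>
    (\<sigma>(i := [], j := replicate n True @ \<sigma> j, d := replicate n True @ \<sigma> d)) (5 * n + 1)"
proof (induction n arbitrary: \<sigma>)
  case 0
  then show ?case
    using runs_While_Nil[of \<sigma> i] by (simp add: fun_upd_idem)
next
  case (Suc n)
  let ?\<sigma> = "\<sigma>(i := replicate n True)"
  have 0: "\<sigma> i = True # replicate n True"
    using Suc.prems by simp
  have 1: "runs (if True then Seq (Psh j True) (Psh d True) else Skip) ?\<sigma>
    (?\<sigma>(j := True # ?\<sigma> j, d := True # ?\<sigma> d)) 2"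
    using runs_Seq[OF runs_Psh runs_Psh, of j True d True ?\<sigma>] assms by (simp add: numeral_2_eq_2)
  show ?case
    by (rule runs_weaken[OF runs_While_Cons[OF 0 1 Suc.IH]])
      (use assms in \<open>auto simp: fun_eq_iff replicate_app_Cons_same\<close>)
qed

lemma runs_move_count:
  assumes "i \<noteq> j" "i \<noteq> d" "j \<noteq> d"
  shows "runs (While i (Seq (Psh j False) (Psh d True)) (Seq (Psh j True) (Psh d True))) \<sigma>
     (\<sigma>(i := [], j := rev (\<sigma> i) @ \<sigma> j, d := replicate (length (\<sigma> i)) True @ \<sigma> d))
     (5 * length (\<sigma> i) + 1)"
proof (induction "\<sigma> i" arbitrary: \<sigma>)
  case Nil
  then show ?case
    by (intro runs_weaken[OF runs_While_Nil[of \<sigma> i]]) (auto simp: fun_eq_iff)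
next
  case (Cons b w)
  let ?c = "While i (Seq (Psh j False) (Psh d True)) (Seq (Psh j True) (Psh d True))"
  let ?\<sigma> = "\<sigma>(i := w, j := b # \<sigma> j, d := True # \<sigma> d)"
  note \<sigma> = Cons(2)[symmetric]
  have 1: "runs (if b then Seq (Psh j True) (Psh d True) else Seq (Psh j False) (Psh d True))
     (\<sigma>(i := w)) ?\<sigma> (1 + 1)"
    using runs_Seq[OF runs_Psh runs_Psh, of j b d True "\<sigma>(i := w)"] assms by (cases b) auto
  have 2: "runs ?c ?\<sigma> (?\<sigma>(i := [], j := rev (?\<sigma> i) @ ?\<sigma> j,
     d := replicate (length (?\<sigma> i)) True @ ?\<sigma> d)) (5 * length (?\<sigma> i) + 1)"
    by (rule Cons(1)) (use assms in simp)
  show ?case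
    by (rule runs_weaken[OF runs_While_Cons[OF \<sigma> 1 2]])
      (use \<sigma> assms in \<open>auto simp: fun_eq_iff replicate_app_Cons_same\<close>)
qed

section \<open>Evaluating numerical expressions\<close>

lemma val_var: "val (\<lambda>e x. e v)"
proof -
  have "\<exists>c (q :: nat poly). \<forall>e x \<sigma> K. rep0 e x \<sigma> \<longrightarrow> bounded e x K \<longrightarrow>
     e v \<le> poly q K \<and> runs c \<sigma> (\<sigma>(d := replicate (e v) True @ \<sigma> d)) (poly q K)" if d: "d \<in> {3,4}" for d
  proof (intro exI allI impI conjI)
    fix e x \<sigma> K assume r: "rep0 e x \<sigma>" and b: "bounded e x K"
    let ?i = "7 + v"
    let ?\<sigma> = "\<sigma>(?i := [], 2 := replicate (e v) True)"
    \<comment> \<open>Reading a unary variable destroys it, so it is parked on scratch stack 2 and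
      restored while the copy is made.\<close>
    have 1: "runs (While ?i (Psh 2 False) (Psh 2 True)) \<sigma> ?\<sigma> (4 * e v + 1)"
      using runs_move[of ?i 2 \<sigma>] r by (simp add: rep0_def)
    have 2: "runs (While 2 Skip (Seq (Psh ?i True) (Psh d True))) ?\<sigma> (?\<sigma>(2 := [],
        ?i := replicate (e v) True @ ?\<sigma> ?i, d := replicate (e v) True @ ?\<sigma> d)) (5 * e v + 1)"
      by (rule runs_copy2) (use d in auto)
    have K: "e v \<le> K"
      using b by (simp add: bounded_def)
    show "runs (Seq (While ?i (Psh 2 False) (Psh 2 True))
      (While 2 Skip (Seq (Psh ?i True) (Psh d True)))) \<sigma> (\<sigma>(d := replicate (e v) True @ \<sigma> d))
      (poly [:2, 9:] K)"
      by (rule runs_weaken[OF runs_Seq[OF 1 2]]) (use d r K in \<open>auto simp: fun_eq_iff rep0_def\<close>)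
    show "e v \<le> poly [:2, 9:] K"
      using K by simp
  qed
  then show ?thesis
    unfolding val_def by blast
qed

lemma val_length: "val (\<lambda>e x. length x)"
proof -
  have "\<exists>c (q :: nat poly). \<forall>e x \<sigma> K. rep0 e x \<sigma> \<longrightarrow> bounded e x K \<longrightarrow> length x \<le> poly q K \<and>
     runs c \<sigma> (\<sigma>(d := replicate (length x) True @ \<sigma> d)) (poly q K)" if d: "d \<in> {3,4}" for d
  proof (intro exI allI impI conjI)
    fix e x \<sigma> K assume r: "rep0 e x \<sigma>" and b: "bounded e x K"
    let ?c = "While 6 (Seq (Psh 2 False) (Psh d True)) (Seq (Psh 2 True) (Psh d True))"
    let ?\<sigma> = "\<sigma>(6 := [], 2 := rev x, d := replicate (length x) True @ \<sigma> d)"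
    have 1: "runs ?c \<sigma> ?\<sigma> (5 * length x + 1)"
      by (rule runs_weaken[OF runs_move_count]) (use d r in \<open>auto simp: rep0_def\<close>)
    have 2: "runs (While 2 (Psh 6 False) (Psh 6 True)) ?\<sigma>
       (\<sigma>(d := replicate (length x) True @ \<sigma> d)) (4 * length x + 1)"
      by (rule runs_weaken[OF runs_move]) (use d r in \<open>auto simp: rep0_def fun_eq_iff\<close>)
    have K: "length x \<le> K"
      using b by (simp add: bounded_def)
    show "runs (Seq ?c (While 2 (Psh 6 False) (Psh 6 True))) \<sigma>
       (\<sigma>(d := replicate (length x) True @ \<sigma> d)) (poly [:2, 9:] K)"
      by (rule runs_weaken[OF runs_Seq[OF 1 2]]) (use K in auto)
    show "length x \<le> poly [:2, 9:] K"
      using K by simp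
  qed
  then show ?thesis
    unfolding val_def by blast
qed

lemma val_const: "val (\<lambda>e x. n)"
  unfolding val_def
proof
  fix d :: nat
  show "\<exists>c (q :: nat poly). \<forall>e x \<sigma> K. rep0 e x \<sigma> \<longrightarrow> bounded e x K \<longrightarrow>
     n \<le> poly q K \<and> runs c \<sigma> (\<sigma>(d := replicate n True @ \<sigma> d)) (poly q K)"
  proof (rule exI, rule exI, intro allI impI conjI)
    fix \<sigma> K
    show "runs (foldr Seq (replicate n (Psh d True)) Skip) \<sigma> (\<sigma>(d := replicate n True @ \<sigma> d))
      (poly [:n:] K)"
    proof (induction n arbitrary: \<sigma>)
      case 0
      then show ?case using runs_Skip[of \<sigma>] by simp
    next
      case (Suc n)
      show ?case
        unfolding replicate.simps foldr.simps o_apply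
        by (rule runs_weaken[OF runs_Seq[OF runs_Psh Suc]])
          (auto simp: fun_eq_iff replicate_app_Cons_same)
    qed
  qed simp
qed

lemma val_add:
  assumes "val f" "val g"
  shows "val (\<lambda>e x. f e x + g e x)"
  unfolding val_def
proof
  fix d :: nat assume d: "d \<in> {3,4}"
  obtain c q where f: "\<And>e x \<sigma> K. rep0 e x \<sigma> \<Longrightarrow> bounded e x K \<Longrightarrow>
     f e x \<le> poly q K \<and> runs c \<sigma> (\<sigma>(d := replicate (f e x) True @ \<sigma> d)) (poly q K)"
    using assms(1) d unfolding val_def by meson
  obtain c' q' where g: "\<And>e x \<sigma> K. rep0 e x \<sigma> \<Longrightarrow> bounded e x K \<Longrightarrow>
     g e x \<le> poly q' K \<and> runs c' \<sigma> (\<sigma>(d := replicate (g e x) True @ \<sigma> d)) (poly q' K)"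
    using assms(2) d unfolding val_def by meson
  show "\<exists>c (q :: nat poly). \<forall>e x \<sigma> K. rep0 e x \<sigma> \<longrightarrow> bounded e x K \<longrightarrow>
     f e x + g e x \<le> poly q K \<and>
     runs c \<sigma> (\<sigma>(d := replicate (f e x + g e x) True @ \<sigma> d)) (poly q K)"
  proof (rule exI[of _ "Seq c' c"], rule exI[of _ "q' + q"], intro allI impI)
    fix e x \<sigma> K assume r: "rep0 e x \<sigma>" and b: "bounded e x K"
    let ?\<sigma> = "\<sigma>(d := replicate (g e x) True @ \<sigma> d)"
    have r': "rep0 e x ?\<sigma>"
      using r d by (auto simp: rep0_def)
    show "f e x + g e x \<le> poly (q' + q) K \<and>
     runs (Seq c' c) \<sigma> (\<sigma>(d := replicate (f e x + g e x) True @ \<sigma> d)) (poly (q' + q) K)"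
      using runs_Seq[OF conjunct2[OF g[OF r b]] conjunct2[OF f[OF r' b]]] f[OF r b] g[OF r b]
      by (simp add: replicate_add)
  qed
qed

section \<open>Deciding comparisons and input bits\<close>

lemma runs_subtract:
  "\<sigma> 3 = replicate m True \<Longrightarrow> \<sigma> 4 = replicate n True \<Longrightarrow>
   runs (While 3 Skip (Case 4 Skip Skip Skip)) \<sigma> (\<sigma>(3 := [], 4 := replicate (n - m) True)) (6 * m + 1)"
proof (induction m arbitrary: \<sigma> n)
  case 0
  then show ?case
    using runs_While_Nil[of \<sigma> 3] by (simp add: fun_upd_idem)
next
  case (Suc m)
  let ?\<sigma> = "\<sigma>(3 := replicate m True)"
  let ?\<sigma>' = "?\<sigma>(4 := replicate (n - 1) True)"
  have 0: "\<sigma> 3 = True # replicate m True"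
    using Suc.prems by simp
  have 1: "runs (if True then Case 4 Skip Skip Skip else Skip) ?\<sigma> ?\<sigma>' (0 + 3)"
    unfolding if_True
    by (rule runs_Case; rule runs_weaken[OF runs_Skip])
      (use Suc.prems in \<open>cases n; auto simp: fun_eq_iff\<close>)+
  have 2: "runs (While 3 Skip (Case 4 Skip Skip Skip)) ?\<sigma>'
      (?\<sigma>'(3 := [], 4 := replicate (n - 1 - m) True)) (6 * m + 1)"
    by (rule Suc.IH) auto
  show ?case
    by (rule runs_weaken[OF runs_While_Cons[OF 0 1 2]]) (auto simp: fun_eq_iff)
qed

text \<open>After truncated subtraction of the left operand, stack 4 is nonempty iff the comparison
  holds; it contains no \<open>False\<close>, so that branch of the test is never taken.\<close>

lemma dec_less:
  assumes "val f" "val g"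
  shows "dec (\<lambda>e x. f e x < g e x)"
proof -
  obtain c q where f: "\<And>e x \<sigma> K. rep0 e x \<sigma> \<Longrightarrow> bounded e x K \<Longrightarrow>
     f e x \<le> poly q K \<and> runs c \<sigma> (\<sigma>(3 := replicate (f e x) True @ \<sigma> 3)) (poly q K)"
    using assms(1) unfolding val_def by (meson insertI1)
  obtain c' q' where g: "\<And>e x \<sigma> K. rep0 e x \<sigma> \<Longrightarrow> bounded e x K \<Longrightarrow>
     g e x \<le> poly q' K \<and> runs c' \<sigma> (\<sigma>(4 := replicate (g e x) True @ \<sigma> 4)) (poly q' K)"
    using assms(2) unfolding val_def by (meson insertI1 insertI2)
  let ?d = "Case 4 (Psh 5 False) Skip (Seq (While 4 Skip Skip) (Psh 5 True))"
  show ?thesis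
    unfolding dec_def
  proof (rule exI[of _ "Seq (Seq (Seq c c') (While 3 Skip (Case 4 Skip Skip Skip))) ?d"],
      rule exI[of _ "7 * q + 4 * q' + [:6:]"], intro allI impI)
    fix e x \<sigma> K assume r: "rep e x \<sigma>" and b: "bounded e x K"
    let ?f = "f e x" and ?g = "g e x"
    let ?\<sigma>1 = "\<sigma>(3 := replicate ?f True)"
    let ?\<sigma>2 = "?\<sigma>1(4 := replicate ?g True)"
    let ?\<sigma>3 = "?\<sigma>2(3 := [], 4 := replicate (?g - ?f) True)"
    have r0: "rep0 e x \<sigma>" "rep0 e x ?\<sigma>1"
      using r by (auto simp: rep_def rep0_def)
    have 1: "runs c \<sigma> ?\<sigma>1 (poly q K)" and F: "?f \<le> poly q K"
      using f[OF r0(1) b] r by (auto simp: rep_def)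
    have 2: "runs c' ?\<sigma>1 ?\<sigma>2 (poly q' K)" and G: "?g \<le> poly q' K"
      using g[OF r0(2) b] r by (auto simp: rep_def)
    have 3: "runs (While 3 Skip (Case 4 Skip Skip Skip)) ?\<sigma>2 ?\<sigma>3 (6 * ?f + 1)"
      by (rule runs_subtract) auto
    have 4: "runs ?d ?\<sigma>3 (\<sigma>(5 := (?f < ?g) # \<sigma> 5)) (3 * ?g + 2 + 3)"
    proof (rule runs_Case)
      assume "?\<sigma>3 4 = []"
      then show "runs (Psh 5 False) ?\<sigma>3 (\<sigma>(5 := (?f < ?g) # \<sigma> 5)) (3 * ?g + 2)"
        by (intro runs_weaken[OF runs_Psh]) (use r in \<open>auto simp: fun_eq_iff rep_def\<close>)
    next
      fix w assume "?\<sigma>3 4 = False # w"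
      then show "runs Skip (?\<sigma>3(4 := w)) (\<sigma>(5 := (?f < ?g) # \<sigma> 5)) (3 * ?g + 2)"
        by (cases "?g - ?f") auto
    next
      fix w assume w: "?\<sigma>3 4 = True # w"
      then have "replicate (?g - ?f) True = True # w"
        by simp
      then have "length (replicate (?g - ?f) True) = Suc (length w)"
        by (metis length_Cons)
      then have "?f < ?g" "length w \<le> ?g"
        by auto
      then show "runs (Seq (While 4 Skip Skip) (Psh 5 True)) (?\<sigma>3(4 := w))
          (\<sigma>(5 := (?f < ?g) # \<sigma> 5)) (3 * ?g + 2)"
        by (intro runs_weaken[OF runs_Seq[OF runs_clear runs_Psh]])
          (use r in \<open>auto simp: fun_eq_iff rep_def\<close>)
    qed
    show "runs (Seq (Seq (Seq c c') (While 3 Skip (Case 4 Skip Skip Skip))) ?d) \<sigma>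
      (\<sigma>(5 := (?f < ?g) # \<sigma> 5)) (poly (7 * q + 4 * q' + [:6:]) K)"
      by (rule runs_weaken[OF runs_Seq[OF runs_Seq[OF runs_Seq[OF 1 2] 3] 4]]) (use F G in auto)
  qed
qed

lemma runs_skip_prefix:
  "\<sigma> 3 = replicate m True \<Longrightarrow>
   runs (While 3 Skip (Case 6 Skip (Psh 4 False) (Psh 4 True))) \<sigma>
     (\<sigma>(3 := [], 6 := drop m (\<sigma> 6), 4 := rev (take m (\<sigma> 6)) @ \<sigma> 4)) (7 * m + 1)"
proof (induction m arbitrary: \<sigma>)
  case 0
  then show ?case
    using runs_While_Nil[of \<sigma> 3] by (simp add: fun_upd_idem)
next
  case (Suc m)
  let ?\<sigma> = "\<sigma>(3 := replicate m True)"
  let ?\<sigma>' = "?\<sigma>(6 := tl (\<sigma> 6), 4 := take 1 (\<sigma> 6) @ \<sigma> 4)"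
  have 0: "\<sigma> 3 = True # replicate m True"
    using Suc.prems by simp
  have 1: "runs (if True then Case 6 Skip (Psh 4 False) (Psh 4 True) else Skip) ?\<sigma> ?\<sigma>' (1 + 3)"
    unfolding if_True
  proof (rule runs_Case)
    assume "?\<sigma> 6 = []"
    then show "runs Skip ?\<sigma> ?\<sigma>' 1"
      by (intro runs_weaken[OF runs_Skip]) (auto simp: fun_eq_iff)
  qed (rule runs_weaken[OF runs_Psh]; auto simp: fun_eq_iff)+
  have 2: "runs (While 3 Skip (Case 6 Skip (Psh 4 False) (Psh 4 True))) ?\<sigma>'
      (?\<sigma>'(3 := [], 6 := drop m (?\<sigma>' 6), 4 := rev (take m (?\<sigma>' 6)) @ ?\<sigma>' 4)) (7 * m + 1)"
    by (rule Suc.IH) auto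
  show ?case
    by (rule runs_weaken[OF runs_While_Cons[OF 0 1 2]])
      (cases "\<sigma> 6"; auto simp: fun_eq_iff)+
qed

text \<open>The bits before the requested position are parked on stack 4, the next bit is inspected
  and pushed back, and the prefix is restored. A position beyond the end shows up as an empty stack
  6.\<close>

lemma dec_nth:
  assumes "val f"
  shows "dec (\<lambda>e x. f e x < length x \<and> x ! f e x)"
proof -
  obtain c q where f: "\<And>e x \<sigma> K. rep0 e x \<sigma> \<Longrightarrow> bounded e x K \<Longrightarrow>
     f e x \<le> poly q K \<and> runs c \<sigma> (\<sigma>(3 := replicate (f e x) True @ \<sigma> 3)) (poly q K)"
    using assms(1) unfolding val_def by (meson insertI1)
  let ?w = "While 3 Skip (Case 6 Skip (Psh 4 False) (Psh 4 True))"
  let ?d = "Case 6 (Psh 5 False) (Seq (Psh 6 False) (Psh 5 False)) (Seq (Psh 6 True) (Psh 5 True))"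
  let ?m = "While 4 (Psh 6 False) (Psh 6 True)"
  show ?thesis
    unfolding dec_def
  proof (rule exI[of _ "Seq (Seq (Seq c ?w) ?d) ?m"],
      rule exI[of _ "12 * q + [:10:]"], intro allI impI)
    fix e x \<sigma> K assume r: "rep e x \<sigma>" and b: "bounded e x K"
    let ?f = "f e x" and ?P = "f e x < length x \<and> x ! f e x"
    let ?\<sigma>1 = "\<sigma>(3 := replicate ?f True)"
    let ?\<sigma>2 = "\<sigma>(6 := drop ?f x, 4 := rev (take ?f x))"
    let ?\<sigma>3 = "?\<sigma>2(5 := ?P # \<sigma> 5)"
    have r0: "rep0 e x \<sigma>" and x: "\<sigma> 6 = x" "\<sigma> 3 = []" "\<sigma> 4 = []"
      using r by (auto simp: rep_def rep0_def)
    have 1: "runs c \<sigma> ?\<sigma>1 (poly q K)" and F: "?f \<le> poly q K"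
      using f[OF r0(1) b] r by (auto simp: rep_def)
    have 2: "runs ?w ?\<sigma>1 ?\<sigma>2 (7 * ?f + 1)"
      by (rule runs_weaken[OF runs_skip_prefix[of _ ?f]]) (use x in \<open>auto simp: fun_eq_iff\<close>)
    have 3: "runs ?d ?\<sigma>2 ?\<sigma>3 (2 + 3)"
    proof (rule runs_Case)
      assume "?\<sigma>2 6 = []"
      then show "runs (Psh 5 False) ?\<sigma>2 ?\<sigma>3 2"
        by (intro runs_weaken[OF runs_Psh]) (auto simp: fun_eq_iff)
    next
      fix w assume "?\<sigma>2 6 = False # w"
      then have "drop ?f x = False # w"
        by simp
      then have "\<not> ?P"
        by (metis Cons_nth_drop_Suc list.inject)
      then show "runs (Seq (Psh 6 False) (Psh 5 False)) (?\<sigma>2(6 := w)) ?\<sigma>3 2"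
        by (intro runs_weaken[OF runs_Seq[OF runs_Psh runs_Psh]])
          (use \<open>drop ?f x = False # w\<close> in \<open>auto simp: fun_eq_iff\<close>)
    next
      fix w assume "?\<sigma>2 6 = True # w"
      then have "drop ?f x = True # w"
        by simp
      then have "?P"
        by (metis Cons_nth_drop_Suc list.inject list.distinct(1) drop_all not_le_imp_less)
      then show "runs (Seq (Psh 6 True) (Psh 5 True)) (?\<sigma>2(6 := w)) ?\<sigma>3 2"
        by (intro runs_weaken[OF runs_Seq[OF runs_Psh runs_Psh]])
          (use \<open>drop ?f x = True # w\<close> in \<open>auto simp: fun_eq_iff\<close>)
    qed
    have 4: "runs ?m ?\<sigma>3 (\<sigma>(5 := ?P # \<sigma> 5)) (4 * ?f + 1)"
      by (rule runs_weaken[OF runs_move]) (use x in \<open>auto simp: fun_eq_iff\<close>)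
    show "runs (Seq (Seq (Seq c ?w) ?d) ?m) \<sigma> (\<sigma>(5 := ?P # \<sigma> 5)) (poly (12 * q + [:10:]) K)"
      by (rule runs_weaken[OF runs_Seq[OF runs_Seq[OF runs_Seq[OF 1 2] 3] 4]]) (use F in auto)
  qed
qed

lemma dec_not:
  assumes "dec P"
  shows "dec (\<lambda>e x. \<not> P e x)"
proof -
  obtain c q where P: "\<And>e x \<sigma> K. rep e x \<sigma> \<Longrightarrow> bounded e x K \<Longrightarrow>
     runs c \<sigma> (\<sigma>(5 := P e x # \<sigma> 5)) (poly q K)"
    using assms unfolding dec_def by meson
  show ?thesis
    unfolding dec_def
  proof (rule exI[of _ "Seq c (Case 5 Skip (Psh 5 True) (Psh 5 False))"],
      rule exI[of _ "q + [:4:]"], intro allI impI)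
    fix e x \<sigma> K assume r: "rep e x \<sigma>" and b: "bounded e x K"
    have 1: "runs (Case 5 Skip (Psh 5 True) (Psh 5 False)) (\<sigma>(5 := P e x # \<sigma> 5))
       (\<sigma>(5 := (\<not> P e x) # \<sigma> 5)) (1 + 3)"
      by (rule runs_Case) (simp, (rule runs_weaken[OF runs_Psh]; auto)+)
    show "runs (Seq c (Case 5 Skip (Psh 5 True) (Psh 5 False))) \<sigma> (\<sigma>(5 := (\<not> P e x) # \<sigma> 5))
       (poly (q + [:4:]) K)"
      by (rule runs_weaken[OF runs_Seq[OF P[OF r b] 1]]) auto
  qed
qed

lemma dec_conj:
  assumes "dec P" "dec Q"
  shows "dec (\<lambda>e x. P e x \<and> Q e x)"
proof -
  obtain c q where P: "\<And>e x \<sigma> K. rep e x \<sigma> \<Longrightarrow> bounded e x K \<Longrightarrow>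
     runs c \<sigma> (\<sigma>(5 := P e x # \<sigma> 5)) (poly q K)"
    using assms(1) unfolding dec_def by meson
  obtain c' q' where Q: "\<And>e x \<sigma> K. rep e x \<sigma> \<Longrightarrow> bounded e x K \<Longrightarrow>
     runs c' \<sigma> (\<sigma>(5 := Q e x # \<sigma> 5)) (poly q' K)"
    using assms(2) unfolding dec_def by meson
  \<comment> \<open>The value of \<open>Q\<close> lies on top of that of \<open>P\<close>. If it is
    \<open>True\<close>, the value below is already the answer; if it is \<open>False\<close>, the
    value below is replaced by \<open>False\<close>.\<close>
  let ?d = "Case 5 Skip (Case 5 Skip (Psh 5 False) (Psh 5 False)) Skip"
  show ?thesis
    unfolding dec_def
  proof (rule exI[of _ "Seq (Seq c c') ?d"], rule exI[of _ "q + q' + [:7:]"], intro allI impI)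
    fix e x \<sigma> K assume r: "rep e x \<sigma>" and b: "bounded e x K"
    let ?\<sigma> = "\<sigma>(5 := P e x # \<sigma> 5)"
    have r': "rep e x ?\<sigma>"
      using r by (auto simp: rep_def rep0_def)
    have 1: "runs (Case 5 Skip (Psh 5 False) (Psh 5 False)) ?\<sigma> (\<sigma>(5 := False # \<sigma> 5)) (1 + 3)"
      by (rule runs_Case) (simp, (rule runs_weaken[OF runs_Psh]; auto)+)
    have 2: "runs ?d (?\<sigma>(5 := Q e x # ?\<sigma> 5)) (\<sigma>(5 := (P e x \<and> Q e x) # \<sigma> 5)) (4 + 3)"
    proof (rule runs_Case)
      fix w assume "(?\<sigma>(5 := Q e x # ?\<sigma> 5)) 5 = False # w"
      then have "\<not> Q e x" "?\<sigma>(5 := Q e x # ?\<sigma> 5, 5 := w) = ?\<sigma>"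
        by auto
      with 1 show "runs (Case 5 Skip (Psh 5 False) (Psh 5 False)) (?\<sigma>(5 := Q e x # ?\<sigma> 5, 5 := w))
         (\<sigma>(5 := (P e x \<and> Q e x) # \<sigma> 5)) 4"
        by simp
    next
      fix w assume "(?\<sigma>(5 := Q e x # ?\<sigma> 5)) 5 = True # w"
      then show "runs Skip (?\<sigma>(5 := Q e x # ?\<sigma> 5, 5 := w)) (\<sigma>(5 := (P e x \<and> Q e x) # \<sigma> 5)) 4"
        by (intro runs_weaken[OF runs_Skip]) auto
    qed simp
    show "runs (Seq (Seq c c') ?d) \<sigma> (\<sigma>(5 := (P e x \<and> Q e x) # \<sigma> 5)) (poly (q + q' + [:7:]) K)"
      by (rule runs_weaken[OF runs_Seq[OF runs_Seq[OF P[OF r b] Q[OF r' b]] 2]]) auto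
  qed
qed

lemma dec_le: "val f \<Longrightarrow> val g \<Longrightarrow> dec (\<lambda>e x. f e x \<le> g e x)"
  using dec_not[OF dec_less[of g f]] by (simp add: not_less)

lemma dec_eq: "val f \<Longrightarrow> val g \<Longrightarrow> dec (\<lambda>e x. f e x = g e x)"
  using dec_conj[OF dec_le[of f g] dec_le[of g f]] by (simp add: eq_iff)

lemma dec_const: "dec (\<lambda>e x. b)"
  using dec_less[OF val_const[of 0] val_const[of "if b then 1 else 0"]] by (cases b) auto

lemma dec_disj: "dec P \<Longrightarrow> dec Q \<Longrightarrow> dec (\<lambda>e x. P e x \<or> Q e x)"
  using dec_not[OF dec_conj[OF dec_not[of P] dec_not[of Q]]] by simp

lemma dec_imp: "dec P \<Longrightarrow> dec Q \<Longrightarrow> dec (\<lambda>e x. P e x \<longrightarrow> Q e x)"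
  using dec_disj[OF dec_not[of P]] by simp

text \<open>The bound is a constant of the program, so the quantifier is unrolled. This serves for
  case distinctions over the addresses of a fixed verifier.\<close>

lemma dec_all_less: "(\<And>c. c < n \<Longrightarrow> dec (P c)) \<Longrightarrow> dec (\<lambda>e x. \<forall>c<(n::nat). P c e x)"
proof (induction n)
  case (Suc n)
  have "dec (\<lambda>e x. (\<forall>c<n. P c e x) \<and> P n e x)"
    using Suc by (intro dec_conj) auto
  then show ?case
    by (simp add: All_less_Suc conj_commute)
qed (simp add: dec_const)

section \<open>Combinators for generators\<close>

lemma gen_Nil: "gen {} (\<lambda>e x. [])"
  unfolding gen_def by (rule exI[of _ Skip], rule exI[of _ 0]) (auto simp: runs_Skip)

lemma gen_single: "gen {} (\<lambda>e x. [b])"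
  unfolding gen_def by (rule exI[of _ "Psh 0 b"], rule exI[of _ 1]) (auto simp: runs_Psh[unfolded One_nat_def])

lemma gen_mono: "gen A f \<Longrightarrow> A \<subseteq> B \<Longrightarrow> gen B f"
  unfolding gen_def by fast

lemma gen_append:
  assumes "gen A f" "gen B g"
  shows "gen (A \<union> B) (\<lambda>e x. f e x @ g e x)"
proof -
  obtain c q where f: "\<And>e x \<sigma> K. rep e x \<sigma> \<Longrightarrow> (\<forall>v\<in>A. e v = 0) \<Longrightarrow> bounded e x K \<Longrightarrow>
     length (f e x) \<le> poly q K \<and> runs c \<sigma> (\<sigma>(0 := f e x @ \<sigma> 0)) (poly q K)"
    using assms(1) unfolding gen_def by meson
  obtain c' q' where g: "\<And>e x \<sigma> K. rep e x \<sigma> \<Longrightarrow> (\<forall>v\<in>B. e v = 0) \<Longrightarrow> bounded e x K \<Longrightarrow>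
     length (g e x) \<le> poly q' K \<and> runs c' \<sigma> (\<sigma>(0 := g e x @ \<sigma> 0)) (poly q' K)"
    using assms(2) unfolding gen_def by meson
  show ?thesis
    unfolding gen_def
  proof (rule exI[of _ "Seq c' c"], rule exI[of _ "q' + q"], intro allI impI)
    fix e x \<sigma> K
    assume r: "rep e x \<sigma>" and z: "\<forall>v\<in>A \<union> B. e v = 0" and b: "bounded e x K"
    have r': "rep e x (\<sigma>(0 := g e x @ \<sigma> 0))"
      using r by (auto simp: rep_def rep0_def)
    show "length (f e x @ g e x) \<le> poly (q' + q) K \<and>
      runs (Seq c' c) \<sigma> (\<sigma>(0 := (f e x @ g e x) @ \<sigma> 0)) (poly (q' + q) K)"
      using runs_Seq[OF conjunct2[OF g[OF r _ b]] conjunct2[OF f[OF r' _ b]]]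
        g[OF r _ b] f[OF r _ b] z by (simp add: add.commute add_mono)
  qed
qed

lemma gen_if:
  assumes "dec P" "gen A f" "gen B g"
  shows "gen (A \<union> B) (\<lambda>e x. if P e x then f e x else g e x)"
proof -
  obtain c0 q0 where P: "\<And>e x \<sigma> K. rep e x \<sigma> \<Longrightarrow> bounded e x K \<Longrightarrow>
     runs c0 \<sigma> (\<sigma>(5 := P e x # \<sigma> 5)) (poly q0 K)"
    using assms(1) unfolding dec_def by meson
  obtain c q where f: "\<And>e x \<sigma> K. rep e x \<sigma> \<Longrightarrow> (\<forall>v\<in>A. e v = 0) \<Longrightarrow> bounded e x K \<Longrightarrow>
     length (f e x) \<le> poly q K \<and> runs c \<sigma> (\<sigma>(0 := f e x @ \<sigma> 0)) (poly q K)"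
    using assms(2) unfolding gen_def by meson
  obtain c' q' where g: "\<And>e x \<sigma> K. rep e x \<sigma> \<Longrightarrow> (\<forall>v\<in>B. e v = 0) \<Longrightarrow> bounded e x K \<Longrightarrow>
     length (g e x) \<le> poly q' K \<and> runs c' \<sigma> (\<sigma>(0 := g e x @ \<sigma> 0)) (poly q' K)"
    using assms(3) unfolding gen_def by meson
  show ?thesis
    unfolding gen_def
  proof (rule exI[of _ "Seq c0 (Case 5 Skip c' c)"], rule exI[of _ "q0 + (q' + q) + [:3:]"],
      intro allI impI conjI)
    fix e x \<sigma> K
    assume r: "rep e x \<sigma>" and z: "\<forall>v\<in>A \<union> B. e v = 0" and b: "bounded e x K"
    note f = f[OF r _ b] and g = g[OF r _ b]
    show "length (if P e x then f e x else g e x) \<le> poly (q0 + (q' + q) + [:3:]) K"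
      using f g z by (simp add: trans_le_add1 trans_le_add2)
    have 1: "runs (Case 5 Skip c' c) (\<sigma>(5 := P e x # \<sigma> 5))
       (\<sigma>(0 := (if P e x then f e x else g e x) @ \<sigma> 0)) (poly (q' + q) K + 3)"
    proof (rule runs_Case)
      fix w assume w: "(\<sigma>(5 := P e x # \<sigma> 5)) 5 = False # w"
      then have "\<sigma>(5 := P e x # \<sigma> 5, 5 := w) = \<sigma>" "\<not> P e x"
        by auto
      then show "runs c' (\<sigma>(5 := P e x # \<sigma> 5, 5 := w))
         (\<sigma>(0 := (if P e x then f e x else g e x) @ \<sigma> 0)) (poly (q' + q) K)"
        using runs_mono[OF conjunct2[OF g], of "poly (q' + q) K"] z by simp
    next
      fix w assume w: "(\<sigma>(5 := P e x # \<sigma> 5)) 5 = True # w"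
      then have "\<sigma>(5 := P e x # \<sigma> 5, 5 := w) = \<sigma>" "P e x"
        by auto
      then show "runs c (\<sigma>(5 := P e x # \<sigma> 5, 5 := w))
         (\<sigma>(0 := (if P e x then f e x else g e x) @ \<sigma> 0)) (poly (q' + q) K)"
        using runs_mono[OF conjunct2[OF f], of "poly (q' + q) K"] z by simp
    qed simp
    show "runs (Seq c0 (Case 5 Skip c' c)) \<sigma>
       (\<sigma>(0 := (if P e x then f e x else g e x) @ \<sigma> 0)) (poly (q0 + (q' + q) + [:3:]) K)"
      by (rule runs_weaken[OF runs_Seq[OF P[OF r b] 1]]) auto
  qed
qed

text \<open>
  Words are pushed back to front, so sequential composition runs the second generator first and
  loops count downwards.
\<close>

lemma gen_for:
  assumes "gen A f" "v \<notin> A" "v \<noteq> w"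
  shows "gen (insert v A) (\<lambda>e x. concat (map (\<lambda>i. f (e(v := i)) x) [0..<e w]))"
proof -
  obtain c q where f: "\<And>e x \<sigma> K. rep e x \<sigma> \<Longrightarrow> (\<forall>v\<in>A. e v = 0) \<Longrightarrow> bounded e x K \<Longrightarrow>
     length (f e x) \<le> poly q K \<and> runs c \<sigma> (\<sigma>(0 := f e x @ \<sigma> 0)) (poly q K)"
    using assms(1) unfolding gen_def by meson
  let ?i = "7 + v" and ?j = "7 + w"
  let ?g = "\<lambda>e x k. concat (map (\<lambda>i. f (e(v := i)) x) [0..<k])"
  let ?move = "While ?j (Psh 2 False) (Psh 2 True)"
  let ?copy = "While 2 Skip (Seq (Psh ?j True) (Psh ?i True))"
  let ?loop = "While ?i Skip c"
  \<comment> \<open>The stack of \<open>v\<close> is itself the loop counter: popping a bit leaves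
    \<open>k\<close> bits, exactly the value that the body has to see.\<close>
  have loop: "rep (e(v := k)) x \<sigma> \<Longrightarrow> length (?g e x k) \<le> k * poly q K \<and>
      runs ?loop \<sigma> (\<sigma>(?i := [], 0 := ?g e x k @ \<sigma> 0)) (k * (poly q K + 3) + 1)"
    if z: "\<forall>v\<in>insert v A. e v = 0" and b: "bounded e x K" and k: "k \<le> K" for e x K k \<sigma>
    using k
  proof (induction k arbitrary: \<sigma>)
    case 0
    then have "\<sigma> ?i = []"
      by (simp add: rep_def rep0_def)
    then show ?case
      using runs_While_Nil[of \<sigma> ?i Skip c] by (simp add: fun_upd_idem)
  next
    case (Suc k)
    let ?e = "e(v := k)"
    let ?\<sigma> = "\<sigma>(?i := replicate k True)"
    let ?\<sigma>' = "?\<sigma>(0 := f ?e x @ ?\<sigma> 0)"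
    have 0: "\<sigma> ?i = True # replicate k True"
      using Suc.prems(1) by (simp add: rep_def rep0_def)
    have r: "rep ?e x ?\<sigma>" "rep ?e x ?\<sigma>'"
      using Suc.prems(1) by (auto simp: rep_def rep0_def)
    have z': "\<forall>v\<in>A. ?e v = 0"
      using z assms(2) by auto
    have b': "bounded ?e x K"
      using b Suc.prems by (auto simp: bounded_def)
    have 1: "runs (if True then c else Skip) ?\<sigma> ?\<sigma>' (poly q K)" and l: "length (f ?e x) \<le> poly q K"
      using f[OF r(1) z' b'] by auto
    have 2: "length (?g e x k) \<le> k * poly q K" "runs ?loop ?\<sigma>'
        (?\<sigma>'(?i := [], 0 := ?g e x k @ ?\<sigma>' 0)) (k * (poly q K + 3) + 1)"
      using Suc.IH[OF r(2) Suc_leD[OF Suc.prems(2)]] by blast+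
    show ?case
    proof
      show "length (?g e x (Suc k)) \<le> Suc k * poly q K"
        using 2(1) l by simp
      show "runs ?loop \<sigma> (\<sigma>(?i := [], 0 := ?g e x (Suc k) @ \<sigma> 0)) (Suc k * (poly q K + 3) + 1)"
        by (rule runs_weaken[OF runs_While_Cons[OF 0 1 2(2)]]) (auto simp: algebra_simps)
    qed
  qed
  show ?thesis
    unfolding gen_def
  proof (rule exI[of _ "Seq (Seq ?move ?copy) ?loop"],
      rule exI[of _ "[:3, 12:] + [:0, 1:] * q"], intro allI impI)
    fix e x \<sigma> K
    assume r: "rep e x \<sigma>" and z: "\<forall>v\<in>insert v A. e v = 0" and b: "bounded e x K"
    let ?n = "e w"
    let ?\<sigma>1 = "\<sigma>(?j := [], 2 := replicate ?n True)"
    let ?\<sigma>2 = "\<sigma>(?i := replicate ?n True)"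
    have K: "?n \<le> K"
      using b by (auto simp: bounded_def)
    have \<sigma>: "\<sigma> ?i = []" "\<sigma> 2 = []" "\<sigma> ?j = replicate ?n True"
      using r z by (auto simp: rep_def rep0_def)
    have 1: "runs ?move \<sigma> ?\<sigma>1 (4 * ?n + 1)"
      using runs_move[of ?j 2 \<sigma>] \<sigma> by simp
    have 2: "runs ?copy ?\<sigma>1 ?\<sigma>2 (5 * ?n + 1)"
      by (rule runs_weaken[OF runs_copy2]) (use assms(3) \<sigma> in \<open>auto simp: fun_eq_iff\<close>)
    have r': "rep (e(v := ?n)) x ?\<sigma>2"
      using r by (auto simp: rep_def rep0_def)
    note 3 = loop[OF z b K r']
    have le: "?n * (poly q K + 3) \<le> K * (poly q K + 3)"
      using K by (rule mult_le_mono1)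
    have "length (?g e x ?n) \<le> poly ([:3, 12:] + [:0, 1:] * q) K"
      using conjunct1[OF 3] le by (simp add: algebra_simps)
    moreover have "runs (Seq (Seq ?move ?copy) ?loop) \<sigma> (\<sigma>(0 := ?g e x ?n @ \<sigma> 0))
        (poly ([:3, 12:] + [:0, 1:] * q) K)"
      by (rule runs_weaken[OF runs_Seq[OF runs_Seq[OF 1 2] conjunct2[OF 3]]])
        (use \<sigma> K le in \<open>auto simp: fun_eq_iff algebra_simps\<close>)
    ultimately show "length (?g e x (e w)) \<le> poly ([:3, 12:] + [:0, 1:] * q) K \<and>
      runs (Seq (Seq ?move ?copy) ?loop) \<sigma> (\<sigma>(0 := ?g e x (e w) @ \<sigma> 0))
        (poly ([:3, 12:] + [:0, 1:] * q) K)"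
      by blast
  qed
qed

lemma gen_const: "gen {} (\<lambda>e x. w)"
proof (induction w)
  case (Cons b w)
  from gen_append[OF gen_single[of b] this] show ?case
    by simp
qed (rule gen_Nil)

text \<open>Horner's rule: each coefficient costs one loop over \<open>e w\<close>, hence
  \<open>m\<close> consecutive loop variables, which lie above \<open>w\<close> to stay apart from
  it.\<close>

lemma gen_replicate_poly:
  "\<exists>m. \<forall>b>w. gen {b..<b + m} (\<lambda>e x. replicate (poly p (e w)) True)"
proof (induction p)
  case 0
  show ?case
    using gen_Nil by (intro exI[of _ 0]) simp
next
  case (pCons a p)
  then obtain m where m: "\<And>b. b > w \<Longrightarrow> gen {b..<b + m} (\<lambda>e x. replicate (poly p (e w)) True)"
    by blast
  have *: "concat (map (\<lambda>i. replicate c True) [0..<n]) = replicate (n * c) True" for n c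
    by (induction n) (simp_all add: replicate_add[symmetric] add.commute)
  show ?case
  proof (intro exI allI impI)
    fix b assume b: "b > w"
    have "gen (insert b {Suc b..<Suc b + m})
        (\<lambda>e x. concat (map (\<lambda>i. replicate (poly p ((e(b := i)) w)) True) [0..<e w]))"
      by (rule gen_for[OF m]) (use b in auto)
    moreover have "insert b {Suc b..<Suc b + m} = {b..<b + Suc m}"
      by auto
    ultimately have "gen ({} \<union> {b..<b + Suc m}) (\<lambda>e x. replicate a True @
        concat (map (\<lambda>i. replicate (poly p ((e(b := i)) w)) True) [0..<e w]))"
      by (intro gen_append gen_const) simp
    then show "gen {b..<b + Suc m} (\<lambda>e x. replicate (poly (pCons a p) (e w)) True)"
      using b by (simp add: * replicate_add)
  qed
qed

section \<open>Loops over tuples\<close>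

primrec tuples :: "nat \<Rightarrow> nat \<Rightarrow> nat list list" where
  "tuples 0 N = [[]]"
| "tuples (Suc d) N = concat (map (\<lambda>i. map ((#) i) (tuples d N)) [0..<N])"

lemma set_tuples: "set (tuples d N) = {l. length l = d \<and> set l \<subseteq> {..<N}}"
  by (induction d) (auto simp: length_Suc_conv)

lemma length_tuples: "length (tuples d N) = N ^ d"
  by (induction d) (simp_all add: length_concat sum_list_triv o_def)

lemma distinct_tuples: "distinct (tuples d N)"
proof (rule card_distinct)
  have "set (tuples d N) = {l. set l \<subseteq> {..<N} \<and> length l = d}"
    by (auto simp: set_tuples)
  then show "card (set (tuples d N)) = length (tuples d N)"
    by (simp add: card_lists_length_eq length_tuples)
qed

lemma concat_map_concat: "concat (map f (concat xss)) = concat (map (\<lambda>xs. concat (map f xs)) xss)"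
  by (induction xss) simp_all

primrec upd :: "nat \<Rightarrow> nat list \<Rightarrow> env \<Rightarrow> env" where
  "upd b [] e = e"
| "upd b (i # l) e = upd (Suc b) l (e(b := i))"

lemma upd_apply: "upd b l e v = (if b \<le> v \<and> v < b + length l then l ! (v - b) else e v)"
  by (induction l arbitrary: b e) (auto simp: nth_Cons' le_Suc_eq)

lemma gen_tuples:
  assumes "gen A f" "A \<inter> {b..<b + d} = {}" "w \<notin> {b..<b + d}"
  shows "gen (A \<union> {b..<b + d}) (\<lambda>e x. concat (map (\<lambda>l. f (upd b l e) x) (tuples d (e w))))"
  using assms
proof (induction d arbitrary: b)
  case 0
  then show ?case by simp
next
  case (Suc d)
  let ?A = "A \<union> {Suc b..<Suc b + d}"
  have "gen ?A (\<lambda>e x. concat (map (\<lambda>l. f (upd (Suc b) l e) x) (tuples d (e w))))"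
    by (rule Suc.IH) (use Suc.prems in auto)
  then have "gen (insert b ?A) (\<lambda>e x. concat (map (\<lambda>i. concat (map
      (\<lambda>l. f (upd (Suc b) l (e(b := i))) x) (tuples d ((e(b := i)) w)))) [0..<e w]))"
    by (rule gen_for) (use Suc.prems in auto)
  moreover have "insert b ?A = A \<union> {b..<b + Suc d}"
    by auto
  moreover have "b \<noteq> w"
    using Suc.prems by auto
  ultimately show ?case
    by (simp add: concat_map_concat o_def)
qed

section \<open>From generators to polynomial-time functions\<close>

text \<open>A program loading the inputs into an environment. The word is \<open>rev x\<close>
  because emptying stack 0 onto stack 6 reverses it; \<open>y\<close> survives only through the
  values of variables.\<close>

definition prep :: "(word \<Rightarrow> word \<Rightarrow> env) \<Rightarrow> bool" where
  "prep E \<longleftrightarrow> (\<exists>c (q :: nat poly). \<forall>x y. \<exists>\<sigma>.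
     runs c (snd (start [x, y])) \<sigma> (poly q (length x + length y)) \<and> rep (E x y) (rev x) \<sigma> \<and>
     \<sigma> 0 = [] \<and> bounded (E x y) (rev x) (poly q (length x + length y)))"

text \<open>
  On the code of an answer this is its second component, since the code of the first one ends with
  \<open>False\<close>.
\<close>

definition trailing_ones :: "word \<Rightarrow> nat" where
  "trailing_ones y = length (takeWhile id (tl (rev y)))"

text \<open>At the first \<open>False\<close> the inner loop empties stack 3, which also ends the
  outer loop.\<close>

lemma runs_count_True:
  assumes "v \<noteq> 3"
  shows "runs (While 3 (While 3 Skip Skip) (Psh v True)) \<sigma>
     (\<sigma>(3 := [], v := replicate (length (takeWhile id (\<sigma> 3))) True @ \<sigma> v)) (6 * length (\<sigma> 3) + 2)"
proof (induction "\<sigma> 3" arbitrary: \<sigma>)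
  case Nil
  then show ?case
    by (intro runs_weaken[OF runs_While_Nil[of \<sigma> 3]]) (auto simp: fun_eq_iff)
next
  case (Cons b w)
  note \<sigma> = Cons(2)[symmetric]
  show ?case
  proof (cases b)
    case True
    let ?\<sigma> = "\<sigma>(3 := w, v := True # \<sigma> v)"
    have 1: "runs (if b then Psh v True else While 3 Skip Skip) (\<sigma>(3 := w)) ?\<sigma> 1"
      using runs_Psh[of v True "\<sigma>(3 := w)"] True assms by simp
    have 2: "runs (While 3 (While 3 Skip Skip) (Psh v True)) ?\<sigma> (?\<sigma>(3 := [],
       v := replicate (length (takeWhile id (?\<sigma> 3))) True @ ?\<sigma> v)) (6 * length (?\<sigma> 3) + 2)"
      by (rule Cons(1)) (use assms in simp)
    show ?thesis
      by (rule runs_weaken[OF runs_While_Cons[OF \<sigma> 1 2]])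
        (use \<sigma> True assms in \<open>auto simp: fun_eq_iff replicate_app_Cons_same\<close>)
  next
    case False
    have 1: "runs (if b then Psh v True else While 3 Skip Skip) (\<sigma>(3 := w)) (\<sigma>(3 := []))
        (3 * length w + 1)"
      using runs_clear[of 3 "\<sigma>(3 := w)"] False by simp
    have 2: "runs (While 3 (While 3 Skip Skip) (Psh v True)) (\<sigma>(3 := [])) (\<sigma>(3 := [])) 1"
      by (rule runs_While_Nil) simp
    show ?thesis
      by (rule runs_weaken[OF runs_While_Cons[OF \<sigma> 1 2]])
        (use \<sigma> False assms in \<open>auto simp: fun_eq_iff\<close>)
  qed
qed

lemma prep_init: "prep (\<lambda>x y. (\<lambda>_. 0)(0 := length x, 3 := trailing_ones y))"
  unfolding prep_def
proof (rule exI, rule exI, intro allI exI conjI)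
  fix x y :: word
  let ?E = "(\<lambda>_. 0)(0 := length x, 3 := trailing_ones y)"
  let ?n = "length x + length y"
  let ?\<sigma>0 = "snd (start [x, y])"
  let ?\<sigma>1 = "(\<lambda>_. [])(1 := y, 6 := rev x, 7 := replicate (length x) True)"
  let ?\<sigma>2 = "(\<lambda>_. [])(3 := rev y, 6 := rev x, 7 := replicate (length x) True)"
  let ?\<sigma>3 = "(\<lambda>_. [])(3 := tl (rev y), 6 := rev x, 7 := replicate (length x) True)"
  let ?\<sigma>4 = "(\<lambda>_. [])(6 := rev x, 7 := replicate (length x) True,
    10 := replicate (trailing_ones y) True)"
  have s: "?\<sigma>0 = (\<lambda>_. [])(0 := x, 1 := y)"
    by (auto simp: start_def fun_eq_iff less_Suc_eq)
  have 1: "runs (While 0 (Seq (Psh 6 False) (Psh 7 True)) (Seq (Psh 6 True) (Psh 7 True)))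
     ?\<sigma>0 ?\<sigma>1 (5 * length x + 1)"
    by (rule runs_weaken[OF runs_move_count]) (auto simp: fun_eq_iff s)
  have 2: "runs (While 1 (Psh 3 False) (Psh 3 True)) ?\<sigma>1 ?\<sigma>2 (4 * length y + 1)"
    by (rule runs_weaken[OF runs_move]) (auto simp: fun_eq_iff)
  \<comment> \<open>All branches are empty: the test itself discards the last bit of
    \<open>y\<close>, which in a code is the end mark of a unary number.\<close>
  have 3: "runs (Case 3 Skip Skip Skip) ?\<sigma>2 ?\<sigma>3 (0 + 3)"
    by (rule runs_Case; rule runs_weaken[OF runs_Skip]) (auto simp: fun_eq_iff)
  have 4: "runs (While 3 (While 3 Skip Skip) (Psh 10 True)) ?\<sigma>3 ?\<sigma>4 (6 * length y + 2)"
    by (rule runs_weaken[OF runs_count_True]) (auto simp: fun_eq_iff trailing_ones_def)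
  show "runs (Seq (Seq (Seq (While 0 (Seq (Psh 6 False) (Psh 7 True)) (Seq (Psh 6 True) (Psh 7 True)))
    (While 1 (Psh 3 False) (Psh 3 True))) (Case 3 Skip Skip Skip))
    (While 3 (While 3 Skip Skip) (Psh 10 True))) ?\<sigma>0 ?\<sigma>4 (poly [:7, 10:] ?n)"
    by (rule runs_weaken[OF runs_Seq[OF runs_Seq[OF runs_Seq[OF 1 2] 3] 4]]) auto
  show "rep ?E (rev x) ?\<sigma>4"
    by (auto simp: rep_def rep0_def)
  have "trailing_ones y \<le> length y"
    unfolding trailing_ones_def
    by (rule order_trans[OF length_takeWhile_le]) simp
  then show "bounded ?E (rev x) (poly [:7, 10:] ?n)"
    by (auto simp: bounded_def)
qed simp

text \<open>Turns a generator into an assignment: a unary output is moved from stack 0 to the stack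
  of the variable \<open>j\<close>. The generator is polynomial in the bound on the environment,
  which is itself polynomial in the input, hence \<open>pcompose\<close>.\<close>

lemma prep_update:
  assumes E: "prep E" and f: "gen A f"
    and A: "\<And>x y v. v \<in> A \<Longrightarrow> E x y v = 0" and j: "\<And>x y. E x y j = 0"
    and h: "\<And>x y. f (E x y) (rev x) = replicate (h x y) True"
  shows "prep (\<lambda>x y. (E x y)(j := h x y))"
proof -
  obtain c and q :: "nat poly" where E: "\<And>(x :: word) (y :: word). \<exists>\<sigma>.
     runs c (snd (start [x, y])) \<sigma> (poly q (length x + length y)) \<and> rep (E x y) (rev x) \<sigma> \<and>
     \<sigma> 0 = [] \<and> bounded (E x y) (rev x) (poly q (length x + length y))"
    using E unfolding prep_def by blast
  obtain c' q' where f: "\<And>e x \<sigma> K. rep e x \<sigma> \<Longrightarrow> (\<forall>v\<in>A. e v = 0) \<Longrightarrow> bounded e x K \<Longrightarrow>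
     length (f e x) \<le> poly q' K \<and> runs c' \<sigma> (\<sigma>(0 := f e x @ \<sigma> 0)) (poly q' K)"
    using f unfolding gen_def by meson
  let ?move = "While 0 (Psh (7 + j) False) (Psh (7 + j) True)"
  let ?q = "q + 5 * pcompose q' q + [:1:]"
  show ?thesis
    unfolding prep_def
  proof (rule exI[of _ "Seq (Seq c c') ?move"], rule exI[of _ ?q], intro allI)
    fix x y :: word
    let ?n = "length x + length y"
    obtain \<sigma> where \<sigma>: "runs c (snd (start [x, y])) \<sigma> (poly q ?n)" "rep (E x y) (rev x) \<sigma>"
      "\<sigma> 0 = []" "bounded (E x y) (rev x) (poly q ?n)"
      using E by blast
    let ?\<sigma> = "\<sigma>(0 := replicate (h x y) True)"
    let ?\<sigma>' = "\<sigma>(7 + j := replicate (h x y) True)"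
    have "\<forall>v\<in>A. E x y v = 0"
      using A by blast
    note f = f[OF \<sigma>(2) this \<sigma>(4)]
    have 1: "runs c' \<sigma> ?\<sigma> (poly q' (poly q ?n))" and l: "h x y \<le> poly q' (poly q ?n)"
      using f h \<sigma>(3) by auto
    have z: "\<sigma> (7 + j) = []"
      using \<sigma>(2) j[of x y] by (auto simp: rep_def rep0_def)
    have 2: "runs ?move ?\<sigma> ?\<sigma>' (4 * h x y + 1)"
      by (rule runs_weaken[OF runs_move]) (use z \<sigma>(3) in \<open>auto simp: fun_eq_iff\<close>)
    have "runs (Seq (Seq c c') ?move) (snd (start [x, y])) ?\<sigma>' (poly ?q ?n)"
      by (rule runs_weaken[OF runs_Seq[OF runs_Seq[OF \<sigma>(1) 1] 2]])
        (use l in \<open>auto simp: poly_pcompose\<close>)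
    moreover have "rep ((E x y)(j := h x y)) (rev x) ?\<sigma>'"
      using \<sigma>(2) by (auto simp: rep_def rep0_def)
    moreover have "bounded ((E x y)(j := h x y)) (rev x) (poly ?q ?n)"
      using \<sigma>(4) l by (auto simp: bounded_def poly_pcompose intro!: trans_le_add1 le_SucI)
    ultimately show "\<exists>\<sigma>. runs (Seq (Seq c c') ?move) (snd (start [x, y])) \<sigma> (poly ?q ?n) \<and>
      rep ((E x y)(j := h x y)) (rev x) \<sigma> \<and> \<sigma> 0 = [] \<and>
      bounded ((E x y)(j := h x y)) (rev x) (poly ?q ?n)"
      using \<sigma>(3) by (intro exI[of _ ?\<sigma>']) simp
  qed
qed

lemma prep_run:
  assumes E: "prep E" and f: "gen A f" and A: "\<And>x y v. v \<in> A \<Longrightarrow> E x y v = 0"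
  shows "\<exists>c (q :: nat poly). \<forall>(x :: word) (y :: word). \<exists>\<sigma>.
     runs c (snd (start [x, y])) \<sigma> (poly q (length x + length y)) \<and> \<sigma> 0 = f (E x y) (rev x)"
proof -
  obtain c and q :: "nat poly" where E: "\<And>(x :: word) (y :: word). \<exists>\<sigma>.
     runs c (snd (start [x, y])) \<sigma> (poly q (length x + length y)) \<and> rep (E x y) (rev x) \<sigma> \<and>
     \<sigma> 0 = [] \<and> bounded (E x y) (rev x) (poly q (length x + length y))"
    using E unfolding prep_def by blast
  obtain c' q' where f: "\<And>e x \<sigma> K. rep e x \<sigma> \<Longrightarrow> (\<forall>v\<in>A. e v = 0) \<Longrightarrow> bounded e x K \<Longrightarrow>
     length (f e x) \<le> poly q' K \<and> runs c' \<sigma> (\<sigma>(0 := f e x @ \<sigma> 0)) (poly q' K)"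
    using f unfolding gen_def by meson
  show ?thesis
  proof (rule exI[of _ "Seq c c'"], rule exI[of _ "q + pcompose q' q"], intro allI)
    fix x y :: word
    let ?n = "length x + length y"
    obtain \<sigma> where \<sigma>: "runs c (snd (start [x, y])) \<sigma> (poly q ?n)" "rep (E x y) (rev x) \<sigma>"
      "\<sigma> 0 = []" "bounded (E x y) (rev x) (poly q ?n)"
      using E by blast
    have "\<forall>v\<in>A. E x y v = 0"
      using A by blast
    note f = f[OF \<sigma>(2) this \<sigma>(4)]
    show "\<exists>\<sigma>. runs (Seq c c') (snd (start [x, y])) \<sigma> (poly (q + pcompose q' q) ?n) \<and>
      \<sigma> 0 = f (E x y) (rev x)"
      using runs_Seq[OF \<sigma>(1) conjunct2[OF f]] \<sigma>(3) by (auto simp: poly_pcompose)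
  qed
qed

lemma polytime_functionI:
  assumes "prep E" "gen A f" "\<And>x y v. v \<in> A \<Longrightarrow> E x y v = 0"
  shows "polytime_function (\<lambda>x. f (E x []) (rev x))"
proof -
  obtain c and q :: "nat poly" where c: "\<And>(x :: word) (y :: word). \<exists>\<sigma>. runs c (snd (start [x, y])) \<sigma>
     (poly q (length x + length y)) \<and> \<sigma> 0 = f (E x y) (rev x)"
    using prep_run[OF assms] by blast
  have s: "snd (start [x]) = snd (start [x, []])" for x
    by (auto simp: start_def fun_eq_iff less_Suc_eq)
  have "computes_within (compile 0 c) [x] (poly q (length x)) (f (E x []) (rev x))" for x
    using c[of x "[]"] s[of x] by (auto intro: runs_computes_within)
  then show ?thesis
    unfolding polytime_function_def by blast
qed

lemma polytime_relationI:
  assumes "prep E" "gen A f" "\<And>x y v. v \<in> A \<Longrightarrow> E x y v = 0"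
    and "\<And>x y. f (E x y) (rev x) = [V x y]"
  shows "polytime_relation V"
proof -
  obtain c and q :: "nat poly" where c: "\<And>(x :: word) (y :: word). \<exists>\<sigma>. runs c (snd (start [x, y])) \<sigma>
     (poly q (length x + length y)) \<and> \<sigma> 0 = f (E x y) (rev x)"
    using prep_run[OF assms(1-3)] by blast
  have "computes_within (compile 0 c) [x, y] (poly q (length x + length y)) [V x y]" for x y
    using c[of x y] assms(4) by (auto intro: runs_computes_within)
  then show ?thesis
    unfolding polytime_relation_def by blast
qed

section \<open>The computation tableau as an independent_set set problem\<close>

text \<open>
  Before the verifier starts, the input is pushed onto stack \<open>0\<close>, and in \<open>G\<close> further steps a
  certificate is guessed onto stack \<open>1\<close>; during this prologue the program counter is the code of
  the pushed bit, and \<open>2\<close> or more means that nothing is pushed. \<open>X\<close> is the reversed input.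
\<close>

definition act :: "instr list \<Rightarrow> word \<Rightarrow> nat \<Rightarrow> nat \<Rightarrow> nat \<Rightarrow> instr option" where
  "act P X G \<tau> q =
    (if \<tau> < length X then Some (Push 0 (q = 1))
     else if \<tau> < length X + G then (if q < 2 then Some (Push 1 (q = 1)) else None)
     else if q < length P then Some (P ! q) else None)"

text \<open>The last time that has vertices is \<open>N - 1\<close>. Having halted there excludes a
  push at that time, which keeps all pointers below \<open>N\<close>.\<close>

definition valid_code :: "instr list \<Rightarrow> word \<Rightarrow> nat \<Rightarrow> nat \<Rightarrow> nat \<Rightarrow> nat \<Rightarrow> bool" where
  "valid_code P X G N \<tau> q \<longleftrightarrow> (\<tau> < length X \<longrightarrow> q = of_bool (X ! \<tau>)) \<and>
     (\<tau> = length X + G \<longrightarrow> q = 0) \<and> (Suc \<tau> = N \<longrightarrow> length P \<le> q)"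

definition effect :: "instr list \<Rightarrow> word \<Rightarrow> nat \<Rightarrow> nat \<Rightarrow> config \<Rightarrow> config" where
  "effect P X G \<tau> c = (case act P X G \<tau> (fst c) of None \<Rightarrow> c | Some I \<Rightarrow> exec I c)"

text \<open>During the prologue the next code does not follow from the previous one: it is an input
  bit or a guess. So the program counter is tied to \<open>effect\<close> only from time
  \<open>length X + G\<close> on.\<close>

definition accepting_run ::
    "instr list \<Rightarrow> word \<Rightarrow> nat \<Rightarrow> nat \<Rightarrow> (nat \<Rightarrow> nat) \<Rightarrow> (nat \<Rightarrow> stacks) \<Rightarrow> bool" where
  "accepting_run P X G N pc \<sigma> \<longleftrightarrow> \<sigma> 0 = (\<lambda>_. []) \<and> (\<forall>\<tau>\<le>N. pc \<tau> < N) \<and>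
     (\<forall>\<tau><N. valid_code P X G N \<tau> (pc \<tau>) \<and>
        \<sigma> (Suc \<tau>) = snd (effect P X G \<tau> (pc \<tau>, \<sigma> \<tau>)) \<and>
        (length X + G \<le> \<tau> \<longrightarrow> pc (Suc \<tau>) = fst (effect P X G \<tau> (pc \<tau>, \<sigma> \<tau>)))) \<and>
     \<sigma> (N - 1) 0 = [True]"

section \<open>Accepting runs and membership in the language\<close>

fun instr_le :: "nat \<Rightarrow> instr \<Rightarrow> bool" where
  "instr_le c (Push i b) \<longleftrightarrow> i \<le> c"
| "instr_le c (Pop i e f t) \<longleftrightarrow> i \<le> c \<and> e \<le> c \<and> f \<le> c \<and> t \<le> c"

lemma instr_le_mono: "instr_le c I \<Longrightarrow> c \<le> c' \<Longrightarrow> instr_le c' I"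
  by (cases I) auto

text \<open>Once \<open>N\<close> exceeds this constant of the verifier, its program counters and
  the indices of the stacks it uses are below \<open>N\<close> and thus fit into vertices.\<close>

lemma instr_le_exists: "\<exists>c. length P \<le> c \<and> (\<forall>I\<in>set P. instr_le c I)"
proof (induction P)
  case (Cons I P)
  then obtain c where c: "length P \<le> c" "\<forall>I\<in>set P. instr_le c I"
    by blast
  obtain c' where "instr_le c' I"
  proof (cases I)
    case (Push i b)
    then show ?thesis
      using that[of i] by simp
  next
    case (Pop i e f t)
    then show ?thesis
      using that[of "i + e + f + t"] by simp
  qed
  with c show ?case
    by (intro exI[of _ "Suc (c + c')"]) (auto intro: instr_le_mono)
qed simp

lemma pc_step_le:
  assumes "length P \<le> c" "\<forall>I\<in>set P. instr_le c I"
  shows "fst ((step P ^^ m) (0, \<sigma>)) \<le> c"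
proof (induction m)
  case (Suc m)
  obtain q \<rho> where q: "(step P ^^ m) (0, \<sigma>) = (q, \<rho>)"
    by fastforce
  have "fst (step P (q, \<rho>)) \<le> c"
  proof (cases "q < length P")
    case True
    then have "instr_le c (P ! q)"
      using assms(2) by simp
    then show ?thesis
      using True assms(1) by (cases "P ! q") (auto simp: step_def split: list.splits)
  next
    case False
    moreover have "q \<le> c"
      using q Suc by simp
    ultimately show ?thesis
      by (simp add: step_def)
  qed
  with q show ?case
    by simp
qed simp

lemma effect_eq_step: "length X + G \<le> \<tau> \<Longrightarrow> effect P X G \<tau> c = step P c"
  by (simp add: effect_def act_def step_def)

text \<open>Pushing the bits of \<open>rev x\<close> in order builds \<open>x\<close> on stack 0,
  the guessing steps build some \<open>y\<close> on stack 1, and from then on the run is that of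
  \<open>P\<close> started on both.\<close>

lemma accepting_run_sound:
  assumes run: "accepting_run P X G N pc \<sigma>" and X: "X = rev x"
    and time: "\<And>y. length y \<le> G \<Longrightarrow> computes_within P [x, y] T [V x y]"
    and N: "length x + G + T < N"
  shows "\<exists>y. length y \<le> G \<and> V x y"
proof -
  let ?n = "length X"
  have s0: "\<sigma> 0 = (\<lambda>_. [])"
    and val: "\<And>\<tau>. \<tau> < N \<Longrightarrow> valid_code P X G N \<tau> (pc \<tau>)"
    and s: "\<And>\<tau>. \<tau> < N \<Longrightarrow> \<sigma> (Suc \<tau>) = snd (effect P X G \<tau> (pc \<tau>, \<sigma> \<tau>))"
    and p: "\<And>\<tau>. \<tau> < N \<Longrightarrow> ?n + G \<le> \<tau> \<Longrightarrow> pc (Suc \<tau>) = fst (effect P X G \<tau> (pc \<tau>, \<sigma> \<tau>))"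
    and fin: "\<sigma> (N - 1) 0 = [True]"
    using run by (auto simp: accepting_run_def)
  have N': "?n + G + T < N"
    using N X by simp
  have A: "\<tau> \<le> ?n \<Longrightarrow> \<sigma> \<tau> = (\<lambda>_. [])(0 := rev (take \<tau> X))" for \<tau>
  proof (induction \<tau>)
    case (Suc \<tau>)
    then have "(pc \<tau> = 1) = X ! \<tau>"
      using val[of \<tau>] N' by (simp add: valid_code_def)
    with Suc show ?case
      using s[of \<tau>] N' by (auto simp: effect_def act_def take_Suc_conv_app_nth fun_eq_iff)
  qed (simp add: s0 fun_eq_iff)
  have B: "j \<le> G \<Longrightarrow> \<exists>y. length y \<le> j \<and> \<sigma> (?n + j) = (\<lambda>_. [])(0 := x, 1 := y)" for j
  proof (induction j)
    case 0
    then show ?case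
      using A[of ?n] X by (auto simp: fun_eq_iff)
  next
    case (Suc j)
    then obtain y where y: "length y \<le> j" "\<sigma> (?n + j) = (\<lambda>_. [])(0 := x, 1 := y)"
      using Suc_leD by blast
    show ?case
    proof (cases "pc (?n + j) < 2")
      case True
      then show ?thesis
        using s[of "?n + j"] y Suc.prems N'
        by (intro exI[of _ "(pc (?n + j) = 1) # y"]) (auto simp: effect_def act_def)
    next
      case False
      then show ?thesis
        using s[of "?n + j"] y Suc.prems N'
        by (intro exI[of _ y]) (auto simp: effect_def act_def)
    qed
  qed
  then obtain y where y: "length y \<le> G" "\<sigma> (?n + G) = (\<lambda>_. [])(0 := x, 1 := y)"
    by blast
  have st: "start [x, y] = (0, (\<lambda>_. [])(0 := x, 1 := y))"
    by (auto simp: start_def fun_eq_iff less_Suc_eq)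
  have C: "?n + G + m \<le> N \<Longrightarrow> (pc (?n + G + m), \<sigma> (?n + G + m)) = (step P ^^ m) (start [x, y])" for m
  proof (induction m)
    case 0
    then show ?case
      using val[of "?n + G"] N' y st by (auto simp: valid_code_def fun_eq_iff)
  next
    case (Suc m)
    then show ?case
      using s[of "?n + G + m"] p[of "?n + G + m"] by (simp add: effect_eq_step)
  qed
  \<comment> \<open>The verifier has \<open>m\<close> steps until time \<open>N - 1\<close>, at
    least \<open>T\<close>, and a halted configuration no longer changes.\<close>
  define m where "m = N - 1 - (?n + G)"
  have m: "?n + G + m = N - 1" "T \<le> m"
    using N' by (auto simp: m_def)
  then have "(step P ^^ m) (start [x, y]) = (pc (N - 1), \<sigma> (N - 1))"
    using C[of m] by simp
  moreover obtain c where c: "(step P ^^ T) (start [x, y]) = c" "length P \<le> fst c" "snd c 0 = [V x y]"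
    using time[OF y(1)] by (auto simp: computes_within_def Let_def)
  ultimately have "c = (pc (N - 1), \<sigma> (N - 1))"
    using steps_halted[OF c(1) c(2) m(2)] by simp
  with c fin y show ?thesis
    by auto
qed

lemma accepting_run_complete:
  assumes X: "X = rev x" and y: "length y \<le> G" "V x y"
    and time: "computes_within P [x, y] T [V x y]"
    and P: "length P \<le> c" "\<forall>I\<in>set P. instr_le c I"
    and N: "length x + G + T < N" "c < N" "2 < N"
  shows "\<exists>pc \<sigma>. accepting_run P X G N pc \<sigma>"
proof -
  let ?n = "length X"
  let ?run = "\<lambda>\<tau>. (step P ^^ (\<tau> - (?n + G))) (start [x, y])"
  \<comment> \<open>The certificate is pushed from its last bit to its first, in the last
    \<open>length y\<close> guessing steps; the earlier ones carry the code 2 and push nothing. So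
    time \<tau> is responsible for index \<open>?n + G - \<tau> - 1\<close>.\<close>
  define pc where "pc = (\<lambda>\<tau>. if \<tau> < ?n then of_bool (X ! \<tau>)
    else if \<tau> < ?n + G then
      (if ?n + G - \<tau> - 1 < length y then of_bool (y ! (?n + G - \<tau> - 1)) else 2)
    else fst (?run \<tau>))"
  define \<sigma> where "\<sigma> = (\<lambda>\<tau>. if \<tau> < ?n then (\<lambda>_. [])(0 := rev (take \<tau> X))
    else if \<tau> < ?n + G then (\<lambda>_. [])(0 := x, 1 := drop (?n + G - \<tau>) y)
    else snd (?run \<tau>))"
  have st: "start [x, y] = (0, (\<lambda>_. [])(0 := x, 1 := y))"
    by (auto simp: start_def fun_eq_iff less_Suc_eq)
  have N': "?n + G + T < N"
    using N X by simp
  have s1: "\<sigma> \<tau> = (\<lambda>_. [])(0 := rev (take \<tau> X))" if "\<tau> \<le> ?n" for \<tau>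
    using that X y by (auto simp: \<sigma>_def st fun_eq_iff)
  have s2: "\<sigma> \<tau> = (\<lambda>_. [])(0 := x, 1 := drop (?n + G - \<tau>) y)" if "?n \<le> \<tau>" "\<tau> \<le> ?n + G" for \<tau>
    using that by (auto simp: \<sigma>_def st fun_eq_iff)
  have s3: "(pc \<tau>, \<sigma> \<tau>) = ?run \<tau>" if "?n + G \<le> \<tau>" for \<tau>
    using that by (simp add: \<sigma>_def pc_def)
  have step: "\<sigma> (Suc \<tau>) = snd (effect P X G \<tau> (pc \<tau>, \<sigma> \<tau>)) \<and>
        (?n + G \<le> \<tau> \<longrightarrow> pc (Suc \<tau>) = fst (effect P X G \<tau> (pc \<tau>, \<sigma> \<tau>)))" for \<tau>
  proof -
    consider "\<tau> < ?n" | "?n \<le> \<tau>" "\<tau> < ?n + G" | "?n + G \<le> \<tau>"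
      by linarith
    then show ?thesis
    proof cases
      case 1
      then have "pc \<tau> = of_bool (X ! \<tau>)"
        by (simp add: pc_def)
      with 1 show ?thesis
        using s1[of \<tau>] s1[of "Suc \<tau>"] by (simp add: effect_def act_def take_Suc_conv_app_nth)
    next
      case 2
      define k where "k = ?n + G - \<tau> - 1"
      have k: "?n + G - \<tau> = Suc k" "?n + G - Suc \<tau> = k"
        using 2 by (auto simp: k_def)
      have q: "pc \<tau> = (if k < length y then of_bool (y ! k) else 2)"
        using 2 by (simp add: pc_def k_def)
      show ?thesis
      proof (cases "k < length y")
        case True
        then have "drop k y = y ! k # drop (Suc k) y"
          by (simp add: Cons_nth_drop_Suc)
        with True show ?thesis
          using 2 s2[of \<tau>] s2[of "Suc \<tau>"] k q by (auto simp: effect_def act_def fun_eq_iff)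
      next
        case False
        then show ?thesis
          using 2 s2[of \<tau>] s2[of "Suc \<tau>"] k q by (auto simp: effect_def act_def fun_eq_iff)
      qed
    next
      case 3
      then have "(pc (Suc \<tau>), \<sigma> (Suc \<tau>)) = step P (pc \<tau>, \<sigma> \<tau>)"
        using s3[of \<tau>] s3[of "Suc \<tau>"] by (simp add: Suc_diff_le)
      then show ?thesis
        using 3 by (metis effect_eq_step fst_conv snd_conv)
    qed
  qed
  let ?m = "N - 1 - (?n + G)"
  obtain d where d: "(step P ^^ T) (start [x, y]) = d" "length P \<le> fst d" "snd d 0 = [V x y]"
    using time by (auto simp: computes_within_def Let_def)
  have "(step P ^^ ?m) (start [x, y]) = d"
    by (rule steps_halted[OF d(1,2)]) (use N' in simp)
  moreover have "?n + G \<le> N - 1"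
    using N' by simp
  ultimately have "(pc (N - 1), \<sigma> (N - 1)) = d"
    using s3[of "N - 1"] by simp
  then have last: "length P \<le> pc (N - 1)" "\<sigma> (N - 1) 0 = [True]"
    using d y(2) by auto
  have "pc \<tau> < N" for \<tau>
    using N pc_step_le[OF P, of "\<tau> - (?n + G)" "(\<lambda>_. [])(0 := x, 1 := y)"]
    by (auto simp: pc_def st)
  moreover have "valid_code P X G N \<tau> (pc \<tau>)" for \<tau>
    unfolding valid_code_def
  proof (intro conjI impI)
    assume "Suc \<tau> = N"
    then show "length P \<le> pc \<tau>"
      using last(1) by auto
  qed (simp_all add: pc_def st)
  moreover have "\<sigma> 0 = (\<lambda>_. [])"
    using s1[of 0] by (auto simp: fun_eq_iff)
  ultimately show ?thesis
    unfolding accepting_run_def using step last(2) by blast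
qed

text \<open>
  A vertex is a list \<open>[\<tau>, i, q, q', a, u]\<close>: at time \<open>\<tau>\<close> the program counter is \<open>q\<close> and the top pointer
  of stack \<open>i\<close> is \<open>a\<close>, and at time \<open>Suc \<tau>\<close> they are \<open>q'\<close> and \<open>u\<close>.
\<close>

definition local_ok ::
    "instr list \<Rightarrow> word \<Rightarrow> nat \<Rightarrow> nat \<Rightarrow> nat \<Rightarrow> nat \<Rightarrow> nat \<Rightarrow> nat \<Rightarrow> nat \<Rightarrow> nat \<Rightarrow> bool" where
  "local_ok P X G N \<tau> i q q' a u \<longleftrightarrow>
     valid_code P X G N \<tau> q \<and> (\<tau> = 0 \<longrightarrow> a = 0) \<and> (Suc \<tau> = N \<and> i = 0 \<longrightarrow> a \<noteq> 0) \<and>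
     (case act P X G \<tau> q of
        None \<Rightarrow> u = a \<and> (length X + G \<le> \<tau> \<longrightarrow> q' = q)
      | Some (Push j b) \<Rightarrow> u = (if i = j then Suc \<tau> else a) \<and> (length X + G \<le> \<tau> \<longrightarrow> q' = Suc q)
      | Some (Pop j e f t) \<Rightarrow>
          (if i = j then (if a = 0 then u = 0 \<and> q' = e else q' = f \<or> q' = t) else u = a))"

text \<open>Settles what \<open>local_ok\<close> leaves open. Here \<open>v\<close> is the vertex of
  the push of the top bit seen by \<open>w\<close>: its bit selects the jump target, and its pointer
  before the push is the pointer after the pop. At the last time, a \<open>True\<close> pushed onto
  an empty stack 0 means that the output is \<open>[True]\<close>.\<close>

definition pop_ok :: "instr list \<Rightarrow> word \<Rightarrow> nat \<Rightarrow> nat \<Rightarrow> nat list \<Rightarrow> nat list \<Rightarrow> bool" where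
  "pop_ok P X G N v w \<longleftrightarrow>
     (case act P X G (w ! 0) (w ! 2) of
        Some (Pop j e f t) \<Rightarrow> j = w ! 1 \<longrightarrow>
          (\<exists>b. act P X G (v ! 0) (v ! 2) = Some (Push j b) \<and> w ! 3 = (if b then t else f)) \<and>
          w ! 5 = v ! 4
      | _ \<Rightarrow> True) \<and>
     (Suc (w ! 0) = N \<and> w ! 1 = 0 \<longrightarrow>
        act P X G (v ! 0) (v ! 2) = Some (Push 0 True) \<and> v ! 4 = 0)"

text \<open>A vertex that is not \<open>local_ok\<close> conflicts with every vertex, so no
  independent set with a second element contains it. The relation is not symmetric: independence
  ranges over ordered pairs, and \<open>edge_list\<close> symmetrizes it.\<close>

definition conflict :: "instr list \<Rightarrow> word \<Rightarrow> nat \<Rightarrow> nat \<Rightarrow> nat list \<Rightarrow> nat list \<Rightarrow> bool" where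
  "conflict P X G N v w \<longleftrightarrow>
     \<not> local_ok P X G N (v ! 0) (v ! 1) (v ! 2) (v ! 3) (v ! 4) (v ! 5) \<or>
     v ! 0 = w ! 0 \<and> (v ! 1 = w ! 1 \<or> v ! 2 \<noteq> w ! 2 \<or> v ! 3 \<noteq> w ! 3) \<or>
     v ! 1 = w ! 1 \<and> w ! 0 = Suc (v ! 0) \<and> (v ! 3 \<noteq> w ! 2 \<or> v ! 5 \<noteq> w ! 4) \<or>
     v ! 1 = w ! 1 \<and> w ! 4 = Suc (v ! 0) \<and> \<not> pop_ok P X G N v w"

definition independent_set :: "('a \<Rightarrow> 'a \<Rightarrow> bool) \<Rightarrow> 'a set \<Rightarrow> bool" where
  "independent_set E C \<longleftrightarrow> (\<forall>v\<in>C. \<forall>w\<in>C. v \<noteq> w \<longrightarrow> \<not> E v w)"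

section \<open>Independent sets and accepting runs\<close>

lemma act_PopD: "act P X G \<tau> q = Some (Pop j e f t) \<Longrightarrow> length X + G \<le> \<tau> \<and> Pop j e f t \<in> set P"
  by (auto simp: act_def split: if_splits) (metis nth_mem)

lemma independent_imp_run:
  assumes C: "C \<subseteq> set (tuples 6 N)" "card C = N ^ 2" "independent_set (conflict P X G N) C"
    and P: "\<forall>I\<in>set P. instr_le c I"
    and N: "length X + G < N" "c < N" "2 < N"
  shows "\<exists>pc \<sigma>. accepting_run P X G N pc \<sigma>"
proof -
  have ind: "\<not> conflict P X G N v w" if "v \<in> C" "w \<in> C" "v \<noteq> w" for v w
    using C(3) that by (auto simp: independent_set_def)
  have less: "v ! m < N" if "v \<in> C" "m < 6" for v m
    using C(1) that by (force simp: set_tuples)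
  \<comment> \<open>Different vertices with the same time and stack conflict, so the
    \<open>N ^ 2\<close> elements of \<open>C\<close> have distinct pairs and therefore use every
    pair exactly once.\<close>
  have "inj_on (\<lambda>v. (v ! 0, v ! 1)) C"
    using ind by (fastforce simp: inj_on_def conflict_def)
  moreover have "(\<lambda>v. (v ! 0, v ! 1)) ` C \<subseteq> {..<N} \<times> {..<N}"
    using less by auto
  ultimately have img: "(\<lambda>v. (v ! 0, v ! 1)) ` C = {..<N} \<times> {..<N}"
    using C(2) by (intro card_subset_eq) (auto simp: card_image power2_eq_square)
  have "\<exists>v\<in>C. v ! 0 = \<tau> \<and> v ! 1 = i" if "\<tau> < N" "i < N" for \<tau> i
  proof -
    have "(\<tau>, i) \<in> (\<lambda>v. (v ! 0, v ! 1)) ` C"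
      using that img by auto
    then show ?thesis by auto
  qed
  then obtain v where v: "\<And>\<tau> i. \<tau> < N \<Longrightarrow> i < N \<Longrightarrow> v \<tau> i \<in> C \<and> v \<tau> i ! 0 = \<tau> \<and> v \<tau> i ! 1 = i"
    by metis
  have neq: "v \<tau> i \<noteq> v \<tau>' i'" if "\<tau> < N" "i < N" "\<tau>' < N" "i' < N" "(\<tau>, i) \<noteq> (\<tau>', i')" for \<tau> i \<tau>' i'
    using v[of \<tau> i] v[of \<tau>' i'] that by auto
  have nc: "\<not> conflict P X G N (v \<tau> i) (v \<tau>' i')"
    if "\<tau> < N" "i < N" "\<tau>' < N" "i' < N" "(\<tau>, i) \<noteq> (\<tau>', i')" for \<tau> i \<tau>' i'
    using ind[of "v \<tau> i" "v \<tau>' i'"] neq[OF that] v that by blast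
  \<comment> \<open>No vertex belongs to time \<open>N\<close>; its program counter is the successor
    field of a last vertex.\<close>
  define pc where "pc = (\<lambda>\<tau>. if \<tau> < N then v \<tau> 0 ! 2 else v (N - 1) 0 ! 3)"
  define a where "a = (\<lambda>\<tau> i. v \<tau> i ! 4)"
  define u where "u = (\<lambda>\<tau> i. v \<tau> i ! 5)"
  have q: "v \<tau> i ! 2 = pc \<tau>" if "\<tau> < N" "i < N" for \<tau> i
    using nc[of \<tau> i \<tau> 0] v[of \<tau> i] v[of \<tau> 0] that
    by (cases "i = 0") (auto simp: pc_def conflict_def)
  have q': "v \<tau> i ! 3 = pc (Suc \<tau>)" if "\<tau> < N" "i < N" for \<tau> i
  proof (cases "Suc \<tau> < N")
    case True
    then show ?thesis
      using nc[of \<tau> i "Suc \<tau>" i] v[of \<tau> i] v[of "Suc \<tau>" i] q[of "Suc \<tau>" i] that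
      by (auto simp: conflict_def)
  next
    case False
    then have "N = Suc \<tau>"
      using that by simp
    then show ?thesis
      using nc[of \<tau> i \<tau> 0] v[of \<tau> i] v[of \<tau> 0] that
      by (cases "i = 0") (auto simp: pc_def conflict_def)
  qed
  have au: "a (Suc \<tau>) i = u \<tau> i" if "Suc \<tau> < N" "i < N" for \<tau> i
    using nc[of \<tau> i "Suc \<tau>" i] v[of \<tau> i] v[of "Suc \<tau>" i] that
    by (auto simp: conflict_def a_def u_def)
  \<comment> \<open>Absence of a conflict with any second vertex of \<open>C\<close> gives
    \<open>local_ok\<close>; the one chosen has the same time and another stack.\<close>
  have ok: "local_ok P X G N \<tau> i (pc \<tau>) (pc (Suc \<tau>)) (a \<tau> i) (u \<tau> i)" if "\<tau> < N" "i < N" for \<tau> i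
    using nc[of \<tau> i \<tau> "if i = 0 then 1 else 0"] v[of \<tau> i] that N q[of \<tau> i] q'[of \<tau> i]
    by (auto simp: conflict_def a_def u_def)
  have pop: "pop_ok P X G N (v p i) (v \<tau> i)" if "p < \<tau>" "\<tau> < N" "i < N" "a \<tau> i = Suc p" for p \<tau> i
    using nc[of p i \<tau> i] v[of p i] v[of \<tau> i] that
    by (auto simp: conflict_def a_def)
  define \<sigma> where "\<sigma> = rec_nat (\<lambda>_. []) (\<lambda>\<tau> s. snd (effect P X G \<tau> (pc \<tau>, s)))"
  have s0: "\<sigma> 0 = (\<lambda>_. [])" and s: "\<And>\<tau>. \<sigma> (Suc \<tau>) = snd (effect P X G \<tau> (pc \<tau>, \<sigma> \<tau>))"
    by (simp_all add: \<sigma>_def)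
  \<comment> \<open>The pointer names the push of the top bit, and the rest of the stack is the
    stack at time \<open>p\<close>. After a pop the invariant is needed at that earlier time, hence
    the strong induction.\<close>
  define top where "top = (\<lambda>\<tau> i. a \<tau> i = 0 \<and> \<sigma> \<tau> i = [] \<or>
     (\<exists>p b. a \<tau> i = Suc p \<and> p < \<tau> \<and> act P X G p (pc p) = Some (Push i b) \<and> \<sigma> \<tau> i = b # \<sigma> p i))"
  have top: "top \<tau> i" if "\<tau> < N" "i < N" for \<tau> i
    using that
  proof (induction \<tau> arbitrary: i rule: less_induct)
    case (less \<tau>)
    show ?case
    proof (cases \<tau>)
      case 0
      then show ?thesis
        using ok[of 0 i] less.prems by (simp add: top_def s0 local_ok_def)
    next
      case (Suc \<rho>)
      have \<rho>: "\<rho> < N" "top \<rho> i"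
        using less Suc by auto
      note ok = ok[OF \<rho>(1) less.prems(2)] and au = au[of \<rho> i]
      show ?thesis
      proof (cases "act P X G \<rho> (pc \<rho>)")
        case None
        then show ?thesis
          using ok au less.prems Suc \<rho>(2) s[of \<rho>] by (auto simp: local_ok_def top_def effect_def)
      next
        case (Some I)
        show ?thesis
        proof (cases I)
          case (Push j b)
          then show ?thesis
            using ok au less.prems Suc \<rho>(2) s[of \<rho>] Some
            by (cases "i = j") (auto simp: local_ok_def top_def effect_def)
        next
          case (Pop j e f t)
          show ?thesis
          proof (cases "i = j")
            case False
            then show ?thesis
              using ok au less.prems Suc \<rho>(2) s[of \<rho>] Some Pop
              by (auto simp: local_ok_def top_def effect_def split: list.splits)
          next
            case True
            show ?thesis
            proof (cases "a \<rho> i")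
              case 0
              then show ?thesis
                using ok au less.prems Suc \<rho>(2) s[of \<rho>] Some Pop True
                by (auto simp: local_ok_def top_def effect_def)
            next
              case (Suc p)
              then obtain b where b: "p < \<rho>" "\<sigma> \<rho> i = b # \<sigma> p i"
                using \<rho>(2) by (auto simp: top_def)
              have "pop_ok P X G N (v p i) (v \<rho> i)"
                using pop[OF b(1) \<rho>(1) less.prems(2) Suc] .
              then have "u \<rho> i = a p i"
                using Some Pop True v[OF \<rho>(1) less.prems(2)] q[OF \<rho>(1) less.prems(2)]
                by (auto simp: pop_ok_def a_def u_def)
              then have "a \<tau> i = a p i" "\<sigma> \<tau> i = \<sigma> p i"
                using au s[of \<rho>] Some Pop True b less.prems \<open>\<tau> = Suc \<rho>\<close> by (auto simp: effect_def)
              moreover have "top p i"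
                using less b(1) \<open>\<tau> = Suc \<rho>\<close> by auto
              ultimately show ?thesis
                using b(1) \<open>\<tau> = Suc \<rho>\<close> by (auto simp: top_def)
            qed
          qed
        qed
      qed
    qed
  qed
  have "pc (Suc \<tau>) = fst (effect P X G \<tau> (pc \<tau>, \<sigma> \<tau>))" if \<tau>: "\<tau> < N" "length X + G \<le> \<tau>" for \<tau>
  proof (cases "act P X G \<tau> (pc \<tau>)")
    case None
    then show ?thesis
      using ok[of \<tau> 0] that by (simp add: local_ok_def effect_def)
  next
    case (Some I)
    show ?thesis
    proof (cases I)
      case (Push j b)
      then show ?thesis
        using ok[of \<tau> 0] that Some by (simp add: local_ok_def effect_def)
    next
      case (Pop j e f t)
      \<comment> \<open>The next program counter depends on stack \<open>j\<close>, so the vertex of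
        that stack must exist; this is where the bound on stack indices enters.\<close>
      then have j: "j < N"
        using act_PopD[of P X G \<tau> "pc \<tau>"] Some P N by fastforce
      show ?thesis
      proof (cases "a \<tau> j")
        case 0
        then show ?thesis
          using ok[of \<tau> j] top[of \<tau> j] that j Some Pop
          by (auto simp: local_ok_def effect_def top_def)
      next
        case (Suc p)
        then obtain b where b: "p < \<tau>" "\<sigma> \<tau> j = b # \<sigma> p j" "act P X G p (pc p) = Some (Push j b)"
          using top[OF \<tau>(1) j] by (auto simp: top_def)
        have "p < N"
          using b(1) \<tau>(1) by simp
        have "pop_ok P X G N (v p j) (v \<tau> j)"
          using pop[OF b(1) \<tau>(1) j Suc] .
        then have "pc (Suc \<tau>) = (if b then t else f)"
          using Some Pop b(3) v[OF \<tau>(1) j] v[OF \<open>p < N\<close> j] q[OF \<tau>(1) j] q[OF \<open>p < N\<close> j] q'[OF \<tau>(1) j]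
          by (auto simp: pop_ok_def)
        then show ?thesis
          using Some Pop b(2) by (simp add: effect_def)
      qed
    qed
  qed
  moreover have "\<sigma> (N - 1) 0 = [True]"
  proof -
    let ?\<tau> = "N - 1"
    have \<tau>: "?\<tau> < N" "0 < N" "Suc ?\<tau> = N"
      using N by auto
    obtain p b where b: "p < ?\<tau>" "a ?\<tau> 0 = Suc p" "\<sigma> ?\<tau> 0 = b # \<sigma> p 0"
      "act P X G p (pc p) = Some (Push 0 b)"
      using ok[OF \<tau>(1,2)] top[OF \<tau>(1,2)] \<tau>(3) by (auto simp: local_ok_def top_def)
    have p: "p < N"
      using b(1) \<tau>(1) by simp
    have "b \<and> a p 0 = 0"
      using pop[OF b(1) \<tau>(1,2) b(2)] v[OF \<tau>(1,2)] v[OF p \<tau>(2)] q[OF p \<tau>(2)] b(4) \<tau>(3)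
      by (auto simp: pop_ok_def a_def)
    then show ?thesis
      using top[OF p \<tau>(2)] b(3) by (auto simp: top_def)
  qed
  moreover have "pc \<tau> < N" for \<tau>
    using less v N by (simp add: pc_def)
  moreover have "valid_code P X G N \<tau> (pc \<tau>)" if "\<tau> < N" for \<tau>
    using ok[of \<tau> 0] that by (simp add: local_ok_def)
  ultimately show ?thesis
    unfolding accepting_run_def using s0 s by blast
qed

lemma run_imp_independent:
  assumes run: "accepting_run P X G N pc \<sigma>" and N: "length X + G < N"
  shows "\<exists>C. C \<subseteq> set (tuples 6 N) \<and> card C = N ^ 2 \<and> independent_set (conflict P X G N) C"
proof -
  have s0: "\<sigma> 0 = (\<lambda>_. [])"
    and val: "\<And>\<tau>. \<tau> < N \<Longrightarrow> valid_code P X G N \<tau> (pc \<tau>)"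
    and s: "\<And>\<tau>. \<tau> < N \<Longrightarrow> \<sigma> (Suc \<tau>) = snd (effect P X G \<tau> (pc \<tau>, \<sigma> \<tau>))"
    and p: "\<And>\<tau>. \<tau> < N \<Longrightarrow> length X + G \<le> \<tau> \<Longrightarrow>
      pc (Suc \<tau>) = fst (effect P X G \<tau> (pc \<tau>, \<sigma> \<tau>))"
    and pcN: "\<And>\<tau>. \<tau> \<le> N \<Longrightarrow> pc \<tau> < N" and fin: "\<sigma> (N - 1) 0 = [True]"
    using run by (auto simp: accepting_run_def)
  \<comment> \<open>The full stack of pointers, parallel to the stack of bits; a vertex records only
    its head.\<close>
  define ps where "ps = rec_nat (\<lambda>_. []) (\<lambda>\<tau> (l :: nat \<Rightarrow> nat list). case act P X G \<tau> (pc \<tau>) of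
      None \<Rightarrow> l | Some (Push j b) \<Rightarrow> l(j := Suc \<tau> # l j) | Some (Pop j e f t) \<Rightarrow> l(j := tl (l j)))"
  have ps0: "ps 0 = (\<lambda>_. [])" and ps: "\<And>\<tau>. ps (Suc \<tau>) = (case act P X G \<tau> (pc \<tau>) of
      None \<Rightarrow> ps \<tau> | Some (Push j b) \<Rightarrow> (ps \<tau>)(j := Suc \<tau> # ps \<tau> j)
    | Some (Pop j e f t) \<Rightarrow> (ps \<tau>)(j := tl (ps \<tau> j)))"
    by (simp_all add: ps_def split: option.split instr.split)
  define top where "top = (\<lambda>\<tau> i. ps \<tau> i = [] \<and> \<sigma> \<tau> i = [] \<or>
     (\<exists>p b. ps \<tau> i = Suc p # ps p i \<and> p < \<tau> \<and> act P X G p (pc p) = Some (Push i b) \<and>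
        \<sigma> \<tau> i = b # \<sigma> p i))"
  have top: "top \<tau> i" if "\<tau> \<le> N" for \<tau> i
    using that
  proof (induction \<tau> rule: less_induct)
    case (less \<tau>)
    show ?case
    proof (cases \<tau>)
      case 0
      then show ?thesis
        by (simp add: top_def s0 ps0)
    next
      case (Suc \<rho>)
      have \<rho>: "\<rho> < N" "top \<rho> i"
        using less Suc by auto
      note ps = ps[of \<rho>] and s = s[OF \<rho>(1)]
      show ?thesis
      proof (cases "act P X G \<rho> (pc \<rho>)")
        case None
        then show ?thesis
          using ps s \<rho>(2) Suc by (auto simp: top_def effect_def)
      next
        case (Some I)
        show ?thesis
        proof (cases I)
          case (Push j b)
          then show ?thesis
            using ps s \<rho>(2) Suc Some by (cases "i = j") (auto simp: top_def effect_def)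
        next
          case (Pop j e f t)
          show ?thesis
          proof (cases "i = j \<and> ps \<rho> i \<noteq> []")
            case False
            then show ?thesis
              using ps s \<rho>(2) Suc Some Pop by (auto simp: top_def effect_def split: list.splits)
          next
            case True
            then obtain p b where b: "ps \<rho> i = Suc p # ps p i" "p < \<rho>" "\<sigma> \<rho> i = b # \<sigma> p i"
              using \<rho>(2) by (auto simp: top_def)
            then have "top p i"
              using less Suc by auto
            moreover have "ps \<tau> i = ps p i" "\<sigma> \<tau> i = \<sigma> p i"
              using ps s True Suc Some Pop b by (auto simp: effect_def)
            ultimately show ?thesis
              using b(2) Suc by (auto simp: top_def)
          qed
        qed
      qed
    qed
  qed
  define a where "a = (\<lambda>\<tau> i. case ps \<tau> i of [] \<Rightarrow> 0 | p # _ \<Rightarrow> p)"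
  have a: "a \<tau> i = 0 \<and> ps \<tau> i = [] \<and> \<sigma> \<tau> i = [] \<or> (\<exists>p b. a \<tau> i = Suc p \<and> ps \<tau> i = Suc p # ps p i \<and>
     p < \<tau> \<and> act P X G p (pc p) = Some (Push i b) \<and> \<sigma> \<tau> i = b # \<sigma> p i)" if "\<tau> \<le> N" for \<tau> i
    using top[OF that, of i] by (auto simp: top_def a_def)
  have a_cong: "ps \<tau> i = ps \<tau>' i \<Longrightarrow> a \<tau> i = a \<tau>' i" for \<tau> \<tau>' i
    by (simp add: a_def)
  define v where "v = (\<lambda>(\<tau>, i). [\<tau>, i, pc \<tau>, pc (Suc \<tau>), a \<tau> i, a (Suc \<tau>) i])"
  \<comment> \<open>At time \<open>N\<close> a pointer could be \<open>N\<close> only through a push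
    at time \<open>N - 1\<close>, but then the program has halted.\<close>
  have aN: "a \<tau> i < N" if "\<tau> \<le> N" for \<tau> i
  proof (cases "\<tau> = N")
    case True
    then obtain \<rho> where \<rho>: "N = Suc \<rho>"
      using N by (cases N) auto
    then have "act P X G \<rho> (pc \<rho>) = None"
      using val[of \<rho>] N by (simp add: valid_code_def act_def)
    then have "a N i = a \<rho> i"
      using ps[of \<rho>] \<rho> by (simp add: a_def)
    then show ?thesis
      using a[of \<rho> i] \<rho> True by auto
  next
    case False
    then show ?thesis
      using a[of \<tau> i] that by auto
  qed
  have ok: "local_ok P X G N \<tau> i (pc \<tau>) (pc (Suc \<tau>)) (a \<tau> i) (a (Suc \<tau>) i)" if \<tau>: "\<tau> < N" for \<tau> i
  proof -
    have "a \<tau> i \<noteq> 0" if "Suc \<tau> = N" "i = 0"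
      using a[of \<tau> 0] fin that \<tau> by auto
    moreover have "\<tau> = 0 \<longrightarrow> a \<tau> i = 0"
      by (simp add: a_def ps0)
    moreover have "case act P X G \<tau> (pc \<tau>) of
        None \<Rightarrow> a (Suc \<tau>) i = a \<tau> i \<and> (length X + G \<le> \<tau> \<longrightarrow> pc (Suc \<tau>) = pc \<tau>)
      | Some (Push j b) \<Rightarrow> a (Suc \<tau>) i = (if i = j then Suc \<tau> else a \<tau> i) \<and>
          (length X + G \<le> \<tau> \<longrightarrow> pc (Suc \<tau>) = Suc (pc \<tau>))
      | Some (Pop j e f t) \<Rightarrow>
          (if i = j then (if a \<tau> i = 0 then a (Suc \<tau>) i = 0 \<and> pc (Suc \<tau>) = e
             else pc (Suc \<tau>) = f \<or> pc (Suc \<tau>) = t) else a (Suc \<tau>) i = a \<tau> i)"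
    proof (cases "act P X G \<tau> (pc \<tau>)")
      case None
      then show ?thesis
        using ps[of \<tau>] p[OF \<tau>] by (simp add: a_def effect_def)
    next
      case (Some I)
      show ?thesis
      proof (cases I)
        case (Push j b)
        then show ?thesis
          using ps[of \<tau>] p[OF \<tau>] Some by (simp add: a_def effect_def)
      next
        case (Pop j e f t)
        then have "length X + G \<le> \<tau>"
          using Some act_PopD by blast
        then show ?thesis
          using ps[of \<tau>] p[OF \<tau>] Some Pop a[of \<tau> i] \<tau>
          by (cases "i = j") (auto simp: a_def effect_def)
      qed
    qed
    ultimately show ?thesis
      using val[OF \<tau>] by (simp add: local_ok_def)
  qed
  have pop: "pop_ok P X G N (v (\<tau>, i)) (v (\<tau>', i))" if *: "\<tau> < N" "\<tau>' < N" "a \<tau>' i = Suc \<tau>" for \<tau> \<tau>' i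
  proof -
    obtain b where b: "ps \<tau>' i = Suc \<tau> # ps \<tau> i" "\<tau> < \<tau>'"
      "act P X G \<tau> (pc \<tau>) = Some (Push i b)" "\<sigma> \<tau>' i = b # \<sigma> \<tau> i"
      using a[of \<tau>' i] * by auto
    have "a \<tau> 0 = 0 \<and> b" if "Suc \<tau>' = N" "i = 0"
      using that fin b a[of \<tau> 0] \<open>\<tau> < N\<close> by auto
    moreover have "pc (Suc \<tau>') = (if b then t else f) \<and> a (Suc \<tau>') i = a \<tau> i"
      if "act P X G \<tau>' (pc \<tau>') = Some (Pop i e f t)" for e f t
    proof -
      have "length X + G \<le> \<tau>'"
        using that act_PopD by blast
      then show ?thesis
        using p[OF \<open>\<tau>' < N\<close>] b that ps[of \<tau>'] by (simp add: effect_def a_def)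
    qed
    ultimately show ?thesis
      using b(3) by (auto simp: pop_ok_def v_def split: option.splits instr.splits)
  qed
  let ?C = "v ` ({..<N} \<times> {..<N})"
  have "inj v"
    by (auto simp: inj_def v_def)
  then have "card ?C = N ^ 2"
    by (simp add: card_image inj_on_def power2_eq_square)
  moreover have "?C \<subseteq> set (tuples 6 N)"
    using pcN aN by (auto simp: set_tuples v_def Suc_le_eq)
  moreover have "\<not> conflict P X G N (v (\<tau>, i)) (v (\<tau>', i'))"
    if "\<tau> < N" "i < N" "\<tau>' < N" "i' < N" "v (\<tau>, i) \<noteq> v (\<tau>', i')" for \<tau> i \<tau>' i'
    using ok[of \<tau> i] pop[of \<tau> \<tau>' i] that by (auto simp: conflict_def v_def)
  then have "independent_set (conflict P X G N) ?C"
    by (auto simp: independent_set_def)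
  ultimately show ?thesis
    by blast
qed

section \<open>Deciding conflicts\<close>

lemma val_Suc: "val f \<Longrightarrow> val (\<lambda>e x. Suc (f e x))"
  using val_add[of f, OF _ val_const[of 1]] by simp

lemma dec_case_instr:
  assumes "\<And>j b. I = Push j b \<Longrightarrow> dec (A j b)" "\<And>j e f t. I = Pop j e f t \<Longrightarrow> dec (B j e f t)"
  shows "dec (\<lambda>y x. case I of Push j b \<Rightarrow> A j b y x | Pop j e f t \<Rightarrow> B j e f t y x)"
  using assms by (cases I) auto

lemmas val_intros = val_var val_const val_length val_add val_Suc

lemmas dec_intros = dec_const dec_eq dec_le dec_less dec_not dec_conj dec_disj dec_imp dec_nth
  dec_all_less dec_case_instr

text \<open>Rephrased with the connectives under which \<open>dec\<close> is closed. The instruction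
  at \<open>q\<close> is selected by a quantifier over the addresses of the fixed \<open>P\<close>;
  the existential one is written as a negated universal one.\<close>

lemma act_Push_iff:
  "act P X G \<tau> q = Some (Push i b) \<longleftrightarrow>
     (\<tau> < length X \<and> i = 0 \<and> ((b \<longrightarrow> q = 1) \<and> (\<not> b \<longrightarrow> q \<noteq> 1))) \<or>
     (length X \<le> \<tau> \<and> \<tau> < length X + G \<and> q < 2 \<and> i = 1 \<and> ((b \<longrightarrow> q = 1) \<and> (\<not> b \<longrightarrow> q \<noteq> 1))) \<or>
     (length X + G \<le> \<tau> \<and> \<not> (\<forall>c<length P. q = c \<longrightarrow>
        \<not> (case P ! c of Push j b' \<Rightarrow> i = j \<and> b = b' | Pop j e f t \<Rightarrow> False)))"
  by (auto simp: act_def split: instr.splits)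

lemma dec_act_Push:
  assumes "val \<tau>" "val q" "val i" "val G"
  shows "dec (\<lambda>e x. act P x (G e x) (\<tau> e x) (q e x) = Some (Push (i e x) b))"
  unfolding act_Push_iff by (intro dec_intros val_intros assms)

lemma valid_code_iff:
  "valid_code P X G N \<tau> q \<longleftrightarrow>
     (\<tau> < length X \<longrightarrow> (\<tau> < length X \<and> X ! \<tau> \<longrightarrow> q = 1) \<and> (\<not> (\<tau> < length X \<and> X ! \<tau>) \<longrightarrow> q = 0)) \<and>
     (\<tau> = length X + G \<longrightarrow> q = 0) \<and> (Suc \<tau> = N \<longrightarrow> length P \<le> q)"
  by (auto simp: valid_code_def)

lemma local_ok_iff:
  "local_ok P X G N \<tau> i q q' a u \<longleftrightarrow>
     valid_code P X G N \<tau> q \<and> (\<tau> = 0 \<longrightarrow> a = 0) \<and> (Suc \<tau> = N \<and> i = 0 \<longrightarrow> a \<noteq> 0) \<and>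
     (\<tau> < length X \<longrightarrow> (i = 0 \<longrightarrow> u = Suc \<tau>) \<and> (i \<noteq> 0 \<longrightarrow> u = a)) \<and>
     (length X \<le> \<tau> \<and> \<tau> < length X + G \<longrightarrow>
       (q < 2 \<and> i = 1 \<longrightarrow> u = Suc \<tau>) \<and> (\<not> (q < 2 \<and> i = 1) \<longrightarrow> u = a)) \<and>
     (length X + G \<le> \<tau> \<longrightarrow>
       (length P \<le> q \<longrightarrow> u = a \<and> q' = q) \<and>
       (\<forall>c<length P. q = c \<longrightarrow> (case P ! c of
          Push j b \<Rightarrow> (i = j \<longrightarrow> u = Suc \<tau>) \<and> (i \<noteq> j \<longrightarrow> u = a) \<and> q' = Suc q
        | Pop j e f t \<Rightarrow> (i = j \<longrightarrow> (a = 0 \<longrightarrow> u = 0 \<and> q' = e) \<and> (a \<noteq> 0 \<longrightarrow> q' = f \<or> q' = t)) \<and>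
            (i \<noteq> j \<longrightarrow> u = a))))"
proof -
  consider "\<tau> < length X" | "length X \<le> \<tau>" "\<tau> < length X + G" | "length X + G \<le> \<tau>"
    by linarith
  then show ?thesis
  proof cases
    case 1
    then show ?thesis
      by (auto simp: local_ok_def act_def)
  next
    case 2
    then show ?thesis
      by (auto simp: local_ok_def act_def)
  next
    case 3
    then show ?thesis
      by (cases "q < length P") (auto simp: local_ok_def act_def split: instr.splits)
  qed
qed

lemma dec_local_ok:
  assumes "val G" "val N" "val \<tau>" "val i" "val q" "val q'" "val a" "val u"
  shows "dec (\<lambda>e x. local_ok P x (G e x) (N e x) (\<tau> e x) (i e x) (q e x) (q' e x) (a e x) (u e x))"
  unfolding local_ok_iff valid_code_iff by (intro dec_intros val_intros assms)

lemma pop_ok_iff: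
  "pop_ok P X G N v w \<longleftrightarrow>
     (length X + G \<le> w ! 0 \<longrightarrow> (\<forall>c<length P. w ! 2 = c \<longrightarrow> (case P ! c of
          Push j b \<Rightarrow> True
        | Pop j e f t \<Rightarrow> j = w ! 1 \<longrightarrow>
            ((act P X G (v ! 0) (v ! 2) = Some (Push (w ! 1) True) \<and> w ! 3 = t) \<or>
             (act P X G (v ! 0) (v ! 2) = Some (Push (w ! 1) False) \<and> w ! 3 = f)) \<and>
            w ! 5 = v ! 4))) \<and>
     (Suc (w ! 0) = N \<and> w ! 1 = 0 \<longrightarrow>
        act P X G (v ! 0) (v ! 2) = Some (Push 0 True) \<and> v ! 4 = 0)"
proof (cases "length X + G \<le> w ! 0")
  case True
  then have "act P X G (w ! 0) (w ! 2) = (if w ! 2 < length P then Some (P ! (w ! 2)) else None)"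
    by (simp add: act_def)
  with True show ?thesis
    by (auto simp: pop_ok_def ex_bool_eq split: instr.splits)
next
  case False
  then have "case act P X G (w ! 0) (w ! 2) of Some (Pop j e f t) \<Rightarrow> False | _ \<Rightarrow> True"
    by (auto simp: act_def)
  with False show ?thesis
    by (auto simp: pop_ok_def split: option.splits instr.splits)
qed

lemma nth_block: "k < d \<Longrightarrow> map e [b..<b + d] ! k = e (b + k)"
  by simp

lemma dec_conflict:
  assumes "val G" "val N"
  shows "dec (\<lambda>e x. conflict P x (G e x) (N e x) (map e [b..<b + 6]) (map e [b'..<b' + 6]))"
  unfolding conflict_def pop_ok_iff
  by (simp only: nth_block zero_less_numeral one_less_numeral_iff numeral_less_iff semiring_norm)
    (intro dec_intros val_intros assms dec_local_ok dec_act_Push)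

text \<open>Serves to list every undirected edge once: distinct vertices are related in exactly one
  direction.\<close>

fun lex_less :: "nat list \<Rightarrow> nat list \<Rightarrow> bool" where
  "lex_less (a # v) (b # w) \<longleftrightarrow> a < b \<or> a = b \<and> lex_less v w"
| "lex_less _ _ \<longleftrightarrow> False"

lemma lex_less_linear:
  "length v = length w \<Longrightarrow> v \<noteq> w \<Longrightarrow> lex_less v w \<or> lex_less w v"
  by (induction v w rule: list_induct2) auto

lemma lex_less_asym: "lex_less v w \<Longrightarrow> \<not> lex_less w v"
  by (induction v w rule: lex_less.induct) auto

lemma lex_less_irrefl: "\<not> lex_less v v"
  using lex_less_asym by blast

lemma dec_lex_less: "dec (\<lambda>e x. lex_less (map e [b..<b + d]) (map e [b'..<b' + d]))"
proof (induction d arbitrary: b b')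
  case (Suc d)
  have "[c..<c + Suc d] = c # [Suc c..<Suc c + d]" for c
    by (simp add: upt_conv_Cons)
  then show ?case
    by (simp only: list.map lex_less.simps) (intro dec_intros val_intros Suc)
qed (simp add: dec_const)

section \<open>From independent sets to corrupted groups\<close>

text \<open>Since \<open>r \<le> W\<close>, the set \<open>B\<close> has fewer than
  \<open>card V \<le> card J\<close> nodes, so it cannot meet every block. Over an untouched block,
  \<open>D\<close> supplies at most \<open>r - 1\<close> nodes of a group, so each edge must be hit.
  If a node of \<open>D\<close> were missing, both ends of every edge would have to be in
  \<open>B\<close>, hence all of \<open>V\<close>, which exceeds the budget as
  \<open>2 \<le> W\<close>. The proof does this count in the complement \<open>C\<close>.\<close>

lemma threshold_gadget:
  fixes V D :: "'a set" and blk :: "'j \<Rightarrow> 'a set" and r t s W :: nat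
  assumes fin: "finite V" "finite D" "finite J" "\<And>j. j \<in> J \<Longrightarrow> finite (blk j)"
    and D: "Suc (card D) = r" and blk: "\<And>j. j \<in> J \<Longrightarrow> Suc (card (blk j)) = t"
    and disj: "V \<inter> D = {}" "\<And>j. j \<in> J \<Longrightarrow> blk j \<inter> V = {}" "\<And>j. j \<in> J \<Longrightarrow> blk j \<inter> D = {}"
      "\<And>i j. i \<in> J \<Longrightarrow> j \<in> J \<Longrightarrow> i \<noteq> j \<Longrightarrow> blk i \<inter> blk j = {}"
    and J': "J' \<subseteq> J" "J' \<noteq> {}" "t \<noteq> 1 \<Longrightarrow> J' = J"
    and E: "\<And>e. e \<in> E \<Longrightarrow> e \<subseteq> V \<and> card e = 2" "\<And>v. v \<in> V \<Longrightarrow> \<exists>e\<in>E. v \<in> e"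
    and card: "card V \<le> card J" "r \<le> W" "2 \<le> W" "W \<le> card V"
    and \<A>: "\<A> = {e \<union> blk j \<union> D | e j. e \<in> E \<and> j \<in> J'}"
    and S: "S = V \<union> (\<Union>j\<in>J. blk j) \<union> D" and s: "s = card V - W + card D"
  shows "(\<exists>B\<subseteq>S. card B = s \<and> (\<forall>A\<in>\<A>. r \<le> card (A \<inter> B))) \<longleftrightarrow>
    (\<exists>I\<subseteq>V. card I = W \<and> (\<forall>e\<in>E. \<not> e \<subseteq> I))"
proof
  assume "\<exists>B\<subseteq>S. card B = s \<and> (\<forall>A\<in>\<A>. r \<le> card (A \<inter> B))"
  then obtain B where B: "B \<subseteq> S" "card B = s" "\<And>A. A \<in> \<A> \<Longrightarrow> r \<le> card (A \<inter> B)"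
    by blast
  have finU: "finite (\<Union>j\<in>J. blk j)"
    using fin by auto
  have finS: "finite S"
    using fin finU S by auto
  define C where "C = S - B"
  have cardU: "card (\<Union>j\<in>J. blk j) = card J * (t - 1)"
  proof -
    have "card (\<Union>j\<in>J. blk j) = (\<Sum>j\<in>J. card (blk j))"
      using fin disj by (intro card_UN_disjoint) auto
    also have "\<dots> = (\<Sum>j\<in>J. t - 1)"
      by (intro sum.cong refl) (use blk in force)
    finally show ?thesis by simp
  qed
  have dU: "V \<inter> (\<Union>j\<in>J. blk j) = {}" "(V \<union> (\<Union>j\<in>J. blk j)) \<inter> D = {}"
    unfolding disjoint_iff using disj(1-3) by (metis IntI UN_E UnE empty_iff)+
  have "card S = card V + card J * (t - 1) + card D"
    unfolding S using fin finU dU cardU by (simp add: card_Un_disjoint)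
  then have cardC: "card C = W + card J * (t - 1)"
    using B card card_Diff_subset[of B S] finite_subset[OF B(1) finS] s by (simp add: C_def)
  have split: "card C = card (C \<inter> V) + (\<Sum>j\<in>J. card (C \<inter> blk j)) + card (C \<inter> D)"
  proof -
    have "C = (C \<inter> V) \<union> (\<Union>j\<in>J. C \<inter> blk j) \<union> (C \<inter> D)"
      using S by (auto simp: C_def)
    moreover have "card ((C \<inter> V) \<union> (\<Union>j\<in>J. C \<inter> blk j) \<union> (C \<inter> D)) =
        card (C \<inter> V) + card (\<Union>j\<in>J. C \<inter> blk j) + card (C \<inter> D)"
    proof -
      have "(C \<inter> V) \<inter> (\<Union>j\<in>J. C \<inter> blk j) = {}"
        "((C \<inter> V) \<union> (\<Union>j\<in>J. C \<inter> blk j)) \<inter> (C \<inter> D) = {}"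
        using dU by blast+
      moreover have "finite (\<Union>j\<in>J. C \<inter> blk j)"
        using fin by auto
      ultimately show ?thesis
        using fin by (simp add: card_Un_disjoint)
    qed
    moreover have "card (\<Union>j\<in>J. C \<inter> blk j) = (\<Sum>j\<in>J. card (C \<inter> blk j))"
      using fin disj by (intro card_UN_disjoint) fastforce+
    ultimately show ?thesis
      by simp
  qed
  have finE: "finite e" if "e \<in> E" for e
    using E(1)[OF that] fin(1) finite_subset by blast
  have le: "card (C \<inter> e) + card (C \<inter> blk j) + card (C \<inter> D) \<le> t" if "e \<in> E" "j \<in> J'" for e j
  proof -
    let ?A = "e \<union> blk j \<union> D"
    have j: "j \<in> J"
      using that J' by auto
    have f: "finite e" "finite (blk j)" "finite D"
      using finE that fin j by auto
    have d: "e \<inter> blk j = {}" "(e \<union> blk j) \<inter> D = {}"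
      using E(1)[OF that(1)] disj j by blast+
    have "card ?A = r + t"
      using f d E(1)[OF that(1)] D blk[OF j] by (simp add: card_Un_disjoint)
    moreover have "r \<le> card (?A \<inter> B)"
      using B(3) \<A> that by blast
    moreover have "?A \<inter> C = ?A - (?A \<inter> B)"
      using S E(1)[OF that(1)] j by (auto simp: C_def)
    then have "card (?A \<inter> C) = card ?A - card (?A \<inter> B)"
      using f by (simp add: card_Diff_subset)
    moreover have "card (?A \<inter> C) = card (C \<inter> e) + card (C \<inter> blk j) + card (C \<inter> D)"
    proof -
      have "?A \<inter> C = (C \<inter> e) \<union> (C \<inter> blk j) \<union> (C \<inter> D)"
        by auto
      moreover have "(C \<inter> e) \<inter> (C \<inter> blk j) = {}" "((C \<inter> e) \<union> (C \<inter> blk j)) \<inter> (C \<inter> D) = {}"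
        using d by auto
      ultimately show ?thesis
        using f by (simp add: card_Un_disjoint)
    qed
    ultimately show ?thesis
      by linarith
  qed
  have blk_le: "card (C \<inter> blk j) \<le> t - 1" if "j \<in> J" for j
  proof -
    have "card (C \<inter> blk j) \<le> card (blk j)"
      using fin(4)[OF that] by (intro card_mono) auto
    then show ?thesis
      using blk[OF that] by simp
  qed
  have V_le: "card (C \<inter> V) \<le> card V" and D_le: "card (C \<inter> D) \<le> card D"
    using fin by (auto intro: card_mono)
  have sum_le: "(\<Sum>j\<in>J. card (C \<inter> blk j)) \<le> card J * (t - 1)"
    using sum_bounded_above[of J "\<lambda>j. card (C \<inter> blk j)" "t - 1"] blk_le by simp
  txt \<open>If \<open>C\<close> missed a node of every block, it would lose \<open>card J \<ge> card V\<close> nodes.\<close>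
  have "\<exists>j\<in>J'. t \<le> Suc (card (C \<inter> blk j))"
  proof (cases "t = 1")
    case True
    then show ?thesis
      using J' by auto
  next
    case False
    show ?thesis
    proof (rule ccontr)
      assume n: "\<not> ?thesis"
      have "card (C \<inter> blk j) \<le> t - 2" if "j \<in> J" for j
      proof -
        have "\<not> t \<le> Suc (card (C \<inter> blk j))"
          using n that J'(3)[OF False] by blast
        then show ?thesis by simp
      qed
      then have "(\<Sum>j\<in>J. card (C \<inter> blk j)) \<le> card J * (t - 2)"
        using sum_bounded_above[of J "\<lambda>j. card (C \<inter> blk j)" "t - 2"] by simp
      moreover have "t \<noteq> 0"
        using J'(1,2) blk by (metis nat.distinct(1) subsetD ex_in_conv)
      then have "t - 1 = Suc (t - 2)"
        using False by simp
      ultimately have "card C < W + card J * (t - 1)"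
        using split V_le D_le card D by simp
      then show False
        using cardC by simp
    qed
  qed
  then obtain j where j: "j \<in> J'" "t \<le> Suc (card (C \<inter> blk j))"
    by blast
  \<comment> \<open>\<open>C\<close> contains the whole block \<open>j\<close>, that is
    \<open>t - 1\<close> of the at most \<open>t\<close> nodes it may have in a group.\<close>
  have edge: "card (C \<inter> e) + card (C \<inter> D) \<le> 1" if "e \<in> E" for e
    using le[OF that j(1)] j(2) by simp
  have "card (C \<inter> D) = 0"
  proof (rule ccontr)
    assume *: "card (C \<inter> D) \<noteq> 0"
    have "C \<inter> e = {}" if "e \<in> E" for e
    proof -
      have "card (C \<inter> e) = 0"
        using * edge[OF that] by linarith
      then show ?thesis
        using finE[OF that] by simp
    qed
    then have "C \<inter> V = {}"
      using E(2) by blast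
    obtain v where "v \<in> V"
      using card by fastforce
    then obtain e where "e \<in> E"
      using E(2) by blast
    then have "card (C \<inter> D) \<le> 1"
      using edge by fastforce
    then show False
      using \<open>C \<inter> V = {}\<close> split cardC sum_le card by simp
  qed
  then have "W \<le> card (C \<inter> V)"
    using split cardC sum_le by simp
  then obtain I where I: "I \<subseteq> C \<inter> V" "card I = W"
    by (meson obtain_subset_with_card_n)
  have "\<not> e \<subseteq> I" if "e \<in> E" for e
  proof
    assume "e \<subseteq> I"
    then have "C \<inter> e = e"
      using I by blast
    then show False
      using edge[OF that] E(1)[OF that] by simp
  qed
  with I show "\<exists>I\<subseteq>V. card I = W \<and> (\<forall>e\<in>E. \<not> e \<subseteq> I)"
    by blast
next
  assume "\<exists>I\<subseteq>V. card I = W \<and> (\<forall>e\<in>E. \<not> e \<subseteq> I)"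
  then obtain I where I: "I \<subseteq> V" "card I = W" "\<And>e. e \<in> E \<Longrightarrow> \<not> e \<subseteq> I"
    by blast
  \<comment> \<open>No block node is spent: \<open>D\<close> supplies \<open>r - 1\<close> nodes of
    every group, and an end of the edge outside \<open>I\<close> is the last one.\<close>
  let ?B = "(V - I) \<union> D"
  have "card ?B = s"
    using fin disj I s by (subst card_Un_disjoint) (auto simp: card_Diff_subset finite_subset)
  moreover have "r \<le> card (A \<inter> ?B)" if A: "A \<in> \<A>" for A
  proof -
    obtain e j where ej: "A = e \<union> blk j \<union> D" "e \<in> E" "j \<in> J'"
      using A \<A> by blast
    obtain v where v: "v \<in> e" "v \<notin> I"
      using I(3)[OF ej(2)] by blast
    then have "v \<in> V"
      using E(1)[OF ej(2)] by blast
    then have "insert v D \<subseteq> A \<inter> ?B" "v \<notin> D"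
      using v ej(1) disj(1) by blast+
    moreover have "finite (A \<inter> ?B)"
      using fin by simp
    ultimately show ?thesis
      using card_mono[of "A \<inter> ?B" "insert v D"] fin(2) D by simp
  qed
  moreover have "?B \<subseteq> S"
    using S by blast
  ultimately show "\<exists>B\<subseteq>S. card B = s \<and> (\<forall>A\<in>\<A>. r \<le> card (A \<inter> B))"
    by blast
qed

section \<open>The instance of a tableau\<close>

definition code :: "nat list \<Rightarrow> word" where
  "code l = concat (map enc_nat l)"

lemma code_simps [simp]: "code [] = []" "code (a # l) = enc_nat a @ code l"
  by (simp_all add: code_def)

lemma enc_nat_nonempty [simp]: "enc_nat n \<noteq> []"
  by (simp add: enc_nat_def)

text \<open>Codes of numbers are prefix-free and nonempty, so lists of different lengths also have
  different codes. This separates vertices and block nodes, made of seven numbers, from common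
  nodes, made of one.\<close>

lemma code_inject [simp]: "code l = code m \<longleftrightarrow> l = m"
proof (induction l arbitrary: m)
  case Nil
  then show ?case by (cases m) auto
next
  case (Cons a l)
  then show ?case by (cases m) (auto simp: enc_nat_prefix_free)
qed

lemma inj_code: "inj code"
  by (simp add: inj_def)

text \<open>
  The node \<open>code (0 # v)\<close> stands for the vertex \<open>v\<close>, the nodes \<open>code (Suc a # j)\<close> form the block
  with index \<open>j\<close>, and the nodes \<open>code [a]\<close> lie in all groups.
\<close>

definition node_list :: "nat \<Rightarrow> nat \<Rightarrow> nat \<Rightarrow> word list" where
  "node_list r t N = concat (map (\<lambda>a. map (\<lambda>j. code (a # j)) (tuples 6 N)) [0..<t]) @
     map (\<lambda>a. code [a]) [0..<r - 1]"

definition block :: "nat \<Rightarrow> nat list \<Rightarrow> word list" where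
  "block t j = map (\<lambda>a. code (Suc a # j)) [0..<t - 1]"

definition common :: "nat \<Rightarrow> word list" where
  "common r = map (\<lambda>a. code [a]) [0..<r - 1]"

definition group_of :: "nat \<Rightarrow> nat \<Rightarrow> nat list \<Rightarrow> nat list \<Rightarrow> nat list \<Rightarrow> word list" where
  "group_of r t v w j = [code (0 # v), code (0 # w)] @ block t j @ common r"

text \<open>
  For \<open>t = 1\<close> all blocks are empty, and only one block index is used in order not to list a group
  twice.
\<close>

definition edge_list :: "(nat list \<Rightarrow> nat list \<Rightarrow> bool) \<Rightarrow> nat \<Rightarrow> nat \<Rightarrow>
    (nat list \<times> nat list \<times> nat list) list" where
  "edge_list K t N = concat (map (\<lambda>v. concat (map (\<lambda>w. concat (map (\<lambda>j.
     if lex_less v w \<and> (K v w \<or> K w v) \<and> (t = 1 \<longrightarrow> j = replicate 6 0) then [(v, w, j)] else [])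
     (tuples 6 N))) (tuples 6 N))) (tuples 6 N))"

definition group_list :: "(nat list \<Rightarrow> nat list \<Rightarrow> bool) \<Rightarrow> nat \<Rightarrow> nat \<Rightarrow> nat \<Rightarrow> word list list" where
  "group_list K r t N = map (\<lambda>(v, w, j). group_of r t v w j) (edge_list K t N)"

text \<open>The \<open>s\<close> of \<open>threshold_gadget\<close> for \<open>N ^ 6\<close>
  vertices and \<open>W = N ^ 2\<close>.\<close>

definition budget :: "nat \<Rightarrow> nat \<Rightarrow> nat" where
  "budget r N = N ^ 6 - N ^ 2 + (r - 1)"

definition instance_word :: "(nat list \<Rightarrow> nat list \<Rightarrow> bool) \<Rightarrow> nat \<Rightarrow> nat \<Rightarrow> nat \<Rightarrow> word" where
  "instance_word K r t N = enc_list enc_word (node_list r t N) @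
     enc_list (enc_list enc_word) (group_list K r t N) @ enc_nat (budget r N)"

section \<open>The listed instance is well formed and valid\<close>

lemma set_edge_list:
  "(v, w, j) \<in> set (edge_list K t N) \<longleftrightarrow> v \<in> set (tuples 6 N) \<and> w \<in> set (tuples 6 N) \<and>
     j \<in> set (tuples 6 N) \<and> lex_less v w \<and> (K v w \<or> K w v) \<and> (t = 1 \<longrightarrow> j = replicate 6 0)"
  by (auto simp: edge_list_def split: if_splits)

lemma distinct_concat_mapI:
  assumes "distinct xs" "\<And>x. x \<in> set xs \<Longrightarrow> distinct (f x)"
    "\<And>x y z. x \<in> set xs \<Longrightarrow> y \<in> set xs \<Longrightarrow> z \<in> set (f x) \<Longrightarrow> z \<in> set (f y) \<Longrightarrow> x = y"
  shows "distinct (concat (map f xs))"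
  using assms
proof (induction xs)
  case (Cons x xs)
  have "set (f x) \<inter> set (f y) = {}" if "y \<in> set xs" for y
    using Cons.prems(1) Cons.prems(3)[of x y] that by auto
  moreover have "distinct (concat (map f xs))"
    using Cons.prems by (intro Cons.IH) auto
  ultimately show ?case
    using Cons.prems(2) by auto
qed simp

lemma distinct_node_list: "distinct (node_list r t N)"
proof -
  let ?f = "\<lambda>a. map (\<lambda>j. code (a # j)) (tuples 6 N)"
  have "distinct (concat (map ?f [0..<n]))" for n
  proof (induction n)
    case (Suc n)
    then show ?case
      by (auto simp: distinct_map inj_on_def distinct_tuples enc_nat_prefix_free)
  qed simp
  then show ?thesis
    using inj_code
    by (auto simp: node_list_def distinct_map inj_on_def set_tuples enc_nat_prefix_free
        simp del: code_simps)
qed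

lemma distinct_group_of:
  assumes "length v = 6" "length w = 6" "length j = 6" "v \<noteq> w"
  shows "distinct (group_of r t v w j)"
  using assms
  by (auto simp: group_of_def block_def common_def distinct_map inj_on_def simp del: code_simps)

lemma length_group_of: "1 \<le> r \<Longrightarrow> 1 \<le> t \<Longrightarrow> length (group_of r t v w j) = r + t"
  by (simp add: group_of_def block_def common_def)

text \<open>For empty \<open>u\<close> the node is the common node \<open>code [0]\<close>; this
  exception disappears for vertices, which have length 6.\<close>

lemma code_in_group_of:
  "code (0 # u) \<in> set (group_of r t v w j) \<longleftrightarrow> u = v \<or> u = w \<or> u = [] \<and> 1 < r"
  by (auto simp: group_of_def block_def common_def image_iff simp del: code_simps)

text \<open>The ends of the edge are recovered from the nodes that start with 0, their order from
  \<open>lex_less\<close>, and the block index from the node \<open>code (1 # j)\<close>, which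
  exists unless \<open>t = 1\<close>.\<close>

lemma set_group_of_inject:
  assumes eq: "set (group_of r t v w j) = set (group_of r t v' w' j')"
    and l: "length v = 6" "length w = 6" "length j = 6" "length v' = 6" "length w' = 6" "length j' = 6"
    and less: "lex_less v w" "lex_less v' w'" and t: "t = 1 \<Longrightarrow> j = j'" "t \<noteq> 0"
  shows "v = v' \<and> w = w' \<and> j = j'"
proof -
  have "u = v \<or> u = w \<longleftrightarrow> u = v' \<or> u = w'" if "length u = 6" for u
    using eq code_in_group_of[of u r t v w j] code_in_group_of[of u r t v' w' j'] that by auto
  from this[of v] this[of w] this[of v'] this[of w'] have "v = v' \<and> w = w'"
    using l less lex_less_asym by blast
  moreover have "j = j'"
  proof (cases "t = 1")
    case False
    then have "code (1 # j) \<in> set (group_of r t v w j)"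
      using t by (auto simp: group_of_def block_def image_iff simp del: code_simps intro!: bexI[of _ 0])
    then have "code (1 # j) \<in> set (group_of r t v' w' j')"
      using eq by simp
    then show ?thesis
      using l by (auto simp: group_of_def block_def common_def simp del: code_simps)
  qed (rule t)
  ultimately show ?thesis
    by blast
qed

lemma distinct_edge_list: "distinct (edge_list K t N)"
  unfolding edge_list_def
  by (intro distinct_concat_mapI distinct_tuples) (auto split: if_splits)

lemma distinct_group_sets: "t \<noteq> 0 \<Longrightarrow> distinct (map set (group_list K r t N))"
proof -
  assume t: "t \<noteq> 0"
  have "inj_on (\<lambda>(v, w, j). set (group_of r t v w j)) (set (edge_list K t N))"
  proof (rule inj_onI)
    fix p q
    assume p: "p \<in> set (edge_list K t N)" and q: "q \<in> set (edge_list K t N)"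
      and eq: "(\<lambda>(v, w, j). set (group_of r t v w j)) p = (\<lambda>(v, w, j). set (group_of r t v w j)) q"
    obtain v w j v' w' j' where pq: "p = (v, w, j)" "q = (v', w', j')"
      by (cases p, cases q)
    have "v = v' \<and> w = w' \<and> j = j'"
      using p q eq t unfolding pq
      by (intro set_group_of_inject[of r t]) (auto simp: set_edge_list set_tuples)
    then show "p = q"
      by (simp add: pq)
  qed
  then show ?thesis
    by (simp add: group_list_def distinct_map distinct_edge_list o_def case_prod_unfold)
qed

lemma encodes_instance_word:
  assumes "t \<noteq> 0"
  shows "encodes_instance (instance_word K r t N) (set (node_list r t N))
    (set ` set (group_list K r t N)) (budget r N)"
  unfolding encodes_instance_def instance_word_def
proof (intro exI conjI ballI)
  fix g assume "g \<in> set (group_list K r t N)"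
  then obtain v w j where "g = group_of r t v w j" "(v, w, j) \<in> set (edge_list K t N)"
    by (auto simp: group_list_def)
  then show "distinct g"
    using lex_less_irrefl by (auto simp: set_edge_list set_tuples intro!: distinct_group_of)
qed (simp_all add: distinct_node_list distinct_group_sets assms)

lemma length_node_list: "length (node_list r t N) = t * N ^ 6 + (r - 1)"
proof -
  have "length (concat (map (\<lambda>a. map (\<lambda>j. code (a # j)) (tuples 6 N)) [0..<n])) = n * N ^ 6" for n
    by (induction n) (simp_all add: length_tuples)
  then show ?thesis
    by (simp add: node_list_def)
qed

lemma card_nodes: "card (set (node_list r t N)) = t * N ^ 6 + (r - 1)"
  using distinct_card[OF distinct_node_list] by (simp add: length_node_list)

lemma card_groups:
  assumes "t \<noteq> 0"
  shows "card (set ` set (group_list K r t N)) = length (edge_list K t N)"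
  using distinct_card[OF distinct_group_sets[OF assms], of K r N]
  by (simp only: list.set_map length_map group_list_def)

lemma set_node_list: "set (node_list r t N) =
  (\<lambda>v. code (0 # v)) ` set (tuples 6 N) \<union> (\<Union>j\<in>set (tuples 6 N). set (block t j)) \<union> set (common r)"
  if "t \<noteq> 0"
proof -
  have "{0..<t} = insert 0 (Suc ` {0..<t - 1})"
    using that by (auto simp: image_iff gr0_conv_Suc less_Suc_eq_0_disj)
  then have "(\<Union>a\<in>{0..<t}. (\<lambda>j. code (a # j)) ` set (tuples 6 N)) =
      (\<lambda>v. code (0 # v)) ` set (tuples 6 N) \<union>
      (\<Union>a\<in>{0..<t - 1}. (\<lambda>j. code (Suc a # j)) ` set (tuples 6 N))"
    by (simp only: image_insert Union_insert image_image)
  also have "(\<Union>a\<in>{0..<t - 1}. (\<lambda>j. code (Suc a # j)) ` set (tuples 6 N)) =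
      (\<Union>j\<in>set (tuples 6 N). set (block t j))"
    by (auto simp: block_def simp del: code_simps)
  finally show ?thesis
    by (simp add: node_list_def common_def Un_assoc del: code_simps)
qed

text \<open>The slack 2 makes \<open>budget r N\<close> at least \<open>r + 1\<close>, as an
  instance requires more than \<open>r\<close> corrupted nodes.\<close>

lemma sq_add_2_le_power6:
  assumes "2 \<le> (N :: nat)"
  shows "N ^ 2 + 2 \<le> N ^ 6"
proof -
  have sq: "2 \<le> N ^ 2"
    using power_mono[OF assms, of 2] by simp
  have "2 \<le> N ^ 4"
    using power_mono[OF assms, of 4] by simp
  then have "2 * N ^ 2 \<le> N ^ 4 * N ^ 2"
    by (rule mult_le_mono1)
  also have "N ^ 4 * N ^ 2 = N ^ 6"
    using power_add[of N 4 2] by simp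
  finally show ?thesis
    using sq by linarith
qed

text \<open>Groups are indexed by triples of 6-tuples and there are at least \<open>N ^ 6\<close>
  nodes, which explains the cube; it does not depend on the language being reduced.\<close>

lemma valid_instance_word:
  assumes "1 \<le> r" "1 \<le> t" "2 \<le> N" "threshold \<mu> (r + t) = r"
  shows "valid_instance \<mu> (r + t) (monom 1 3) (set (node_list r t N))
    (set ` set (group_list K r t N)) (budget r N)"
  unfolding valid_instance_def
proof (intro conjI ballI)
  let ?T = "set (tuples 6 N)"
  let ?S = "set (node_list r t N)" and ?A = "set ` set (group_list K r t N)"
  have t: "t \<noteq> 0"
    using assms by simp
  fix A assume "A \<in> ?A"
  then obtain v w j where A: "A = set (group_of r t v w j)" and e: "(v, w, j) \<in> set (edge_list K t N)"
    by (auto simp: group_list_def)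
  then have T: "v \<in> ?T" "w \<in> ?T" "j \<in> ?T" "v \<noteq> w"
    using lex_less_irrefl by (auto simp: set_edge_list)
  then show "A \<subseteq> ?S"
    unfolding A set_node_list[OF t] by (auto simp: group_of_def simp del: code_simps)
  have "distinct (group_of r t v w j)"
    using T by (intro distinct_group_of) (auto simp: set_tuples)
  then show "card A = r + t"
    unfolding A using assms by (simp add: distinct_card length_group_of)
next
  let ?T = "set (tuples 6 N)"
  have t: "t \<noteq> 0"
    using assms by simp
  have T: "card ?T = N ^ 6"
    by (simp add: distinct_card distinct_tuples length_tuples)
  have "length (edge_list K t N) = card (set (edge_list K t N))"
    by (simp add: distinct_card distinct_edge_list)
  also have "\<dots> \<le> card (?T \<times> ?T \<times> ?T)"
    by (rule card_mono) (auto simp: set_edge_list)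
  also have "\<dots> = (N ^ 6) ^ 3"
    by (simp only: card_cartesian_product T power3_eq_cube mult.assoc)
  also have "\<dots> \<le> (t * N ^ 6 + (r - 1)) ^ 3"
    using assms(2) by (intro power_mono trans_le_add1) (cases t; simp)+
  finally show "card (set ` set (group_list K r t N)) \<le> poly (monom 1 3) (card (set (node_list r t N)))"
    by (simp add: card_groups[OF t] card_nodes poly_monom)
  show "threshold \<mu> (r + t) < budget r N"
    using sq_add_2_le_power6[OF assms(3)] assms(1,4) by (simp add: budget_def)
  have "N ^ 6 \<le> t * N ^ 6"
    using assms(2) by simp
  moreover have "0 < N ^ 2"
    using assms(3) by simp
  ultimately show "budget r N < card (set (node_list r t N))"
    unfolding budget_def card_nodes using sq_add_2_le_power6[OF assms(3)] by linarith
qed simp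

lemma hit_all_iff_independent:
  assumes r: "1 \<le> r" and t: "1 \<le> t" and N: "2 \<le> N" "r \<le> N"
    and K: "\<And>v w. v ! 0 = w ! 0 \<Longrightarrow> v ! 1 = w ! 1 \<Longrightarrow> K v w"
  shows "(\<exists>B\<subseteq>set (node_list r t N). card B = budget r N \<and>
      (\<forall>A\<in>set ` set (group_list K r t N). r \<le> card (A \<inter> B))) \<longleftrightarrow>
    (\<exists>C\<subseteq>set (tuples 6 N). card C = N ^ 2 \<and> independent_set K C)"
proof -
  let ?T = "set (tuples 6 N)"
  let ?c = "\<lambda>v. code (0 # v)"
  let ?J' = "if t = 1 then {replicate 6 0} else ?T"
  define E where "E = {{?c v, ?c w} | v w. v \<in> ?T \<and> w \<in> ?T \<and> v \<noteq> w \<and> K v w}"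
  have inj: "inj_on ?c X" for X
    by (simp add: inj_on_def del: code_simps)
  have len: "length v = 6" if "v \<in> ?T" for v
    using that by (simp add: set_tuples)
  have cT: "card ?T = N ^ 6"
    by (simp add: distinct_card distinct_tuples length_tuples)
  have z: "replicate 6 0 \<in> ?T"
    using N by (auto simp: set_tuples)
  have "(\<exists>B\<subseteq>set (node_list r t N). card B = budget r N \<and>
      (\<forall>A\<in>set ` set (group_list K r t N). r \<le> card (A \<inter> B))) \<longleftrightarrow>
    (\<exists>I\<subseteq>?c ` ?T. card I = N ^ 2 \<and> (\<forall>e\<in>E. \<not> e \<subseteq> I))"
  proof (rule threshold_gadget)
    show "finite (?c ` ?T)" "finite (set (common r))" "finite ?T" "\<And>j. finite (set (block t j))"
      by auto
    have "distinct (common r)" "\<And>j. distinct (block t j)"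
      by (auto simp: common_def block_def distinct_map inj_on_def simp del: code_simps)
    then show "Suc (card (set (common r))) = r" "\<And>j. Suc (card (set (block t j))) = t"
      using r t by (simp_all only: distinct_card) (simp_all add: common_def block_def)
    show "?c ` ?T \<inter> set (common r) = {}" "\<And>j. j \<in> ?T \<Longrightarrow> set (block t j) \<inter> ?c ` ?T = {}"
      "\<And>j. j \<in> ?T \<Longrightarrow> set (block t j) \<inter> set (common r) = {}"
      "\<And>i j. i \<in> ?T \<Longrightarrow> j \<in> ?T \<Longrightarrow> i \<noteq> j \<Longrightarrow> set (block t i) \<inter> set (block t j) = {}"
      by (auto simp: common_def block_def dest!: len simp del: code_simps)
    show "?J' \<subseteq> ?T" "?J' \<noteq> {}" "t \<noteq> 1 \<Longrightarrow> ?J' = ?T"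
      using z by auto
    show "e \<subseteq> ?c ` ?T \<and> card e = 2" if "e \<in> E" for e
      using that by (auto simp: E_def card_insert_if simp del: code_simps)
    show "\<exists>e\<in>E. u \<in> e" if u: "u \<in> ?c ` ?T" for u
    proof -
      obtain v where v: "u = ?c v" "v \<in> ?T"
        using u by blast
      \<comment> \<open>The gadget needs an edge at every vertex. Keeping time and stack and
        changing the third field gives a neighbour by \<open>K\<close>; \<open>2 \<le> N\<close>
        makes room for a second value.\<close>
      define w where "w = [v ! 0, v ! 1, if v ! 2 = 0 then 1 else 0, 0, 0, 0]"
      have "v ! 0 < N" "v ! 1 < N"
        using v(2) by (force simp: set_tuples)+
      then have "w \<in> ?T"
        using N by (auto simp: set_tuples w_def)
      moreover have "v ! 2 \<noteq> w ! 2"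
        by (simp add: w_def)
      then have "v \<noteq> w"
        by auto
      moreover have "K v w"
        by (rule K) (simp_all add: w_def)
      ultimately show ?thesis
        using v by (auto simp: E_def simp del: code_simps)
    qed
    have cV: "card (?c ` ?T) = N ^ 6"
      using cT by (simp only: card_image[OF inj])
    then show "card (?c ` ?T) \<le> card ?T" "N ^ 2 \<le> card (?c ` ?T)"
      using cT sq_add_2_le_power6[OF N(1)] by simp_all
    have "N * 1 \<le> N * N"
      using N by (intro mult_le_mono2) auto
    then show "r \<le> N ^ 2" "2 \<le> N ^ 2"
      using N unfolding power2_eq_square by linarith+
    show "budget r N = card (?c ` ?T) - N ^ 2 + card (set (common r))"
      using cV \<open>distinct (common r)\<close> by (simp only: budget_def distinct_card) (simp add: common_def)
    show "set (node_list r t N) = ?c ` ?T \<union> (\<Union>j\<in>?T. set (block t j)) \<union> set (common r)"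
      by (rule set_node_list) (use t in simp)
    show "set ` set (group_list K r t N) =
        {e \<union> set (block t j) \<union> set (common r) | e j. e \<in> E \<and> j \<in> ?J'}" (is "?L = ?R")
    proof
      show "?L \<subseteq> ?R"
      proof
        fix A assume "A \<in> ?L"
        then obtain v w j where A: "A = set (group_of r t v w j)"
          and e: "(v, w, j) \<in> set (edge_list K t N)"
          by (auto simp: group_list_def)
        have "v \<noteq> w"
          using e lex_less_irrefl by (auto simp: set_edge_list)
        then have "{?c v, ?c w} \<in> E"
          using e by (auto simp: E_def set_edge_list simp del: code_simps)
        moreover have "j \<in> ?J'"
          using e by (auto simp: set_edge_list)
        moreover have "A = {?c v, ?c w} \<union> set (block t j) \<union> set (common r)"
          by (simp add: A group_of_def del: code_simps)
        ultimately show "A \<in> ?R"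
          by blast
      qed
    next
      show "?R \<subseteq> ?L"
      proof
        fix A assume "A \<in> ?R"
        then obtain v w j where A: "A = {?c v, ?c w} \<union> set (block t j) \<union> set (common r)"
          and e: "v \<in> ?T" "w \<in> ?T" "v \<noteq> w" "K v w" "j \<in> ?J'"
          unfolding E_def by blast
        have j: "j \<in> ?T" "t = 1 \<longrightarrow> j = replicate 6 0"
          using e(5) z by (auto split: if_splits)
        have g: "set (group_of r t v' w' j) \<in> ?L" if "(v', w', j) \<in> set (edge_list K t N)" for v' w'
          using that by (force simp: group_list_def)
        have "lex_less v w \<or> lex_less w v"
          using e len by (intro lex_less_linear) auto
        then show "A \<in> ?L"
        proof
          assume "lex_less v w"
          then have "(v, w, j) \<in> set (edge_list K t N)"
            using e j by (simp add: set_edge_list)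
          then show ?thesis
            using g[of v w] A by (simp add: group_of_def del: code_simps)
        next
          assume "lex_less w v"
          then have "(w, v, j) \<in> set (edge_list K t N)"
            using e j by (simp add: set_edge_list)
          then show ?thesis
            using g[of w v] A by (simp add: group_of_def insert_commute del: code_simps)
        qed
      qed
    qed
  qed
  also have "\<dots> \<longleftrightarrow> (\<exists>C\<subseteq>?T. card C = N ^ 2 \<and> independent_set K C)"
  proof
    assume "\<exists>I\<subseteq>?c ` ?T. card I = N ^ 2 \<and> (\<forall>e\<in>E. \<not> e \<subseteq> I)"
    then obtain I where I: "I \<subseteq> ?c ` ?T" "card I = N ^ 2" "\<And>e. e \<in> E \<Longrightarrow> \<not> e \<subseteq> I"
      by blast
    obtain C where C: "C \<subseteq> ?T" "I = ?c ` C"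
      using I(1) by (auto simp: subset_image_iff)
    have "\<not> K v w" if vw: "v \<in> C" "w \<in> C" "v \<noteq> w" for v w
    proof
      assume "K v w"
      then have "{?c v, ?c w} \<in> E"
        using vw C(1) unfolding E_def by blast
      then have "\<not> {?c v, ?c w} \<subseteq> I"
        by (rule I(3))
      then show False
        using vw(1,2) unfolding C(2) by blast
    qed
    then have "independent_set K C"
      by (simp add: independent_set_def)
    moreover have "card C = N ^ 2"
      using I(2) card_image[OF inj, of C] unfolding C(2) by simp
    ultimately show "\<exists>C\<subseteq>?T. card C = N ^ 2 \<and> independent_set K C"
      using C(1) by blast
  next
    assume "\<exists>C\<subseteq>?T. card C = N ^ 2 \<and> independent_set K C"
    then obtain C where C: "C \<subseteq> ?T" "card C = N ^ 2" "independent_set K C"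
      by blast
    have "\<not> e \<subseteq> ?c ` C" if e: "e \<in> E" for e
    proof
      assume sub: "e \<subseteq> ?c ` C"
      obtain v w where vw: "e = {?c v, ?c w}" "v \<noteq> w" "K v w"
        using e unfolding E_def by blast
      have "v \<in> C" "w \<in> C"
        using sub inj_image_mem_iff[of ?c _ C] inj[of UNIV] unfolding vw(1) by auto
      then show False
        using C(3) vw unfolding independent_set_def by blast
    qed
    moreover have "card (?c ` C) = N ^ 2"
      using C(2) card_image[OF inj, of C] by simp
    moreover have "?c ` C \<subseteq> ?c ` ?T"
      using C(1) by blast
    ultimately show "\<exists>I\<subseteq>?c ` ?T. card I = N ^ 2 \<and> (\<forall>e\<in>E. \<not> e \<subseteq> I)"
      by blast
  qed
  finally show ?thesis .
qed

section \<open>Optimal answers\<close>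

lemma max_corrupted_eq:
  assumes "valid_instance \<mu> k p S \<A> s"
  shows "max_corrupted (real s / real (card S)) S \<A> \<mu> k =
    Max ((\<lambda>B. card (corrupted \<mu> k \<A> B)) ` {B. B \<subseteq> S \<and> card B = s})"
proof -
  have "card S \<noteq> 0"
    using assms by (auto simp: valid_instance_def)
  then show ?thesis
    by (simp add: max_corrupted_def)
qed

lemma valid_instance_finite:
  assumes "valid_instance \<mu> k p S \<A> s"
  shows "finite \<A>" "finite {B. B \<subseteq> S \<and> card B = s}" "{B. B \<subseteq> S \<and> card B = s} \<noteq> {}"
proof -
  have S: "finite S" "\<A> \<subseteq> Pow S" "s \<le> card S"
    using assms by (auto simp: valid_instance_def)
  show "finite \<A>"
    using S finite_subset by blast
  show "finite {B. B \<subseteq> S \<and> card B = s}"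
    using S by (auto intro: finite_subset[of _ "Pow S"])
  show "{B. B \<subseteq> S \<and> card B = s} \<noteq> {}"
    using obtain_subset_with_card_n[OF S(3)] by blast
qed

lemma optimal_answer_exists:
  assumes "valid_instance \<mu> k p S \<A> s"
  shows "\<exists>B v. optimal_answer \<mu> k S \<A> s B v"
proof -
  let ?F = "{B. B \<subseteq> S \<and> card B = s}" and ?f = "\<lambda>B. card (corrupted \<mu> k \<A> B)"
  note fin = valid_instance_finite[OF assms]
  have "Max (?f ` ?F) \<in> ?f ` ?F"
    using fin by (intro Max_in) auto
  then obtain B where B: "B \<in> ?F" "?f B = Max (?f ` ?F)"
    by force
  have "?f B' \<le> ?f B" if "B' \<in> ?F" for B'
    unfolding B(2) using fin(2) that by (intro Max_ge) auto
  with B(1) show ?thesis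
    unfolding optimal_answer_def by blast
qed

text \<open>No set corrupts more than \<open>card \<A>\<close> groups, so reaching this number means
  that all groups are corrupted.\<close>

lemma optimal_answer_eq_iff:
  assumes valid: "valid_instance \<mu> k p S \<A> s" and opt: "optimal_answer \<mu> k S \<A> s B v"
  shows "card \<A> \<le> v \<longleftrightarrow> (\<exists>B\<subseteq>S. card B = s \<and> (\<forall>A\<in>\<A>. threshold \<mu> k \<le> card (A \<inter> B)))"
proof -
  let ?F = "{B. B \<subseteq> S \<and> card B = s}" and ?f = "\<lambda>B. card (corrupted \<mu> k \<A> B)"
  note fin = valid_instance_finite[OF valid]
  have v: "v = Max (?f ` ?F)"
    using opt max_corrupted_eq[OF valid] by (simp add: optimal_answer_def)
  have "card \<A> \<le> v \<longleftrightarrow> (\<exists>B\<in>?F. card \<A> \<le> ?f B)"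
    unfolding v using fin by (subst Max_ge_iff) auto
  also have "\<dots> \<longleftrightarrow> (\<exists>B\<in>?F. corrupted \<mu> k \<A> B = \<A>)"
  proof (intro bex_cong refl)
    fix B
    have "corrupted \<mu> k \<A> B \<subseteq> \<A>"
      by (auto simp: corrupted_def)
    then show "card \<A> \<le> ?f B \<longleftrightarrow> corrupted \<mu> k \<A> B = \<A>"
      using card_seteq[OF fin(1), of "corrupted \<mu> k \<A> B"] by auto
  qed
  also have "\<dots> \<longleftrightarrow> (\<exists>B\<subseteq>S. card B = s \<and> (\<forall>A\<in>\<A>. threshold \<mu> k \<le> card (A \<inter> B)))"
    by (auto simp: corrupted_def)
  finally show ?thesis .
qed

lemma trailing_ones_answer:
  assumes "encodes_answer y B v"
  shows "trailing_ones y = v"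
proof -
  have "takeWhile id (replicate v True @ False # z) = replicate v True" for z
    by (induction v) auto
  with assms show ?thesis
    by (auto simp: encodes_answer_def enc_nat_def enc_list_def trailing_ones_def)
qed

section \<open>Generating the instance\<close>

lemma gen_append_same: "gen A f \<Longrightarrow> gen A g \<Longrightarrow> gen A (\<lambda>e x. f e x @ g e x)"
  using gen_append[of A f A g] by simp

lemma gen_if_same:
  "dec P \<Longrightarrow> gen A f \<Longrightarrow> gen A g \<Longrightarrow> gen A (\<lambda>e x. if P e x then f e x else g e x)"
  using gen_if[of P A f A g] by simp

lemma gen_const_any: "gen A (\<lambda>e x. w)"
  using gen_mono[OF gen_const] by blast

lemma gen_concat_const:
  "(\<And>a. a \<in> set as \<Longrightarrow> gen A (f a)) \<Longrightarrow> gen A (\<lambda>e x. concat (map (\<lambda>a. f a e x) as))"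
  by (induction as) (auto intro: gen_append_same gen_const_any)

text \<open>The body reads the current tuple off the variables as \<open>map e [b..<b + d]\<close>.
  By \<open>inv\<close> it looks at these variables in no other way, so the result can be stated
  with the tuple as a parameter.\<close>

lemma gen_tuples_block:
  assumes F: "gen A (\<lambda>e x. F (map e [b..<b + d]) e x)"
    and inv: "\<And>l e x. length l = d \<Longrightarrow> F l (upd b l e) x = F l e x"
    and A: "A \<inter> {b..<b + d} = {}" "w \<notin> {b..<b + d}"
  shows "gen (A \<union> {b..<b + d}) (\<lambda>e x. concat (map (\<lambda>l. F l e x) (tuples d (e w))))"
proof -
  have "map (upd b l e) [b..<b + length l] = l" for l e
    by (rule nth_equalityI) (auto simp: upd_apply)
  then have "concat (map (\<lambda>l. F (map (upd b l e) [b..<b + d]) (upd b l e) x) (tuples d (e w))) =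
      concat (map (\<lambda>l. F l e x) (tuples d (e w)))" for e x
    using inv by (intro arg_cong[of _ _ concat] map_cong refl) (auto simp: set_tuples)
  then show ?thesis
    using gen_tuples[OF F A] by simp
qed

text \<open>\<open>enc_word\<close> without its end mark; it commutes with concatenation, so the
  code of a list can be emitted number by number.\<close>

definition dbl :: "word \<Rightarrow> word" where
  "dbl w = concat (map (\<lambda>b. [True, b]) w)"

lemma dbl_append: "dbl (v @ w) = dbl v @ dbl w"
  by (simp add: dbl_def)

lemma enc_word_eq_dbl: "enc_word w = dbl w @ [False]"
  by (simp add: enc_word_def enc_list_def dbl_def)

lemma gen_dbl_enc_nat:
  assumes "z \<noteq> v"
  shows "gen {z} (\<lambda>e x. dbl (enc_nat (e v)))"
proof -
  have "dbl (enc_nat n) = concat (map (\<lambda>i. [True, True]) [0..<n]) @ [True, False]" for n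
    by (simp add: dbl_def enc_nat_def map_replicate_const)
  moreover have "gen {z} (\<lambda>e x. concat (map (\<lambda>i. [True, True]) [0..<e v]) @ [True, False])"
    using gen_for[of "{}" "\<lambda>e x. [True, True]" z v] assms
    by (intro gen_append_same gen_const_any) (simp_all add: gen_const_any)
  ultimately show ?thesis
    by simp
qed

lemma gen_dbl_code:
  "z \<notin> set vs \<Longrightarrow> gen {z} (\<lambda>e x. dbl (code (map e vs)))"
proof (induction vs)
  case Nil
  then show ?case
    by (simp add: dbl_def gen_const_any)
next
  case (Cons v vs)
  then show ?case
    by (auto simp: dbl_append intro!: gen_append_same gen_dbl_enc_nat)
qed

lemma gen_enc_code:
  "z \<notin> set vs \<Longrightarrow> gen {z} (\<lambda>e x. enc_word (code (a # map e vs)))"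
  by (auto simp: enc_word_eq_dbl dbl_append intro!: gen_append_same gen_dbl_code gen_const_any)

text \<open>Variables 10 to 27 hold the three tuples of an entry of \<open>edge_list\<close>, and 30
  is the counter for emitting unary numbers. Variables 1 and 2 are reserved for \<open>G\<close> and
  \<open>N\<close>.\<close>

lemma gen_group:
  "gen {30} (\<lambda>e x. enc_list enc_word
     (group_of r t (map e [10..<16]) (map e [16..<22]) (map e [22..<28])))"
  unfolding group_of_def block_def common_def enc_list_def map_append concat_append
    append.assoc list.map concat.simps map_map o_def append_Nil append_Cons
  by (intro gen_append_same gen_const_any gen_enc_code gen_concat_const
      gen_append_same[of _ "\<lambda>e x. [True]", unfolded append_Cons append_Nil]) auto

lemma dec_eq_zeros: "dec (\<lambda>e x. map e [b..<b + d] = replicate d 0)"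
proof (induction d arbitrary: b)
  case (Suc d)
  have "[b..<b + Suc d] = b # [Suc b..<Suc b + d]"
    by (simp add: upt_conv_Cons)
  then show ?case
    by (simp only: list.map replicate.simps list.inject) (intro dec_intros val_intros Suc)
qed (simp add: dec_const)

text \<open>\<open>H\<close> is a parameter because the same loops serve to write the groups and to
  count them.\<close>

lemma gen_edge_list:
  assumes H: "gen {30} (\<lambda>e x. H (map e [10..<16], map e [16..<22], map e [22..<28]))"
  shows "gen {10..30} (\<lambda>e x. concat (map H (edge_list (conflict P x (e 1) (e 2)) t (e 2))))"
proof -
  define F where "F = (\<lambda>v w j (e :: env) x.
     if lex_less v w \<and> (conflict P x (e 1) (e 2) v w \<or> conflict P x (e 1) (e 2) w v) \<and>
       (t = 1 \<longrightarrow> j = replicate 6 0) then H (v, w, j) else [])"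
  have upd_outside: "map (upd b l e) [c..<c'] = map e [c..<c']"
    if "c' \<le> b \<or> b + length l \<le> c" for b l e c c'
    using that by (auto simp: upd_apply)
  have "gen {30} (\<lambda>e x. F (map e [10..<10 + 6]) (map e [16..<16 + 6]) (map e [22..<22 + 6]) e x)"
    unfolding F_def
    by (intro gen_if_same gen_const_any dec_intros dec_lex_less dec_conflict dec_eq_zeros val_intros)
      (use H in simp)
  from gen_tuples_block[of _ "\<lambda>j e x. F (map e [10..<10 + 6]) (map e [16..<16 + 6]) j e x", OF this, of 2]
  have "gen ({30} \<union> {22..<22 + 6}) (\<lambda>e x. concat (map (\<lambda>j.
      F (map e [10..<10 + 6]) (map e [16..<16 + 6]) j e x) (tuples 6 (e 2))))"
    by (simp add: F_def upd_apply upd_outside)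
  from gen_tuples_block[of _ "\<lambda>w e x. concat (map (\<lambda>j. F (map e [10..<10 + 6]) w j e x) (tuples 6 (e 2)))",
      OF this, of 2]
  have "gen ({30} \<union> {22..<22 + 6} \<union> {16..<16 + 6}) (\<lambda>e x. concat (map (\<lambda>w. concat (map (\<lambda>j.
      F (map e [10..<10 + 6]) w j e x) (tuples 6 (e 2)))) (tuples 6 (e 2))))"
    by (simp add: F_def upd_apply upd_outside)
  moreover have "({30} \<union> {22..<22 + 6} \<union> {16..<16 + 6}) \<inter> {10..<10 + 6} = ({} :: nat set)"
    by auto
  ultimately have "gen ({30} \<union> {22..<22 + 6} \<union> {16..<16 + 6} \<union> {10..<10 + 6})
     (\<lambda>e x. concat (map (\<lambda>v. concat (map (\<lambda>w. concat (map (\<lambda>j.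
      F v w j e x) (tuples 6 (e 2)))) (tuples 6 (e 2)))) (tuples 6 (e 2))))"
    by (intro gen_tuples_block[of _ "\<lambda>v e x. concat (map (\<lambda>w. concat (map (\<lambda>j. F v w j e x)
      (tuples 6 (e 2)))) (tuples 6 (e 2)))"]) (assumption | simp add: F_def upd_apply)+
  then have "gen {10..30} (\<lambda>e x. concat (map (\<lambda>v. concat (map (\<lambda>w. concat (map (\<lambda>j.
      F v w j e x) (tuples 6 (e 2)))) (tuples 6 (e 2)))) (tuples 6 (e 2))))"
    by (rule gen_mono) auto
  moreover have "concat (map H (if b then [p] else [])) = (if b then H p else [])" for b p
    by simp
  ultimately show ?thesis
    by (simp add: edge_list_def concat_map_concat o_def F_def)
qed

lemma concat_map_replicate:
  "concat (map (\<lambda>i. replicate c b) xs) = replicate (length xs * c) b"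
  by (induction xs) (simp_all add: replicate_add)

lemma concat_map_remove:
  "distinct xs \<Longrightarrow> concat (map (\<lambda>l. if l = z then [] else [b]) xs) =
     replicate (length xs - of_bool (z \<in> set xs)) b"
proof (induction xs)
  case (Cons x xs)
  show ?case
  proof (cases "z \<in> set xs")
    case True
    then have "length xs = Suc (length xs - 1)"
      using length_pos_if_in_set by fastforce
    then have "replicate (length xs) b = b # replicate (length xs - 1) b"
      by (metis replicate_Suc)
    then show ?thesis
      using Cons True by auto
  qed (use Cons in auto)
qed simp

text \<open>Loops cannot subtract, but \<open>N ^ 6 - N ^ 2 = N * (N * (N ^ 4 - 1))\<close>, and
  \<open>N ^ 4 - 1\<close> bits come from a loop over 4-tuples that skips the zero tuple.\<close>

lemma gen_budget: "gen {10..30} (\<lambda>e x. replicate (e 2 ^ 6 - e 2 ^ 2) True)"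
proof -
  have 0: "gen ({} \<union> {10..<10 + 4})
      (\<lambda>e x. concat (map (\<lambda>l. if l = replicate 4 0 then [] else [True]) (tuples 4 (e 2))))"
  proof (rule gen_tuples_block)
    show "gen {} (\<lambda>e x. if map e [10..<10 + 4] = replicate 4 0 then [] else [True])"
      by (intro gen_if_same gen_const_any dec_eq_zeros)
  qed auto
  have "gen (insert 15 (insert 14 ({} \<union> {10..<10 + 4}))) (\<lambda>e x. concat (map (\<lambda>_. concat (map (\<lambda>_.
      concat (map (\<lambda>l. if l = replicate 4 0 then [] else [True]) (tuples 4 (e 2)))) [0..<e 2])) [0..<e 2]))"
    using gen_for[OF gen_for[OF 0, of 14 2], of 15 2] by simp
  then have "gen {10..30} (\<lambda>e x. concat (map (\<lambda>_. concat (map (\<lambda>_.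
      concat (map (\<lambda>l. if l = replicate 4 0 then [] else [True]) (tuples 4 (e 2)))) [0..<e 2])) [0..<e 2]))"
    by (rule gen_mono) auto
  moreover have "concat (map (\<lambda>_. concat (map (\<lambda>_. concat (map (\<lambda>l.
      if l = replicate 4 0 then [] else [True]) (tuples 4 N))) [0..<N])) [0..<N]) =
      replicate (N ^ 6 - N ^ 2) True" for N
  proof (cases "N = 0")
    case False
    then have "replicate 4 0 \<in> set (tuples 4 N)"
      by (auto simp: set_tuples)
    then have "concat (map (\<lambda>l. if l = replicate 4 0 then [] else [True]) (tuples 4 N)) =
        replicate (N ^ 4 - 1) True"
      by (simp only: concat_map_remove[OF distinct_tuples] length_tuples) simp
    moreover have "N * (N * (N ^ 4 - 1)) = N ^ 6 - N ^ 2"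
      by (simp add: right_diff_distrib' power2_eq_square eval_nat_numeral)
    ultimately show ?thesis
      by (simp add: concat_map_replicate)
  qed simp
  ultimately show ?thesis
    by simp
qed

lemma gen_nodes: "gen {10..30} (\<lambda>e x. enc_list enc_word (node_list r t (e 2)))"
proof -
  have "gen ({30} \<union> {10..<10 + 6}) (\<lambda>e x. concat (map (\<lambda>l. True # enc_word (code (a # l))) (tuples 6 (e 2))))" for a
  proof (rule gen_tuples_block)
    have "gen {30} (\<lambda>e x. [True] @ enc_word (code (a # map e [10..<10 + 6])))"
      by (intro gen_append_same gen_const_any gen_enc_code) simp
    then show "gen {30} (\<lambda>e x. True # enc_word (code (a # map e [10..<10 + 6])))"
      by (simp only: append_Cons append_Nil)
  qed auto
  then have 1: "gen {10..30} (\<lambda>e x. concat (map (\<lambda>l. True # enc_word (code (a # l))) (tuples 6 (e 2))))" for a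
    by (rule gen_mono) auto
  have "enc_list enc_word (node_list r t N) =
      concat (map (\<lambda>a. concat (map (\<lambda>l. True # enc_word (code (a # l))) (tuples 6 N))) [0..<t]) @
      concat (map (\<lambda>a. True # enc_word (code [a])) [0..<r - 1]) @ [False]" for N
    by (simp add: enc_list_def node_list_def concat_map_concat o_def del: code_simps)
  then show ?thesis
    by (simp only:) (intro gen_append_same gen_concat_const gen_const_any 1)
qed

lemma gen_instance:
  "gen {10..30} (\<lambda>e x. instance_word (conflict P x (e 1) (e 2)) r t (e 2))"
proof -
  have "gen {30} (\<lambda>e x. True # enc_list enc_word
     (group_of r t (map e [10..<16]) (map e [16..<22]) (map e [22..<28])))"
    using gen_append_same[OF gen_const_any gen_group, of "[True]"] by simp
  from gen_edge_list[of "\<lambda>(v, w, j). True # enc_list enc_word (group_of r t v w j)",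
      unfolded prod.case, OF this]
  have 1: "gen {10..30} (\<lambda>e x. enc_list (enc_list enc_word)
      (group_list (conflict P x (e 1) (e 2)) r t (e 2)))"
    unfolding enc_list_def[of "enc_list enc_word"]
    by (intro gen_append_same gen_const_any) (simp add: group_list_def o_def case_prod_unfold)
  have "enc_nat (budget r N) = replicate (N ^ 6 - N ^ 2) True @ enc_nat (r - 1)" for N
    by (simp add: budget_def enc_nat_def replicate_add)
  then show ?thesis
    unfolding instance_word_def
    by (simp only:) (intro gen_append_same gen_nodes 1 gen_budget gen_const_any)
qed

lemma gen_count:
  "gen {10..30} (\<lambda>e x. replicate (length (edge_list (conflict P x (e 1) (e 2)) t (e 2))) True)"
proof -
  have "gen {10..30} (\<lambda>e x. concat (map (\<lambda>_. [True])
      (edge_list (conflict P x (e 1) (e 2)) t (e 2))))"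
    by (rule gen_edge_list) (rule gen_const_any)
  then show ?thesis
    by (simp add: map_replicate_const)
qed

section \<open>The reduction\<close>

lemma poly_nat_mono: "a \<le> b \<Longrightarrow> poly (p :: nat poly) a \<le> poly p b"
  by (induction p) (auto intro: add_mono mult_mono)

lemma computes_within_mono:
  assumes "computes_within P ws t out" "t \<le> t'"
  shows "computes_within P ws t' out"
proof -
  obtain c where c: "(step P ^^ t) (start ws) = c" "length P \<le> fst c" "snd c 0 = out"
    using assms(1) by (auto simp: computes_within_def Let_def)
  then show ?thesis
    using steps_halted[OF c(1,2) assms(2)] by (simp add: computes_within_def)
qed

text \<open>\<open>m\<close> lets \<open>N\<close> be made large compared with \<open>r\<close>, as
  the gadget requires; the tableau itself knows nothing of \<open>r\<close>.\<close>

lemma NP_tableau: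
  assumes "L \<in> NP"
  shows "\<exists>P (p :: nat poly) (q :: nat poly). (\<forall>n. m + 2 \<le> poly q n) \<and>
    (\<forall>x. x \<in> L \<longleftrightarrow> (\<exists>C\<subseteq>set (tuples 6 (poly q (length x))). card C = poly q (length x) ^ 2 \<and>
      independent_set (conflict P (rev x) (poly p (length x)) (poly q (length x))) C))"
proof -
  obtain V and p :: "nat poly" where V: "polytime_relation V"
    and L: "\<And>x. x \<in> L \<longleftrightarrow> (\<exists>y. length y \<le> poly p (length x) \<and> V x y)"
    using assms by (auto simp: NP_def)
  obtain P and s :: "nat poly" where P: "\<And>x y. computes_within P [x, y] (poly s (length x + length y)) [V x y]"
    using V by (auto simp: polytime_relation_def)
  obtain c where c: "length P \<le> c" "\<forall>I\<in>set P. instr_le c I"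
    using instr_le_exists by blast
  \<comment> \<open>A time bound for all admissible certificates at once: input and certificate
    together have length at most \<open>n + poly p n\<close>.\<close>
  define T where "T = pcompose s ([:0, 1:] + p)"
  \<comment> \<open>The sum of everything that must fit below \<open>N\<close>: the prologue, the
    running time, the constant of the verifier and the demand \<open>m + 2\<close>.\<close>
  define q where "q = [:0, 1:] + p + T + [:c + m + 3:]"
  have q: "poly q n = n + poly p n + poly T n + (c + m + 3)" for n
    by (simp add: q_def)
  have time: "computes_within P [x, y] (poly T (length x)) [V x y]"
    if "length y \<le> poly p (length x)" for x y
    by (rule computes_within_mono[OF P]) (use that in \<open>auto simp: T_def poly_pcompose intro: poly_nat_mono\<close>)
  have "x \<in> L \<longleftrightarrow> (\<exists>C\<subseteq>set (tuples 6 (poly q (length x))). card C = poly q (length x) ^ 2 \<and>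
      independent_set (conflict P (rev x) (poly p (length x)) (poly q (length x))) C)" for x
  proof -
    let ?X = "rev x" and ?G = "poly p (length x)" and ?N = "poly q (length x)" and ?T = "poly T (length x)"
    have N: "length x + ?G + ?T < ?N" "c < ?N" "2 < ?N" "length ?X + ?G < ?N"
      by (auto simp: q)
    have "x \<in> L \<longleftrightarrow> (\<exists>pc \<sigma>. accepting_run P ?X ?G ?N pc \<sigma>)"
    proof
      assume "x \<in> L"
      then obtain y where y: "length y \<le> ?G" "V x y"
        using L by blast
      show "\<exists>pc \<sigma>. accepting_run P ?X ?G ?N pc \<sigma>"
        by (rule accepting_run_complete[where x = x and y = y and V = V])
          (rule refl y time[OF y(1)] c N(1-3))+
    next
      assume "\<exists>pc \<sigma>. accepting_run P ?X ?G ?N pc \<sigma>"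
      then obtain pc \<sigma> where "accepting_run P ?X ?G ?N pc \<sigma>"
        by blast
      then have "\<exists>y. length y \<le> ?G \<and> V x y"
        by (rule accepting_run_sound) (use time N in auto)
      then show "x \<in> L"
        using L by blast
    qed
    also have "\<dots> \<longleftrightarrow> (\<exists>C\<subseteq>set (tuples 6 ?N). card C = ?N ^ 2 \<and> independent_set (conflict P ?X ?G ?N) C)"
      using run_imp_independent[of P ?X ?G ?N] independent_imp_run[of _ ?N P ?X ?G c] c(2) N
      by blast
    finally show ?thesis .
  qed
  moreover have "m + 2 \<le> poly q n" for n
    by (simp add: q)
  ultimately show ?thesis
    by blast
qed

lemma prep_params:
  "prep (\<lambda>x y. (\<lambda>_. 0)(0 := length x, 3 := trailing_ones y, 1 := poly p (length x), 2 := poly q (length x)))"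
proof -
  obtain m where "\<forall>b>0. gen {b..<b + m} (\<lambda>e x. replicate (poly p (e 0)) True)"
    using gen_replicate_poly by blast
  \<comment> \<open>Loop variables from 40 on are clear of the parameters stored in 0 to 3.\<close>
  then have m: "gen {40..<40 + m} (\<lambda>e x. replicate (poly p (e 0)) True)"
    using zero_less_numeral by blast
  obtain m' where "\<forall>b>0. gen {b..<b + m'} (\<lambda>e x. replicate (poly q (e 0)) True)"
    using gen_replicate_poly by blast
  then have m': "gen {40..<40 + m'} (\<lambda>e x. replicate (poly q (e 0)) True)"
    using zero_less_numeral by blast
  have "prep (\<lambda>x y. (\<lambda>_. 0)(0 := length x, 3 := trailing_ones y, 1 := poly p (length x)))"
    by (rule prep_update[OF prep_init m]) auto
  then show ?thesis
    by (rule prep_update[OF _ m']) auto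
qed

lemma corruption_problemI:
  assumes "encodes_instance w S \<A> s" "encodes_answer y B v" "valid_instance \<mu> k p S \<A> s"
    "optimal_answer \<mu> k S \<A> s B v"
  shows "(w, y) \<in> corruption_problem \<mu> k p"
  unfolding corruption_problem_def mem_Collect_eq prod.case
  by (intro exI conjI) (rule assms)+

lemma corruption_problemE:
  assumes "(w, y) \<in> corruption_problem \<mu> k p" "encodes_instance w S \<A> s"
  obtains B v where "encodes_answer y B v" "optimal_answer \<mu> k S \<A> s B v"
proof -
  obtain S' \<A>' s' B v where *: "encodes_instance w S' \<A>' s'" "encodes_answer y B v"
    "optimal_answer \<mu> k S' \<A>' s' B v"
    using assms(1) unfolding corruption_problem_def mem_Collect_eq prod.case by (elim exE conjE)
  have eq: "S' = S" "\<A>' = \<A>" "s' = s"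
    using encodes_instance_unique[OF *(1) assms(2)] by auto
  show ?thesis
    by (rule that) (use * in \<open>simp_all only: eq\<close>)
qed

theorem theorem5:
  fixes r k :: nat and \<mu> :: real
  assumes "1 \<le> r" and "r < k" and "r = threshold \<mu> k"
  shows "\<exists>p. NP_hard (corruption_problem \<mu> k p)"
proof -
  define t where "t = k - r"
  have t: "1 \<le> t" "t \<noteq> 0" "k = r + t"
    using assms by (auto simp: t_def)
  have thr: "threshold \<mu> (r + t) = r"
    using assms(3) t(3) by simp
  have "reduces_to L (corruption_problem \<mu> k (monom 1 3))" if L: "L \<in> NP" for L
  proof -
    obtain P and p q :: "nat poly" where ge: "\<forall>n. r + 2 \<le> poly q n"
      and iff: "\<forall>x. x \<in> L \<longleftrightarrow> (\<exists>C\<subseteq>set (tuples 6 (poly q (length x))). card C = poly q (length x) ^ 2 \<and>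
        independent_set (conflict P (rev x) (poly p (length x)) (poly q (length x))) C)"
      using NP_tableau[OF L, of r] by (elim exE conjE)
    define N where "N = (\<lambda>x :: word. poly q (length x))"
    define K where "K = (\<lambda>x. conflict P (rev x) (poly p (length x)) (N x))"
    define g where "g = (\<lambda>x. instance_word (K x) r t (N x))"
    define m where "m = (\<lambda>x. length (edge_list (K x) t (N x)))"
    \<comment> \<open>Only the value in the answer is read, so any optimal set serves. The value
      never exceeds the number of groups, so \<le> asks whether all groups can be corrupted.\<close>
    define h where "h = (\<lambda>x y. m x \<le> trailing_ones y)"
    let ?E = "\<lambda>x y. (\<lambda>_. 0)(0 := length x, 3 := trailing_ones y, 1 := poly p (length x),
      2 := poly q (length x)) :: env"
    note E = prep_params[of p q]
    have "polytime_function g"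
    proof -
      have "polytime_function (\<lambda>x. instance_word (conflict P (rev x) (?E x [] 1) (?E x [] 2)) r t (?E x [] 2))"
        by (rule polytime_functionI[OF E gen_instance]) auto
      then show ?thesis
        by (simp add: g_def K_def N_def)
    qed
    moreover have "polytime_relation h"
    proof -
      \<comment> \<open>Variable 4 receives the number of groups, recomputed from \<open>x\<close>
        by the loops that write the instance.\<close>
      have E': "prep (\<lambda>x y. (?E x y)(4 := m x))"
        by (rule prep_update[OF E gen_count[of P t]]) (auto simp: m_def K_def N_def)
      have "gen {} (\<lambda>e x. if e 4 \<le> e 3 then [True] else [False])"
        by (intro gen_if_same dec_intros val_intros gen_const_any)
      then show ?thesis
        by (rule polytime_relationI[OF E']) (auto simp: h_def)
    qed
    moreover have "g x \<in> Domain (corruption_problem \<mu> k (monom 1 3)) \<and>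
      (\<forall>y. (g x, y) \<in> corruption_problem \<mu> k (monom 1 3) \<longrightarrow> (x \<in> L \<longleftrightarrow> h x y))" for x
    proof -
      let ?S = "set (node_list r t (N x))" and ?A = "set ` set (group_list (K x) r t (N x))"
      let ?s = "budget r (N x)"
      have N: "2 \<le> N x" "r \<le> N x"
        using spec[OF ge, of "length x"] by (auto simp: N_def)
      have enc: "encodes_instance (g x) ?S ?A ?s"
        unfolding g_def by (rule encodes_instance_word[OF t(2)])
      have valid: "valid_instance \<mu> k (monom 1 3) ?S ?A ?s"
        unfolding t(3) by (rule valid_instance_word) (rule assms(1) t(1) N(1) thr)+
      obtain B v where opt: "optimal_answer \<mu> k ?S ?A ?s B v"
        using optimal_answer_exists[OF valid] by blast
      then have "finite B"
        by (auto simp: optimal_answer_def intro: finite_subset)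
      then obtain xs where "set xs = B" "distinct xs"
        using finite_distinct_list by blast
      then have "encodes_answer (enc_list enc_word xs @ enc_nat v) B v"
        by (auto simp: encodes_answer_def)
      then have "g x \<in> Domain (corruption_problem \<mu> k (monom 1 3))"
        using corruption_problemI[OF enc _ valid opt] by blast
      moreover have "x \<in> L \<longleftrightarrow> h x y" if y: "(g x, y) \<in> corruption_problem \<mu> k (monom 1 3)" for y
      proof -
        obtain B v where ans: "encodes_answer y B v" and opt: "optimal_answer \<mu> k ?S ?A ?s B v"
          by (rule corruption_problemE[OF y enc])
        have "h x y \<longleftrightarrow> card ?A \<le> v"
          by (simp add: h_def m_def trailing_ones_answer[OF ans] card_groups[OF t(2)])
        also have "\<dots> \<longleftrightarrow> (\<exists>B\<subseteq>?S. card B = ?s \<and> (\<forall>A\<in>?A. r \<le> card (A \<inter> B)))"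
          using optimal_answer_eq_iff[OF valid opt] assms(3) by simp
        also have "\<dots> \<longleftrightarrow> (\<exists>C\<subseteq>set (tuples 6 (N x)). card C = N x ^ 2 \<and> independent_set (K x) C)"
          by (rule hit_all_iff_independent) (use assms(1) t(1) N in \<open>auto simp: K_def conflict_def\<close>)
        also have "\<dots> \<longleftrightarrow> x \<in> L"
          using iff unfolding K_def N_def by simp
        finally show ?thesis ..
      qed
      ultimately show ?thesis
        by blast
    qed
    ultimately show ?thesis
      unfolding reduces_to_def by blast
  qed
  then show ?thesis
    unfolding NP_hard_def by blast
qed

end
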